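(* Let $p_{23}(m)$ be defined by $\sum_{m\ge0}p_{23}(m)q^m=\prod_{k=1}^\infty(1-q^k)^{23}$. For every integer $n\ge1$, $$\begin{aligned}p_{23}(n-1)&=\tfrac{1}{897196601564928}\bigl(-57917897540518785552\,n^{5}+30652078276547889552\,n^{4}+5952274737922797228\,n^{3}\\ &\qquad-2214892612179680256\,n^{2}+188772676333745691\,n-4410708034409819\bigr)M_{2}(n)\\ &\quad+\tfrac{5}{224299150391232}\bigl(4089872889595634400\,n^{4}-3320629034843596140\,n^{3}+593555423164294752\,n^{2}\\ &\qquad-40741028214970311\,n+815166233039851\bigr)M_{4}(n)\\ &\quad+\tfrac{13}{7120607948928}\bigl(-4612652508217680\,n^{3}+2500384365901740\,n^{2}-190834728931028\,n+5730847932535\bigr)M_{6}(n)\\ &\quad+\tfrac{65}{24922127821248}\bigl(431597256867684\,n^{2}-112947999359631\,n+3472477850182\bigr)M_{8}(n)\\ &\quad+\tfrac{143}{600533200512}\bigl(-555655003092\,n+33496841951\bigr)M_{10}(n)+\tfrac{16986177}{1919176}M_{12}(n)\\ &\quad+\tfrac{24599722121}{3316336128}\bigl(-46656\,n^{5}+45360\,n^{4}-12096\,n^{3}+1296\,n^{2}-60\,n+1\bigr)N_{2}(n)\\ &\quad-\tfrac{24599722121}{3316336128}N_{12}(n).\end{aligned}$$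
   Context: The rank of a partition is its largest part minus its number of parts. $N(m,n)$ is the number of partitions of $n$ with rank $m$; $N(0,0)=1$ and $N(m,0)=0$ for $m\ne0$. The crank of a partition is its largest part if the partition contains no ones; otherwise it is (the number of parts larger than the number of ones) minus (the number of ones). For $n\ge2$, $M(m,n)$ is the number of partitions of $n$ with crank $m$. By convention $M(0,0)=1$ and $M(m,0)=0$ for $m\neq0$; and $M(0,1)=-1$, $M(-1,1)=M(1,1)=1$, $M(m,1)=0$ otherwise. With these conventions it is known that $\sum_{n\ge0}\sum_m M(m,n)z^mq^n=\prod_{n\ge1}\frac{1-q^n}{(1-zq^n)(1-z^{-1}q^n)}$. For even $j\ge2$ the rank and crank moments are $N_j(n)=\sum_{k\in\mathbb Z}k^jN(k,n)$ and $M_j(n)=\sum_{k\in\mathbb Z}k^jM(k,n)$. *)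

theory Defs
  imports "HOL-Analysis.Analysis" "HOL-Library.Groups_Big_Fun"
begin

definition partitions :: "nat \<Rightarrow> nat multiset set" where
  "partitions n = {P. 0 \<notin># P \<and> sum_mset P = n}"

lemma finite_partitions: "finite (partitions n)"
proof (rule finite_subset)
  show "partitions n \<subseteq> (\<lambda>xs. mset xs) ` {xs. set xs \<subseteq> {..n} \<and> length xs \<le> n}"
  proof
    fix P assume P: "P \<in> partitions n"
    obtain xs where xs: "P = mset xs" by (metis ex_mset)
    have s: "sum_list xs = n" and z: "0 \<notin> set xs"
      using P by (auto simp: xs partitions_def sum_mset_sum_list)
    have "set xs \<subseteq> {..n}" using s by (auto dest: member_le_sum_list)
    moreover have "length xs \<le> sum_list xs" using z by (induction xs) auto
    ultimately show "P \<in> (\<lambda>xs. mset xs) ` {xs. set xs \<subseteq> {..n} \<and> length xs \<le> n}"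
      using s xs by auto
  qed
  show "finite ((\<lambda>xs. mset xs) ` {xs. set xs \<subseteq> {..n} \<and> length xs \<le> n})"
    by (intro finite_imageI finite_lists_length_le) simp
qed

text \<open>
  Rank and crank are meant for nonempty partitions only (on the empty one, \<open>Max\<close> is unspecified);
  the counting functions below fix the values for \<open>n = 0\<close> (and \<open>n = 1\<close> for the crank) by convention.
\<close>

definition partition_rank :: "nat multiset \<Rightarrow> int" where
  "partition_rank P = int (Max (set_mset P)) - int (size P)"

definition partition_crank :: "nat multiset \<Rightarrow> int" where
  "partition_crank P =
     (if 1 \<notin># P then int (Max (set_mset P))
      else int (size {#p \<in># P. p > count P 1#}) - int (count P 1))"

definition rank_count :: "int \<Rightarrow> nat \<Rightarrow> int" where
  "rank_count m n =
     (if n = 0 then (if m = 0 then 1 else 0)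
      else int (card {P \<in> partitions n. partition_rank P = m}))"

definition crank_count :: "int \<Rightarrow> nat \<Rightarrow> int" where
  "crank_count m n =
     (if n = 0 then (if m = 0 then 1 else 0)
      else if n = 1 then (if m = 0 then - 1 else if m = 1 \<or> m = - 1 then 1 else 0)
      else int (card {P \<in> partitions n. partition_crank P = m}))"

lemma finite_rank_count_support: "finite {m. rank_count m n \<noteq> 0}"
proof (rule finite_subset)
  show "{m. rank_count m n \<noteq> 0} \<subseteq> insert 0 (partition_rank ` partitions n)"
  proof
    fix m assume "m \<in> {m. rank_count m n \<noteq> 0}"
    then have "n = 0 \<and> m = 0 \<or> {P \<in> partitions n. partition_rank P = m} \<noteq> {}"
      by (auto simp: rank_count_def card_gt_0_iff split: if_splits)
    then show "m \<in> insert 0 (partition_rank ` partitions n)" by auto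
  qed
qed (simp add: finite_partitions)

lemma finite_crank_count_support: "finite {m. crank_count m n \<noteq> 0}"
proof (rule finite_subset)
  show "{m. crank_count m n \<noteq> 0} \<subseteq> {- 1, 0, 1} \<union> partition_crank ` partitions n"
  proof
    fix m assume "m \<in> {m. crank_count m n \<noteq> 0}"
    then have "m \<in> {- 1, 0, 1} \<or> {P \<in> partitions n. partition_crank P = m} \<noteq> {}"
      by (auto simp: crank_count_def card_gt_0_iff split: if_splits)
    then show "m \<in> {- 1, 0, 1} \<union> partition_crank ` partitions n" by auto
  qed
qed (simp add: finite_partitions)

text \<open>
  \<open>Sum_any\<close> is the sum over the whole type \<open>int\<close>; by the two lemmas above, only finitely many
  summands are nonzero.
\<close>

definition rank_moment :: "nat \<Rightarrow> nat \<Rightarrow> int" where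
  "rank_moment j n = Sum_any (\<lambda>k. k ^ j * rank_count k n)"

definition crank_moment :: "nat \<Rightarrow> nat \<Rightarrow> int" where
  "crank_moment j n = Sum_any (\<lambda>k. k ^ j * crank_count k n)"

text \<open>
  The infinite product is taken in the topology of formal power series. Its factors are indexed
  from \<open>0\<close>, so factor \<open>k\<close> is \<open>(1 - q\<^sup>k\<^sup>+\<^sup>1)\<^sup>2\<^sup>3\<close>. It converges by \<open>convergent_prod_p23\<close> below.
\<close>

definition p23 :: "nat \<Rightarrow> int" where
  "p23 m = fps_nth (prodinf (\<lambda>k. (1 - fps_X ^ Suc k) ^ 23)) m"

lemma convergent_prod_p23: "convergent_prod (\<lambda>k. (1 - fps_X ^ Suc k :: int fps) ^ 23)"
proof -
  define f :: "nat \<Rightarrow> int fps" where "f k = (1 - fps_X ^ Suc k) ^ 23" for k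
  have low: "\<exists>u. f k = 1 + fps_X ^ Suc k * u" for k
  proof -
    have "(fps_X ^ Suc k :: int fps) dvd f k - 1"
    proof -
      have "(1 - fps_X ^ Suc k) - 1 dvd f k - (1 :: int fps) ^ 23"
        unfolding f_def power_diff_sumr2 by (rule dvd_triv_left)
      then show ?thesis by (simp del: power_Suc)
    qed
    then obtain u where "f k - 1 = fps_X ^ Suc k * u" by (rule dvdE)
    then have "f k = 1 + fps_X ^ Suc k * u" by (simp only: diff_eq_eq add.commute)
    then show ?thesis ..
  qed
  have step: "fps_nth (\<Prod>i\<le>Suc n. f i) m = fps_nth (\<Prod>i\<le>n. f i) m" if "m \<le> n" for m n
  proof -
    obtain u where u: "f (Suc n) = 1 + fps_X ^ Suc (Suc n) * u" using low by blast
    have "(\<Prod>i\<le>Suc n. f i) = (\<Prod>i\<le>n. f i) + fps_X ^ Suc (Suc n) * (u * (\<Prod>i\<le>n. f i))"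
      by (simp only: prod.atMost_Suc u) (simp only: algebra_simps mult_1_left)
    then show ?thesis using that by (simp add: fps_X_power_mult_nth del: power_Suc prod.atMost_Suc)
  qed
  have stable: "fps_nth (\<Prod>i\<le>n. f i) m = fps_nth (\<Prod>i\<le>m. f i) m" if "m \<le> n" for m n
    using that by (induction n rule: dec_induct) (simp_all only: step)
  define g where "g = Abs_fps (\<lambda>m. fps_nth (\<Prod>i\<le>m. f i) m)"
  have "(\<lambda>n. \<Prod>i\<le>n. f i) \<longlonglongrightarrow> g"
  proof (rule tendsto_fpsI)
    fix m
    show "\<forall>\<^sub>F n in sequentially. fps_nth (\<Prod>i\<le>n. f i) m = fps_nth g m"
      unfolding g_def fps_nth_Abs_fps using eventually_ge_at_top[of m]
      by eventually_elim (rule stable)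
  qed
  moreover have "g \<noteq> 0"
  proof -
    have "fps_nth g 0 = fps_nth (f 0) 0" by (simp add: g_def)
    also have "\<dots> = 1" by (simp add: f_def fps_power_zeroth)
    finally have "fps_nth g 0 = 1" .
    then show ?thesis by auto
  qed
  ultimately show ?thesis
    unfolding convergent_prod_def raw_has_prod_def f_def[symmetric]
    by (intro exI[of _ 0] exI[of _ g]) simp
qed

end

theory Submission
  imports Defs
begin

text \<open>
  Put \<open>x = z\<close> and \<open>y = q / z\<close>. Counting partitions by the number of ones and of parts greater than it shows
  that the series \<open>K\<close> of the numbers of partitions with crank at most \<open>m\<close> is symmetric in \<open>x\<close> and \<open>y\<close>, and
  that \<open>C = (1 - z) K\<close>, the crank series, is symmetric under \<open>z \<rightarrow> 1 / z\<close>. Playing the two symmetries off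
  against each other lowers the power of \<open>q\<close>; by descent they determine the logarithmic derivative of \<open>C\<close>
  and, together with Dyson's symmetry of the rank, give the rank-crank differential equation, which
  expresses \<open>C\<^sup>3\<close> divided by the square of the partition series \<open>P\<close> through the rank.

  Taking moments in \<open>z\<close>, the crank moments and the moments of this cube become \<open>P\<close> times polynomials in
  the divisor-sum series, and the twelfth rank moment reduces to the second one and these. Ramanujan's
  differential equations turn multiplication by \<open>n\<close> into an operation on \<open>P\<close> times polynomials in
  \<open>E\<^sub>2\<close>, \<open>E\<^sub>4\<close>, \<open>E\<^sub>6\<close>. In the given combination all terms cancel except a multiple of \<open>P (E\<^sub>4\<^sup>3 - E\<^sub>6\<^sup>2)\<close>,
  which satisfies the same first-order differential equation as \<open>q \<Prod>n\<ge>1. (1 - q\<^sup>n)\<^sup>2\<^sup>3\<close>.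
\<close>

section \<open>Formal series in q and z\<close>

text \<open>That an identity of this shape exists is a dimension count. Give \<open>E2\<close>,
  \<open>E4\<close>, \<open>E6\<close> the weights 2, 4, 6. There are 23 monomials of weight at most
  12, and multiplication by \<open>n\<close> raises the weight by at most 2. The 21 series with
  coefficients \<open>n^s M_2j(n)\<close>, where \<open>j >= 1\<close> and
  \<open>j + s <= 6\<close>, what remains of \<open>N_12\<close> after its multiple of
  \<open>N_2\<close> is removed, and \<open>P (E4^3 - E6^2)\<close> all lie in \<open>P\<close>
  times the span of these monomials. All have constant term 0, which leaves dimension at most 22 for
  23 series, so they are linearly dependent; the coefficients of the theorem are such a dependence.
  \<open>N_2\<close> has to stay: the moment of order \<open>a\<close> of the cube contains
  \<open>N_a\<close> with the factor \<open>(a - 1)(a - 2) / 2\<close>, which is 0 for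
  \<open>a = 2\<close>. The rank enters through the cube because only that series has a logarithmic
  derivative given by divisor sums. No product formula for the crank and no theta function is used:
  the logarithmic derivative in \<open>z\<close> suffices for all moments. The variables
  \<open>x\<close>, \<open>y\<close> make the hidden symmetry of the crank an exchange of rows and
  columns, so that uniqueness becomes an induction on the row.\<close>

text \<open>A double series in \<open>x\<close> and \<open>y\<close> stands for a series in \<open>q\<close> and \<open>z\<close> by \<open>x = z\<close>, \<open>y = q / z\<close>:
  \<open>coeff2 A n i\<close>, the coefficient of \<open>y\<^sup>n x\<^sup>i\<close>, is that of \<open>q\<^sup>n z\<^sup>i\<^sup>-\<^sup>n\<close>.\<close>

abbreviation coeff2 :: "real fps fps \<Rightarrow> nat \<Rightarrow> nat \<Rightarrow> real" where
  "coeff2 A n i \<equiv> fps_nth (fps_nth A n) i"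

lemma fps2_eqI: "(\<And>n i. coeff2 A n i = coeff2 B n i) \<Longrightarrow> A = B"
  by (simp add: fps_eq_iff)

lemma coeff2_mult:
  "coeff2 (A * B) n i = (\<Sum>k\<le>n. \<Sum>l\<le>i. coeff2 A k l * coeff2 B (n - k) (i - l))"
  by (simp add: fps_mult_nth fps_sum_nth atMost_atLeast0)

definition swap2 :: "real fps fps \<Rightarrow> real fps fps" where
  "swap2 A = Abs_fps (\<lambda>n. Abs_fps (\<lambda>i. coeff2 A i n))"

lemma coeff2_swap2 [simp]: "coeff2 (swap2 A) n i = coeff2 A i n"
  by (simp add: swap2_def)

lemma swap2_mult: "swap2 (A * B) = swap2 A * swap2 B"
proof (rule fps2_eqI)
  fix n i
  show "coeff2 (swap2 (A * B)) n i = coeff2 (swap2 A * swap2 B) n i"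
    by (simp add: coeff2_mult) (rule sum.swap)
qed

text \<open>This is \<open>z d/dz\<close> at fixed \<open>q\<close>, that is
  \<open>x d/dx - y d/dy\<close>; hence the product rule, and hence series in \<open>q\<close> alone
  are constants.\<close>

definition zderiv :: "real fps fps \<Rightarrow> real fps fps" where
  "zderiv A = Abs_fps (\<lambda>n. Abs_fps (\<lambda>i. (real i - real n) * coeff2 A n i))"

lemma coeff2_zderiv [simp]: "coeff2 (zderiv A) n i = (real i - real n) * coeff2 A n i"
  by (simp add: zderiv_def)

lemma zderiv_mult: "zderiv (A * B) = zderiv A * B + A * zderiv B"
proof (rule fps2_eqI)
  fix n i
  have "coeff2 (zderiv (A * B)) n i =
    (\<Sum>k\<le>n. \<Sum>l\<le>i. (real i - real n) * (coeff2 A k l * coeff2 B (n - k) (i - l)))"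
    by (simp add: coeff2_mult sum_distrib_left)
  also have "\<dots> = (\<Sum>k\<le>n. \<Sum>l\<le>i. coeff2 (zderiv A) k l * coeff2 B (n - k) (i - l)
      + coeff2 A k l * coeff2 (zderiv B) (n - k) (i - l))"
    by (intro sum.cong refl) (simp add: of_nat_diff algebra_simps)
  also have "\<dots> = coeff2 (zderiv A * B + A * zderiv B) n i"
    by (simp only: coeff2_mult fps_add_nth sum.distrib)
  finally show "coeff2 (zderiv (A * B)) n i = coeff2 (zderiv A * B + A * zderiv B) n i" .
qed

definition qdiag :: "real fps \<Rightarrow> real fps fps" where
  "qdiag c = Abs_fps (\<lambda>n. fps_const (fps_nth c n) * fps_X ^ n)"

lemma coeff2_qdiag: "coeff2 (qdiag c) n i = (if n = i then fps_nth c n else 0)"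
  by (simp add: qdiag_def)

lemma zderiv_qdiag: "zderiv (qdiag c) = 0"
  by (rule fps2_eqI) (simp add: coeff2_qdiag)

lemma swap2_qdiag: "swap2 (qdiag c) = qdiag c"
  by (rule fps2_eqI) (simp add: coeff2_qdiag)

text \<open>In each power of \<open>q\<close>, a balanced series is a Laurent polynomial in \<open>z\<close> with exponents in \<open>{-n..n}\<close>.\<close>

definition balanced :: "real fps fps \<Rightarrow> bool" where
  "balanced A \<longleftrightarrow> (\<forall>n i. 2 * n < i \<longrightarrow> coeff2 A n i = 0)"

text \<open>Balance turns the triangular range \<open>l <= i\<close> of the Cauchy product into a
  full rectangle of pairs \<open>(l, j)\<close>. The weight \<open>F\<close> is left free: an
  indicator extracts one coefficient (\<open>zsym_mult\<close>), a power of \<open>i - n\<close>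
  gives moments (\<open>zmoment_mult\<close>).\<close>

lemma balanced_sum:
  assumes "balanced A" "balanced B"
  shows "(\<Sum>i\<le>2*n. F i * coeff2 (A * B) n i) =
    (\<Sum>k\<le>n. \<Sum>l\<le>2*k. \<Sum>j\<le>2*(n-k). F (l + j) * (coeff2 A k l * coeff2 B (n - k) j))"
proof -
  have inner: "(\<Sum>i\<le>2*n. \<Sum>l\<le>i. F i * (coeff2 A k l * coeff2 B (n - k) (i - l))) =
      (\<Sum>l\<le>2*k. \<Sum>j\<le>2*(n-k). F (l + j) * (coeff2 A k l * coeff2 B (n - k) j))"
    if k: "k \<le> n" for k
  proof -
    have zero: "coeff2 A k l * coeff2 B (n - k) j = 0" if "\<not> (l \<le> 2*k \<and> j \<le> 2*(n-k))" for l j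
    proof -
      from that have "2*k < l \<or> 2*(n-k) < j" by linarith
      then show ?thesis using assms unfolding balanced_def by auto
    qed
    let ?g = "\<lambda>(l, j). F (l + j) * (coeff2 A k l * coeff2 B (n - k) j)"
    have "(\<Sum>i\<le>2*n. \<Sum>l\<le>i. F i * (coeff2 A k l * coeff2 B (n - k) (i - l))) =
        sum (\<lambda>(i, l). F i * (coeff2 A k l * coeff2 B (n - k) (i - l))) (SIGMA i:{..2*n}. {..i})"
      by (simp add: sum.Sigma)
    also have "\<dots> = sum ?g {(l, j). l + j \<le> 2*n}"
      by (rule sum.reindex_bij_witness[where i = "\<lambda>(l, j). (l + j, l)" and j = "\<lambda>(i, l). (l, i - l)"]) auto
    also have "\<dots> = sum ?g ({..2*k} \<times> {..2*(n-k)})"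
    proof (rule sum.mono_neutral_right)
      show "finite {(l, j). l + j \<le> 2 * n}"
        by (rule finite_subset[of _ "{..2*n} \<times> {..2*n}"]) auto
      show "\<forall>p\<in>{(l, j). l + j \<le> 2 * n} - {..2 * k} \<times> {..2 * (n - k)}. ?g p = 0"
      proof
        fix p assume p: "p \<in> {(l, j). l + j \<le> 2 * n} - {..2 * k} \<times> {..2 * (n - k)}"
        then obtain l j where "p = (l, j)" "\<not> (l \<le> 2*k \<and> j \<le> 2*(n-k))" by auto
        then show "?g p = 0" using zero[of l j] by simp
      qed
    qed (use k in auto)
    also have "\<dots> = (\<Sum>l\<le>2*k. \<Sum>j\<le>2*(n-k). F (l + j) * (coeff2 A k l * coeff2 B (n - k) j))"
      by (simp add: sum.cartesian_product)
    finally show ?thesis .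
  qed
  have "(\<Sum>i\<le>2*n. F i * coeff2 (A * B) n i) =
      (\<Sum>i\<le>2*n. \<Sum>k\<le>n. \<Sum>l\<le>i. F i * (coeff2 A k l * coeff2 B (n - k) (i - l)))"
    by (simp add: coeff2_mult sum_distrib_left)
  also have "\<dots> = (\<Sum>k\<le>n. \<Sum>i\<le>2*n. \<Sum>l\<le>i. F i * (coeff2 A k l * coeff2 B (n - k) (i - l)))"
    by (rule sum.swap)
  also have "\<dots> = (\<Sum>k\<le>n. \<Sum>l\<le>2*k. \<Sum>j\<le>2*(n-k). F (l
      + j) * (coeff2 A k l * coeff2 B (n - k) j))"
    by (intro sum.cong refl inner) simp
  finally show ?thesis .
qed

lemma balanced_mult:
  assumes "balanced A" "balanced B" shows "balanced (A * B)"
  unfolding balanced_def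
proof (intro allI impI)
  fix n i assume i: "2 * n < (i::nat)"
  have "coeff2 A k l * coeff2 B (n - k) (i - l) = 0" if "k \<le> n" "l \<le> i" for k l
  proof (cases "2 * k < l")
    case False
    then have "2 * (n - k) < i - l" using i that by auto
    then show ?thesis using assms by (auto simp: balanced_def)
  qed (use assms in \<open>auto simp: balanced_def\<close>)
  then show "coeff2 (A * B) n i = 0"
    unfolding coeff2_mult by (intro sum.neutral ballI) auto
qed

lemma balanced_qdiag: "balanced (qdiag c)"
  by (auto simp: balanced_def coeff2_qdiag)

text \<open>For balanced series, \<open>i \<rightarrow> 2 * n
    - i\<close> is the substitution \<open>z \<rightarrow> 1 / z\<close>.\<close>

definition zsym :: "real \<Rightarrow> real fps fps \<Rightarrow> bool" where
  "zsym e A \<longleftrightarrow> balanced A \<and> (\<forall>n. \<forall>i\<le>2*n. coeff2 A n (2*n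
      - i) = e * coeff2 A n i)"

lemma sum_atMost_rev: "(\<Sum>i\<le>m. f (m - i)) = (\<Sum>i\<le>(m::nat). f i)"
  by (rule sum.reindex_bij_witness[where i = "\<lambda>i. m - i" and j = "\<lambda>i. m - i"]) auto

lemma sum_atMost_rev_rev:
  "(\<Sum>l\<le>p. \<Sum>j\<le>r. G (p - l) (r - j)) = (\<Sum>l\<le>(p::nat). \<Sum>j\<le>(r::nat). G l j)"
proof -
  have "(\<Sum>l\<le>p. \<Sum>j\<le>r. G (p - l) (r - j)) = (\<Sum>l\<le>p. \<Sum>j\<le>r. G (p - l) j)"
    by (rule sum.cong[OF refl], rule sum_atMost_rev)
  also have "\<dots> = (\<Sum>l\<le>p. \<Sum>j\<le>r. G l j)"
    by (rule sum_atMost_rev[where f = "\<lambda>l. \<Sum>j\<le>r. G l j"])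
  finally show ?thesis .
qed

lemma zsym_mult:
  assumes A: "zsym e A" and B: "zsym d B" shows "zsym (e * d) (A * B)"
  unfolding zsym_def
proof (intro conjI allI impI)
  have bal: "balanced A" "balanced B" using assms by (auto simp: zsym_def)
  then show "balanced (A * B)" by (rule balanced_mult)
  fix n i assume i: "i \<le> 2 * (n::nat)"
  \<comment> \<open>On the rectangle the two exponents can be reflected independently,
    \<open>l\<close> to \<open>2*k - l\<close> and \<open>j\<close> to \<open>2*(n-k) - j\<close>,
    which the triangular range does not allow.\<close>
  have ext: "coeff2 (A * B) n m = (\<Sum>k\<le>n. \<Sum>l\<le>2*k. \<Sum>j\<le>2*(n-k).
      of_bool (l + j = m) * (coeff2 A k l * coeff2 B (n - k) j))" if "m \<le> 2 * n" for m
  proof -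
    have "coeff2 (A * B) n m = (\<Sum>i\<in>{m}. of_bool (i = m) * coeff2 (A * B) n i)" by simp
    also have "\<dots> = (\<Sum>i\<le>2*n. of_bool (i = m) * coeff2 (A * B) n i)"
      by (rule sum.mono_neutral_left) (use that in auto)
    also have "\<dots> = (\<Sum>k\<le>n. \<Sum>l\<le>2*k. \<Sum>j\<le>2*(n-k).
        of_bool (l + j = m) * (coeff2 A k l * coeff2 B (n - k) j))"
      by (rule balanced_sum[OF bal])
    finally show ?thesis .
  qed
  have "coeff2 (A * B) n (2 * n - i) = (\<Sum>k\<le>n. \<Sum>l\<le>2*k. \<Sum>j\<le>2*(n-k).
      of_bool (l + j = 2 * n - i) * (coeff2 A k l * coeff2 B (n - k) j))"
    by (rule ext) simp
  also have "\<dots> = (\<Sum>k\<le>n. \<Sum>l\<le>2*k. \<Sum>j\<le>2*(n-k).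
      of_bool ((2*k - l) + (2*(n-k) - j) = 2 * n - i) * (coeff2 A k (2*k - l) * coeff2 B (n - k) (2*(n-k) - j)))"
    by (rule sum.cong[OF refl], rule sum_atMost_rev_rev[symmetric])
  also have "\<dots> = (\<Sum>k\<le>n. \<Sum>l\<le>2*k. \<Sum>j\<le>2*(n-k).
      e * d * (of_bool (l + j = i) * (coeff2 A k l * coeff2 B (n - k) j)))"
  proof (intro sum.cong refl)
    fix k l j assume *: "k \<in> {..n}" "l \<in> {..2*k}" "j \<in> {..2*(n-k)}"
    then have "(2*k - l) + (2*(n-k) - j) = 2 * n - i \<longleftrightarrow> l + j = i"
      using i by auto
    with * A B show "of_bool ((2*k - l) + (2*(n-k) - j) = 2 * n - i) *
        (coeff2 A k (2*k - l) * coeff2 B (n - k) (2*(n-k) - j)) =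
        e * d * (of_bool (l + j = i) * (coeff2 A k l * coeff2 B (n - k) j))"
      by (simp add: zsym_def)
  qed
  also have "\<dots> = e * d * coeff2 (A * B) n i"
    by (simp only: ext[OF i] sum_distrib_left)
  finally show "coeff2 (A * B) n (2 * n - i) = e * d * coeff2 (A * B) n i" .
qed

text \<open>The operator \<open>(z d/dz)^a\<close> followed by \<open>z = 1\<close>; for balanced
  series the cut-off at \<open>2 * n\<close> loses nothing.\<close>

definition zmoment :: "nat \<Rightarrow> real fps fps \<Rightarrow> real fps" where
  "zmoment a A = Abs_fps (\<lambda>n. \<Sum>i\<le>2*n. (real i - real n) ^ a * coeff2 A n i)"

lemma fps_nth_of_nat_mult: "fps_nth (of_nat c * f) n = of_nat c * fps_nth (f :: 'a::comm_ring_1 fps) n"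
  by (simp flip: fps_of_nat)

text \<open>Exponents of \<open>z\<close> add in a product, so the binomial theorem applied to
  \<open>(l - k) + (j - (n - k))\<close> gives the Leibniz rule for \<open>z d/dz\<close> at
  \<open>z = 1\<close>.\<close>

lemma zmoment_mult:
  assumes "balanced A" "balanced B"
  shows "zmoment a (A * B) =
    (\<Sum>b\<le>a. of_nat (a choose b) * zmoment b A * zmoment (a - b) B)"
proof (rule fps_ext)
  fix n
  have "fps_nth (zmoment a (A * B)) n = (\<Sum>k\<le>n. \<Sum>l\<le>2*k. \<Sum>j\<le>2*(n-k).
      (real (l + j) - real n) ^ a * (coeff2 A k l * coeff2 B (n - k) j))"
    by (simp add: zmoment_def balanced_sum[OF assms, where F = "\<lambda>i. (real i - real n) ^ a"])
  also have "\<dots> = (\<Sum>k\<le>n. \<Sum>l\<le>2*k. \<Sum>j\<le>2*(n-k). \<Sum>b\<le>a. real (a choose b) *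
      (((real l - real k) ^ b * coeff2 A k l) * ((real j - real (n - k)) ^ (a - b) * coeff2 B (n - k) j)))"
  proof (intro sum.cong refl)
    fix k l j assume "k \<in> {..n}" "l \<in> {..2*k}" "j \<in> {..2*(n-k)}"
    then have "real (l + j) - real n = (real l - real k) + (real j - real (n - k))"
      by (simp add: of_nat_diff)
    then show "(real (l + j) - real n) ^ a * (coeff2 A k l * coeff2 B (n - k) j) =
      (\<Sum>b\<le>a. real (a choose b) *
      (((real l - real k) ^ b * coeff2 A k l) * ((real j - real (n - k)) ^ (a - b) * coeff2 B (n - k) j)))"
      by (simp only: binomial_ring sum_distrib_right) (simp add: mult_ac)
  qed
  also have "\<dots> = (\<Sum>k\<le>n. \<Sum>b\<le>a. \<Sum>l\<le>2*k. \<Sum>j\<le>2*(n-k). real (a choose b) *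
      (((real l - real k) ^ b * coeff2 A k l) * ((real j - real (n - k)) ^ (a - b) * coeff2 B (n - k) j)))"
  proof (rule sum.cong[OF refl])
    fix k :: nat
    let ?h = "\<lambda>l j b. real (a choose b) *
      (((real l - real k) ^ b * coeff2 A k l) * ((real j - real (n - k)) ^ (a - b) * coeff2 B (n - k) j))"
    have "(\<Sum>l\<le>2*k. \<Sum>j\<le>2*(n-k). \<Sum>b\<le>a. ?h l j b)
        = (\<Sum>l\<le>2*k. \<Sum>b\<le>a. \<Sum>j\<le>2*(n-k). ?h l j b)"
      by (intro sum.cong refl sum.swap)
    also have "\<dots> = (\<Sum>b\<le>a. \<Sum>l\<le>2*k. \<Sum>j\<le>2*(n-k). ?h l j b)" by (rule sum.swap)
    finally show "(\<Sum>l\<le>2*k. \<Sum>j\<le>2*(n-k). \<Sum>b\<le>a. ?h l j b)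
        = (\<Sum>b\<le>a. \<Sum>l\<le>2*k. \<Sum>j\<le>2*(n-k). ?h l j b)" .
  qed
  also have "\<dots> = (\<Sum>k\<le>n. \<Sum>b\<le>a. real (a choose b) *
     (fps_nth (zmoment b A) k * fps_nth (zmoment (a - b) B) (n - k)))"
    by (simp only: zmoment_def fps_nth_Abs_fps sum_product) (simp only: sum_distrib_left)
  also have "\<dots> = (\<Sum>b\<le>a. \<Sum>k\<le>n. real (a choose b) *
     (fps_nth (zmoment b A) k * fps_nth (zmoment (a - b) B) (n - k)))"
    by (rule sum.swap)
  also have "\<dots> = fps_nth (\<Sum>b\<le>a. of_nat (a choose b) * zmoment b A * zmoment (a - b) B) n"
    by (simp only: fps_sum_nth mult.assoc fps_nth_of_nat_mult)
       (simp only: fps_mult_nth sum_distrib_left atLeast0AtMost)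
  finally show "fps_nth (zmoment a (A * B)) n =
      fps_nth (\<Sum>b\<le>a. of_nat (a choose b) * zmoment b A * zmoment (a - b) B) n" .
qed

lemma zmoment_zderiv: "zmoment a (zderiv A) = zmoment (Suc a) A"
  by (rule fps_ext) (simp add: zmoment_def mult_ac)

lemma zmoment_qdiag: "zmoment a (qdiag c) = (if a = 0 then c else 0)"
proof (rule fps_ext)
  fix n
  have "fps_nth (zmoment a (qdiag c)) n = (\<Sum>i\<in>{n}. (real i - real n) ^ a * coeff2 (qdiag c) n i)"
    unfolding zmoment_def fps_nth_Abs_fps
    by (rule sum.mono_neutral_right) (auto simp: coeff2_qdiag)
  then show "fps_nth (zmoment a (qdiag c)) n = fps_nth (if a = 0 then c else 0) n"
    by (simp add: coeff2_qdiag)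
qed

lemma zmoment_add: "zmoment a (A + B) = zmoment a A + zmoment a B"
  by (rule fps_ext) (simp add: zmoment_def algebra_simps sum.distrib)

section \<open>The logarithmic derivative and the rank-crank equation\<close>

text \<open>Division by powers of \<open>1 - z\<close> produces partial sums of rows; this lets such
  a sum up to \<open>i\<close> be compared with the one at the reflected position.\<close>

lemma zsym_tail_sum:
  assumes "zsym e A" "i \<le> 2 * n"
  shows "(\<Sum>l\<in>{i<..2*n}. g l * coeff2 A n l) = e * (\<Sum>l<2*n-i. g (2*n-l) * coeff2 A n l)"
proof -
  have "(\<Sum>l\<in>{i<..2*n}. g l * coeff2 A n l) = (\<Sum>l<2*n-i. g (2*n-l) * coeff2 A n (2*n-l))"
    by (rule sum.reindex_bij_witness[where i = "\<lambda>l. 2*n-l" and j = "\<lambda>l. 2*n-l"]) (use assms in auto)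
  also have "\<dots> = (\<Sum>l<2*n-i. e * (g (2*n-l) * coeff2 A n l))"
    by (rule sum.cong) (use assms in \<open>auto simp: zsym_def\<close>)
  finally show ?thesis by (simp add: sum_distrib_left)
qed

lemma zsym_zderiv: "zsym e A \<Longrightarrow> zsym (- e) (zderiv A)"
  by (auto simp: zsym_def balanced_def of_nat_diff algebra_simps)

lemma zsym_diff: "zsym e A \<Longrightarrow> zsym e B \<Longrightarrow> zsym e (A - B)"
  by (simp add: zsym_def balanced_def algebra_simps)

lemma fps_nth_one_minus_X_mult:
  "fps_nth ((1 - fps_X) * f) i = fps_nth f i - (if i = 0 then 0 else fps_nth (f :: real fps) (i - 1))"
  by (simp add: algebra_simps)

lemma coeff2_one_minus_x_mult:
  "coeff2 (fps_const (1 - fps_X) * A) n i = coeff2 A n i - (if i = 0 then 0 else coeff2 A n (i - 1))"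
  by (simp add: fps_nth_one_minus_X_mult)

lemma coeff2_partial_sum:
  assumes "B = fps_const (1 - fps_X) * A"
  shows "coeff2 A n i = (\<Sum>l\<le>i. coeff2 B n l)"
  unfolding assms coeff2_one_minus_x_mult by (induction i) auto

text \<open>The logarithmic derivative in \<open>z\<close> of \<open>\<Prod>n\<ge>1. 1 / ((1
    - z q\<^sup>n) (1 - q\<^sup>n / z))\<close>. The row \<open>n = 0\<close>
  added in \<open>zlog_full\<close> is \<open>z / (1 - z)\<close>, since every integer divides \<open>0\<close>.\<close>

definition zlog :: "real fps fps" where
  "zlog = Abs_fps (\<lambda>n. Abs_fps (\<lambda>i. if n > 0 \<and> i \<noteq> n \<and> (int i - int n) dvd int n
     then sgn (real i - real n) else 0))"

definition zlog_full :: "real fps fps" where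
  "zlog_full = Abs_fps (\<lambda>n. Abs_fps (\<lambda>i. if i \<noteq> n \<and> (int i - int n) dvd int n
     then sgn (real i - real n) else 0))"

text \<open>Put \<open>k = i - n\<close>. The exchange sends \<open>k\<close> to \<open>- k\<close>,
  and \<open>k\<close> divides \<open>n\<close> iff it divides \<open>i = n + k\<close>. Row 0 must
  be present, as it is the mirror image of the column \<open>i = 0\<close>.\<close>

lemma swap2_zlog_full: "swap2 zlog_full = - zlog_full"
proof (rule fps2_eqI)
  fix n i :: nat
  have "(int n - int i) dvd int i \<longleftrightarrow> (int i - int n) dvd int n"
  proof -
    have "(int n - int i) dvd int i \<longleftrightarrow> (int i - int n) dvd int i"
      by (metis minus_diff_eq minus_dvd_iff)
    also have "\<dots> \<longleftrightarrow> (int i - int n) dvd (int n + (int i - int n))" by simp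
    also have "\<dots> \<longleftrightarrow> (int i - int n) dvd int n" by (simp only: dvd_add_triv_right_iff)
    finally show ?thesis .
  qed
  then show "coeff2 (swap2 zlog_full) n i = coeff2 (- zlog_full) n i"
    by (auto simp: zlog_full_def sgn_if)
qed

lemma zlog_full_mult: "fps_const (1 - fps_X) * zlog_full = fps_const (1 - fps_X) * zlog + fps_const fps_X"
proof (rule fps2_eqI)
  fix n i :: nat
  show "coeff2 (fps_const (1 - fps_X) * zlog_full) n i =
      coeff2 (fps_const (1 - fps_X) * zlog + fps_const fps_X) n i"
    unfolding fps_add_nth coeff2_one_minus_x_mult
    by (auto simp: zlog_full_def zlog_def sgn_if)
qed

text \<open>For \<open>n > 0\<close> a divisor \<open>k = i - n\<close> of \<open>n\<close>
  satisfies \<open>|k| <= n\<close>, which gives balance; the row of \<open>z / (1 - z)\<close>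
  would destroy it.\<close>

lemma zsym_zlog: "zsym (- 1) zlog"
  unfolding zsym_def balanced_def
proof (intro conjI allI impI)
  fix n i :: nat
  {
    assume "2 * n < i"
    then have "n > 0 \<Longrightarrow> \<not> (int i - int n) dvd int n"
      using zdvd_imp_le[of "int i - int n" "int n"] by auto
    then show "coeff2 zlog n i = 0" by (auto simp: zlog_def)
  next
    assume "i \<le> 2 * n"
    moreover have "(int n - int i) dvd int n \<longleftrightarrow> (int i - int n) dvd int n"
      by (metis minus_diff_eq minus_dvd_iff)
    ultimately show "coeff2 zlog n (2 * n - i) = - 1 * coeff2 zlog n i"
      by (auto simp: zlog_def sgn_if of_nat_diff)
  }
qed

text \<open>The difference \<open>Z\<close> of both sides, divided by \<open>1
    - z\<close>, is antisymmetric both under the exchange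
  of \<open>x = z\<close> and \<open>y
      = q / z\<close> and, up to a shift, under \<open>z \<rightarrow> 1 / z\<close>; the composition of the two lowers
  the power of \<open>q\<close>, so \<open>Z\<close> vanishes by descent.\<close>

theorem zderiv_eq_mult_zlog:
  assumes swap: "swap2 K = K" and C: "C = fps_const (1 - fps_X) * K" and sym: "zsym 1 C"
  shows "zderiv C = C * zlog"
proof -
  define Z where "Z = zderiv K - K * zlog_full"
  define Z' where "Z' = zderiv C - C * zlog"
  have zc: "zderiv (fps_const (1 - fps_X)) = - fps_const fps_X"
    by (rule fps2_eqI) auto
  have Z': "Z' = fps_const (1 - fps_X) * Z"
  proof -
    have "zderiv C = - fps_const fps_X * K + fps_const (1 - fps_X) * zderiv K"
      unfolding C zderiv_mult zc ..
    moreover have "fps_const (1 - fps_X) * (K * zlog_full) = K * (fps_const (1 - fps_X) * zlog_full)"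
      by (simp only: mult_ac)
    ultimately show ?thesis
      unfolding Z_def Z'_def zlog_full_mult right_diff_distrib C
      by (simp only:) (simp only: algebra_simps zlog_full_mult mult_minus_right mult_minus_left, simp)
  qed
  have sw: "coeff2 Z n i = - coeff2 Z i n" for n i
  proof -
    have "swap2 (K * zlog_full) = - (K * zlog_full)" by (simp add: swap2_mult swap swap2_zlog_full)
    then have "coeff2 (K * zlog_full) i n = - coeff2 (K * zlog_full) n i"
      by (metis coeff2_swap2 fps_neg_nth)
    moreover have "coeff2 K i n = coeff2 K n i" using swap by (metis coeff2_swap2)
    ultimately show ?thesis by (simp add: Z_def algebra_simps)
  qed
  have "zsym (1 * - 1) (C * zlog)" by (rule zsym_mult[OF sym zsym_zlog])
  then have sym': "zsym (- 1) Z'"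
    unfolding Z'_def using zsym_zderiv[OF sym] by (intro zsym_diff) auto
  have ps: "coeff2 Z n i = (\<Sum>l\<le>i. coeff2 Z' n l)" for n i
    by (rule coeff2_partial_sum[OF Z'])
  have total: "(\<Sum>l\<le>2*n. coeff2 Z' n l) = 0" for n
  proof -
    have "(\<Sum>l\<le>2*n. coeff2 Z' n l) = (\<Sum>l\<le>2*n. coeff2 Z' n (2*n-l))"
      by (rule sum_atMost_rev[symmetric])
    also have "\<dots> = (\<Sum>l\<le>2*n. - coeff2 Z' n l)"
      by (rule sum.cong) (use sym' in \<open>auto simp: zsym_def\<close>)
    finally show ?thesis by (simp add: sum_negf)
  qed
  have big: "coeff2 Z n i = 0" if "i \<ge> 2 * n" for n i
  proof -
    have "(\<Sum>l\<le>i. coeff2 Z' n l) = (\<Sum>l\<le>2*n. coeff2 Z' n l)"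
      by (rule sum.mono_neutral_right) (use that sym' in \<open>auto simp: zsym_def balanced_def\<close>)
    then show ?thesis by (simp add: ps total)
  qed
  \<comment> \<open>Since \<open>1 - 1/z = - (1 - z) / z\<close>, antisymmetry of \<open>Z'\<close>
    becomes \<open>Z(1/z) = z Z(z)\<close>: the division by \<open>1 - z\<close> costs a sign and a
    shift by one.\<close>
  have refl: "coeff2 Z n i = coeff2 Z n (2*n-1-i)" if "i < 2 * n" for n i
  proof -
    have "{..2*n} = {..i} \<union> {i<..2*n}" using that by auto
    then have "0 = (\<Sum>l\<le>i. coeff2 Z' n l) + (\<Sum>l\<in>{i<..2*n}. coeff2 Z' n l)"
      using total[of n] by (simp add: sum.union_disjoint[symmetric] ivl_disj_int)
    also have "(\<Sum>l\<in>{i<..2*n}. coeff2 Z' n l) = - (\<Sum>l<2*n-i. coeff2 Z' n l)"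
      using zsym_tail_sum[OF sym', of i n "\<lambda>_. 1"] that by simp
    also have "{..<2*n-i} = {..2*n-1-i}" using that by auto
    finally show ?thesis by (simp add: ps)
  qed
  have "coeff2 Z n i = 0" for n i
  proof (induction n arbitrary: i rule: less_induct)
    case (less n)
    consider "i < n" | "i \<ge> 2 * n" | "n \<le> i" "i < 2 * n" by linarith
    then show ?case
    proof cases
      case 1
      then show ?thesis using less sw[of n i] by simp
    next
      case 2
      then show ?thesis by (rule big)
    next
      \<comment> \<open>Reflection moves \<open>i\<close> to \<open>2*n-1-i\<close>, which is less
        than \<open>n\<close>; the exchange then makes it the row.\<close>
      case 3
      then have "coeff2 Z (2*n-1-i) n = 0" by (intro less) auto
      then show ?thesis using sw[of n "2*n-1-i"] refl[of i n] 3 by simp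
    qed
  qed
  then have "Z = 0" by (intro fps2_eqI) simp
  then show ?thesis using Z' by (simp add: Z'_def)
qed

lemma fps_nth_numeral_mult:
  "fps_nth (numeral k * f) n = numeral k * fps_nth (f :: 'a::comm_ring_1 fps) n"
  by (simp flip: numeral_fps_const)

definition sigma_fps :: "nat \<Rightarrow> real fps" where
  "sigma_fps a = Abs_fps (\<lambda>n. \<Sum>d | d \<in> {1..n} \<and> d dvd n. real d ^ a)"

text \<open>A divisor \<open>d\<close> of \<open>n\<close> contributes \<open>z^d - z^(-d)\<close>,
  hence \<open>d^a - (-d)^a\<close>, which is 0 or \<open>2 d^a\<close> according to the parity of
  \<open>a\<close>.\<close>

lemma zmoment_zlog: "zmoment a zlog = (if odd a then 2 * sigma_fps a else 0)"
proof (rule fps_ext)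
  fix n :: nat
  let ?f = "\<lambda>i. (real i - real n) ^ a * coeff2 zlog n i"
  let ?D = "{d. d \<in> {1..n} \<and> d dvd n}"
  have "{..2*n} = ({..<n} \<union> {n}) \<union> {n<..2*n}" by auto
  then have "(\<Sum>i\<le>2*n. ?f i) = (\<Sum>i<n. ?f i) + ?f n + (\<Sum>i\<in>{n<..2*n}. ?f i)"
    by (simp only:) (subst sum.union_disjoint; (subst sum.union_disjoint)?; auto)
  also have "?f n = 0" by (simp add: zlog_def)
  also have "(\<Sum>i\<in>{n<..2*n}. ?f i) = (\<Sum>d\<in>{1..n}. ?f (n + d))"
    by (rule sum.reindex_bij_witness[where i = "\<lambda>d. n + d" and j = "\<lambda>i. i - n"]) auto
  also have "\<dots> = (\<Sum>d\<in>{1..n}. if d dvd n then real d ^ a else 0)"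
    by (rule sum.cong) (auto simp: zlog_def)
  also have "(\<Sum>i<n. ?f i) = (\<Sum>d\<in>{1..n}. ?f (n - d))"
    by (rule sum.reindex_bij_witness[where i = "\<lambda>d. n - d" and j = "\<lambda>i. n - i"]) auto
  also have "\<dots> = (\<Sum>d\<in>{1..n}. if d dvd n then - ((- 1) ^ a * real d ^ a) else 0)"
    by (rule sum.cong) (auto simp: zlog_def of_nat_diff power_minus[of "real _"] sgn_if)
  finally have "(\<Sum>i\<le>2*n. ?f i) =
      (\<Sum>d\<in>?D. - ((- 1) ^ a * real d ^ a)) + (\<Sum>d\<in>?D. real d ^ a)"
    by (simp only: sum.inter_filter finite_atLeastAtMost add_0_right)
  also have "\<dots> = (if odd a then 2 * (\<Sum>d\<in>?D. real d ^ a) else 0)"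
    by (simp add: sum_negf)
  finally show "fps_nth (zmoment a zlog) n = fps_nth (if odd a then 2 * sigma_fps a else 0) n"
    by (simp add: zmoment_def sigma_fps_def)
qed

lemma zsym_qdiag: "zsym 1 (qdiag c)"
  using balanced_qdiag by (auto simp: zsym_def coeff2_qdiag)

lemma zmoment0_mult:
  "balanced A \<Longrightarrow> balanced B \<Longrightarrow> zmoment 0 (A * B) = zmoment 0 A * zmoment 0 B"
  by (simp add: zmoment_mult)

lemma zmoment_Suc_logderiv:
  assumes "balanced H" "zderiv H = H * zlog + H * zlog + H * zlog"
  shows "zmoment (Suc a) H = 3 * (\<Sum>b\<le>a. of_nat (a choose b) * zmoment b H * zmoment (a - b) zlog)"
proof -
  have bal: "balanced zlog" using zsym_zlog by (simp add: zsym_def)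
  have "zmoment (Suc a) H = zmoment a (zderiv H)" by (rule zmoment_zderiv[symmetric])
  also have "\<dots> = zmoment a (H * zlog) + zmoment a (H * zlog) + zmoment a (H * zlog)"
    by (simp only: assms(2) zmoment_add)
  also have "\<dots> = 3 * zmoment a (H * zlog)" by simp
  finally show ?thesis by (simp only: zmoment_mult[OF assms(1) bal])
qed

text \<open>The weights are the coefficients \<open>binomial (t + 2) 2\<close> of
  \<open>(1 - x)^(-3)\<close> at \<open>t = i - l\<close>.\<close>

lemma coeff2_triple_partial_sum:
  assumes H: "H = fps_const (1 - fps_X) ^ 3 * V"
  shows "coeff2 V n i = (\<Sum>l\<le>i. (real i - real l + 1) * (real i - real l + 2) / 2 * coeff2 H n l)"
proof -
  define W1 where "W1 = fps_const (1 - fps_X) * V"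
  define W2 where "W2 = fps_const (1 - fps_X) * W1"
  have H': "H = fps_const (1 - fps_X) * W2"
    unfolding H W1_def W2_def by (simp only: power3_eq_cube mult.assoc)
  have 2: "coeff2 W2 n i = (\<Sum>l\<le>i. coeff2 H n l)" for i
    by (rule coeff2_partial_sum[OF H'])
  have 1: "coeff2 W1 n i = (\<Sum>l\<le>i. (real i - real l + 1) * coeff2 H n l)" for i
  proof (induction i)
    case (Suc i)
    have "coeff2 W1 n (Suc i) = coeff2 W1 n i + coeff2 W2 n (Suc i)"
      by (simp add: coeff2_partial_sum[OF W2_def, of n])
    also have "\<dots> = (\<Sum>l\<le>i. (real i - real l + 1) * coeff2 H n l + coeff2 H n l) + coeff2 H n (Suc i)"
      by (simp add: Suc 2 sum.distrib)
    also have "(\<Sum>l\<le>i. (real i - real l + 1) * coeff2 H n l + coeff2 H n l) =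
        (\<Sum>l\<le>i. (real (Suc i) - real l + 1) * coeff2 H n l)"
      by (rule sum.cong) (simp_all add: field_simps)
    finally show ?case by simp
  qed (simp add: coeff2_partial_sum[OF W2_def, of n] 2)
  show ?thesis
  proof (induction i)
    case (Suc i)
    have "coeff2 V n (Suc i) = coeff2 V n i + coeff2 W1 n (Suc i)"
      by (simp add: coeff2_partial_sum[OF W1_def, of n])
    also have "\<dots> = (\<Sum>l\<le>i. (real i - real l + 1) * (real i - real l + 2) / 2 * coeff2 H n l
        + (real (Suc i) - real l + 1) * coeff2 H n l) + coeff2 H n (Suc i)"
      by (simp add: Suc 1 sum.distrib)
    also have "(\<Sum>l\<le>i. (real i - real l + 1) * (real i - real l + 2) / 2 * coeff2 H n l
        + (real (Suc i) - real l + 1) * coeff2 H n l) =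
        (\<Sum>l\<le>i. (real (Suc i) - real l + 1) * (real (Suc i) - real l + 2) / 2 * coeff2 H n l)"
      by (rule sum.cong) (simp_all add: field_simps)
    finally show ?case by simp
  qed (simp add: coeff2_partial_sum[OF W1_def, of n] 1)
qed

text \<open>With \<open>t = i - l\<close> the weight \<open>(t + 1)(t + 2) / 2\<close> is invariant
  under \<open>t -> - 3 - t\<close> and is 0 at \<open>t = - 1, - 2\<close>. The part of the full
  sum beyond \<open>i\<close> is therefore itself a coefficient of \<open>V\<close>, at
  \<open>2*n-i-3\<close>, and no gap remains between the two.\<close>

lemma triple_partial_sum_reflect:
  assumes H: "H = fps_const (1 - fps_X) ^ 3 * V" and sym: "zsym 1 H"
  shows "coeff2 V n i + (if i + 3 \<le> 2 * n then coeff2 V n (2*n-i-3) else 0) =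
    (\<Sum>l\<le>2*n. (real i - real l + 1) * (real i - real l + 2) / 2 * coeff2 H n l)"
proof -
  let ?g = "\<lambda>i l. (real i - real l + 1) * (real i - real l + 2) / 2"
  note V = coeff2_triple_partial_sum[OF H, of n]
  show ?thesis
  proof (cases "i \<le> 2 * n")
    case False
    have "coeff2 V n i = (\<Sum>l\<le>2*n. ?g i l * coeff2 H n l)"
      unfolding V by (rule sum.mono_neutral_right) (use False sym in \<open>auto simp: zsym_def balanced_def\<close>)
    then show ?thesis using False by simp
  next
    case True
    then have "{..2*n} = {..i} \<union> {i<..2*n}" by auto
    then have "(\<Sum>l\<le>2*n. ?g i l * coeff2 H n l) = coeff2 V n i + (\<Sum>l\<in>{i<..2*n}. ?g i l * coeff2 H n l)"
      by (simp add: sum.union_disjoint ivl_disj_int V)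
    also have "(\<Sum>l\<in>{i<..2*n}. ?g i l * coeff2 H n l) = (\<Sum>l<2*n-i. ?g i (2*n-l) * coeff2 H n l)"
      using zsym_tail_sum[OF sym True, of "?g i"] by simp
    also have "\<dots> = (if i + 3 \<le> 2 * n then coeff2 V n (2*n-i-3) else 0)"
    proof (cases "i + 3 \<le> 2 * n")
      case i: True
      have "(\<Sum>l<2*n-i. ?g i (2*n-l) * coeff2 H n l) = (\<Sum>l\<le>2*n-i-3. ?g i (2*n-l) * coeff2 H n l)"
      proof (rule sum.mono_neutral_right)
        show "\<forall>l\<in>{..<2*n-i} - {..2*n-i-3}. ?g i (2*n-l) * coeff2 H n l = 0"
        proof
          fix l assume "l \<in> {..<2*n-i} - {..2*n-i-3}"
          then have "l = 2*n-i-1 \<or> l = 2*n-i-2" using i by auto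
          then have "?g i (2*n-l) = 0" using i by (auto simp: of_nat_diff)
          then show "?g i (2*n-l) * coeff2 H n l = 0" by (simp only: mult_zero_left)
        qed
      qed (use i in auto)
      also have "\<dots> = (\<Sum>l\<le>2*n-i-3. ?g (2*n-i-3) l * coeff2 H n l)"
        by (rule sum.cong) (use i in \<open>auto simp: of_nat_diff algebra_simps\<close>)
      finally show ?thesis using i by (simp add: V)
    next
      case i: False
      have "?g i (2*n-l) * coeff2 H n l = 0" if "l < 2*n-i" for l
      proof -
        have "2*n-l = i + 1 \<or> 2*n-l = i + 2" using i that by auto
        then have "?g i (2*n-l) = 0" by auto
        then show ?thesis by (simp only: mult_zero_left)
      qed
      then have "(\<Sum>l<2*n-i. ?g i (2*n-l) * coeff2 H n l) = 0" by (intro sum.neutral) auto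
      then show ?thesis using i by (simp only: if_False)
    qed
    finally show ?thesis by simp
  qed
qed

text \<open>The rank-crank differential equation of Atkin and Garvan, read off at \<open>z\<^sup>m\<^sup>-\<^sup>1\<close> after division
  by \<open>(1 - z)\<^sup>3\<close>; \<open>L m n\<close> stands for the number of partitions of \<open>n\<close> with rank at most \<open>m\<close>. Both sides
  satisfy the same two-term relation, which again determines them by descent.\<close>

theorem rank_crank_pde:
  fixes P :: "real fps" and L :: "int \<Rightarrow> nat \<Rightarrow> real"
  assumes swap: "swap2 K = K" and C: "C = fps_const (1 - fps_X) * K" and sym: "zsym 1 C"
    and P0: "fps_nth P 0 \<noteq> 0" and mass: "zmoment 0 C = P" and XD: "fps_XD P = sigma_fps 1 * P"
    and L: "\<And>m n. n > 0 \<or> m \<noteq> 0 \<Longrightarrow>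
      L (m - 1) n + (if m + 1 \<le> int n then L (m + 2) (nat (int n - m - 1)) else 0) = fps_nth P n"
    and L0: "\<And>m n. m < 0 \<Longrightarrow> m \<le> - int n \<Longrightarrow> L m n = 0"
    and H: "H = qdiag (inverse P) ^ 2 * C ^ 3"
  shows "balanced H" "zmoment 0 H = P" "zderiv H = H * zlog + H * zlog + H * zlog"
    "H = fps_const (1 - fps_X) ^ 3 * Abs_fps (\<lambda>n. Abs_fps (\<lambda>i.
      (3 * real n + (real i - real n + 1) * (real i - real n + 2) / 2) * L (int i - int n + 1) n))"
proof -
  define V where "V = qdiag (inverse P) ^ 2 * K ^ 3"
  \<comment> \<open>With \<open>m = i - n + 1\<close> this is \<open>3 n + m (m + 1) / 2\<close>,
    the factor by which \<open>3 q d/dq + (z d/dz + (z d/dz)^2) / 2\<close> acts on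
    \<open>q^n z^m\<close>.\<close>
  define c where "c n i = 3 * real n + (real i - real n + 1) * (real i - real n + 2) / 2" for n i :: nat
  define Y where "Y = Abs_fps (\<lambda>n. Abs_fps (\<lambda>i. c n i * L (int i - int n + 1) n))"
  have symC3: "zsym 1 (C ^ 3)"
    using zsym_mult[OF zsym_mult[OF sym sym] sym] by (simp add: power3_eq_cube)
  have symI2: "zsym 1 (qdiag (inverse P) ^ 2)"
    using zsym_mult[OF zsym_qdiag zsym_qdiag] by (simp add: power2_eq_square)
  have symH: "zsym 1 H" using zsym_mult[OF symI2 symC3] by (simp add: H)
  then show balH: "balanced H" by (simp add: zsym_def)
  have balC: "balanced C" using sym by (simp add: zsym_def)
  have PP: "inverse P * P = 1" using P0 by (rule inverse_mult_eq_1)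
  have "zmoment 0 H = inverse P ^ 2 * P ^ 3"
    by (simp add: H zmoment0_mult balanced_mult balanced_qdiag balC power2_eq_square power3_eq_cube
      zmoment_qdiag mass)
  also have "\<dots> = (inverse P * P) ^ 2 * P"
    by (simp only: power_mult_distrib power2_eq_square power3_eq_cube mult_ac)
  finally show mH: "zmoment 0 H = P" by (simp add: PP)
  have lC: "zderiv C = C * zlog" by (rule zderiv_eq_mult_zlog[OF swap C sym])
  show lH: "zderiv H = H * zlog + H * zlog + H * zlog"
    unfolding H power2_eq_square power3_eq_cube zderiv_mult zderiv_qdiag lC
    by (simp add: algebra_simps)
  have HV: "H = fps_const (1 - fps_X) ^ 3 * V"
    unfolding H V_def C power_mult_distrib by (simp only: mult_ac)
  have swV: "coeff2 V i n = coeff2 V n i" for i n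
  proof -
    have "swap2 V = V" by (simp add: V_def power2_eq_square power3_eq_cube swap2_mult swap2_qdiag swap)
    then show ?thesis by (metis coeff2_swap2)
  qed
  have h1: "zmoment 1 H = 0"
    using zmoment_Suc_logderiv[OF balH lH, of 0] by (simp add: zmoment_zlog)
  \<comment> \<open>This is the origin of the \<open>3 n\<close> in \<open>c\<close>: half the
    second moment of the cube is \<open>3 q dP/dq\<close>, because \<open>sigma_fps 1\<close> is the
    logarithmic derivative of \<open>P\<close>.\<close>
  have h2: "zmoment 2 H = 6 * fps_XD P"
    using zmoment_Suc_logderiv[OF balH lH, of 1] by (simp add: zmoment_zlog XD mH numeral_2_eq_2)
  have relV: "coeff2 V n i + (if i + 3 \<le> 2 * n then coeff2 V n (2*n-i-3) else 0) = c n i * fps_nth P n"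
    for n i
  proof -
    define m where "m = real i - real n"
    have "(\<Sum>l\<le>2*n. (real i - real l + 1) * (real i - real l + 2) / 2 * coeff2 H n l) =
       (\<Sum>l\<le>2*n. (m + 1) * (m + 2) / 2 * ((real l - real n) ^ 0 * coeff2 H n l)
          - (2 * m + 3) / 2 * ((real l - real n) ^ 1 * coeff2 H n l)
          + 1 / 2 * ((real l - real n) ^ 2 * coeff2 H n l))"
      by (rule sum.cong) (simp_all add: m_def field_simps power2_eq_square)
    also have "\<dots> = (m + 1) * (m + 2) / 2 * fps_nth (zmoment 0 H) n
        - (2 * m + 3) / 2 * fps_nth (zmoment 1 H) n + 1 / 2 * fps_nth (zmoment 2 H) n"
      by (simp only: sum.distrib sum_subtractf sum_distrib_left[symmetric] zmoment_def fps_nth_Abs_fps)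
    also have "fps_nth (zmoment 2 H) n = 6 * (real n * fps_nth P n)"
      by (simp add: h2 fps_nth_numeral_mult)
    finally have "(\<Sum>l\<le>2*n. (real i - real l + 1) * (real i - real l + 2) / 2 * coeff2 H n l)
        = c n i * fps_nth P n"
      by (simp add: mH h1[unfolded One_nat_def] c_def m_def algebra_simps)
    then show ?thesis using triple_partial_sum_reflect[OF HV symH, of n i] by simp
  qed
  have cY: "coeff2 Y n i = c n i * L (int i - int n + 1) n" for n i by (simp add: Y_def)
  define D where "D n i = coeff2 Y n i - coeff2 V n i" for n i
  have L': "L (int i - int n + 1) n + (if int i - int n + 3 \<le> int n
      then L (int i - int n + 4) (nat (2 * int n - int i - 3)) else 0) = fps_nth P n" for n i
  proof -
    have "n > 0 \<or> int i - int n + 2 \<noteq> 0" by linarith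
    note L1 = L[where n = n and m = "int i - int n + 2", OF this]
    have "int n - (int i - int n + 2) - 1 = 2 * int n - int i - 3"
      "int i - int n + 2 - 1 = int i - int n + 1" "int i - int n + 2 + 1 = int i - int n + 3"
      "int i - int n + 2 + 2 = int i - int n + 4" by linarith+
    then show ?thesis using L1 by (simp only:)
  qed
  \<comment> \<open>The factor \<open>c\<close> is invariant under
    \<open>(n, i) -> (2*n-i-3, n)\<close>, so Dyson's relation multiplied by \<open>c\<close> is the
    relation \<open>relV\<close>, once the second term there is transposed by the symmetry of
    \<open>V\<close>.\<close>
  have up: "D n i = - (if i + 3 \<le> 2 * n then D (2*n-i-3) n else 0)" for n i
  proof (cases "i + 3 \<le> 2 * n")
    case True
    have "c (2*n-i-3) n = c n i" using True by (simp add: c_def of_nat_diff field_simps)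
    moreover have "L (int i - int n + 1) n + L (int n - int (2*n-i-3) + 1) (2*n-i-3) = fps_nth P n"
    proof -
      have "nat (2 * int n - int i - 3) = 2*n-i-3" using True by linarith
      moreover have "int n - int (2*n-i-3) + 1 = int i - int n + 4" using True by linarith
      ultimately show ?thesis using L'[of i n] True by (simp add: algebra_simps)
    qed
    ultimately show ?thesis
      using relV[of n i] True swV[of "2*n-i-3" n] by (simp add: D_def cY algebra_simps) (simp flip: distrib_left)
  next
    case False
    then show ?thesis using relV[of n i] L'[of i n] by (simp add: D_def cY algebra_simps)
  qed
  have down: "D i n = - (if i + 3 \<le> 2 * n then D n (2*n-i-3) else 0)" for n i
  proof -
    have c1: "c i n = c n i" by (simp add: c_def field_simps)
    have Li: "L (int n - int i - 2) n + L (int n - int i + 1) i = fps_nth P n"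
    proof -
      have "n > 0 \<or> int n - int i - 1 \<noteq> 0" by linarith
      then show ?thesis using L[where n = n and m = "int n - int i - 1"] by (simp add: algebra_simps)
    qed
    show ?thesis
    proof (cases "i + 3 \<le> 2 * n")
      case True
      have "c n (2*n-i-3) = c n i" using True by (simp add: c_def of_nat_diff field_simps)
      moreover have "int (2*n-i-3) - int n + 1 = int n - int i - 2" using True by simp
      ultimately show ?thesis
        using relV[of n i] Li c1 True swV[of i n]
        by (simp add: D_def cY algebra_simps) (simp flip: distrib_left)
    next
      case False
      then have "L (int n - int i - 2) n = 0" by (intro L0) auto
      then show ?thesis using relV[of n i] Li c1 False swV[of i n] by (simp add: D_def cY algebra_simps)
    qed
  qed
  have "D n i = 0" for n i
  proof (induction n arbitrary: i rule: less_induct)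
    case (less n)
    \<comment> \<open>Row \<open>2*n-i-3\<close> lies below \<open>n\<close> exactly if
      \<open>n <= i + 2\<close>; in the other case row \<open>i\<close> does, reached by the
      transposed relation.\<close>
    show ?case
    proof (cases "n \<le> i + 2")
      case True
      then show ?thesis using up[of n i] less[of "2*n-i-3" n] by auto
    next
      case False
      then show ?thesis using down[of n i] less[of i "2*i-n-3"] by auto
    qed
  qed
  then have "V = Y" by (intro fps2_eqI) (simp add: D_def)
  then show "H = fps_const (1 - fps_X) ^ 3 * Abs_fps (\<lambda>n. Abs_fps (\<lambda>i.
      (3 * real n + (real i - real n + 1) * (real i - real n + 2) / 2) * L (int i - int n + 1) n))"
    using HV by (simp add: Y_def c_def)
qed

section \<open>Dyson's symmetry of the rank\<close>

text \<open>Dyson's map removes the first column of the Ferrers diagram, of length \<open>l\<close>, and adds a part \<open>l + r\<close>.\<close>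

definition dyson_map :: "int \<Rightarrow> nat multiset \<Rightarrow> nat multiset" where
  "dyson_map r P = add_mset (nat (int (size P) + r)) {#x - 1. x \<in># filter_mset (\<lambda>x. 1 < x) P#}"

text \<open>The greatest part is \<open>M = l + r\<close>, so the removed column had length
  \<open>l = M - r\<close>; the \<open>l - size R\<close> rows missing from \<open>R\<close>
  consisted of a single cell.\<close>

definition dyson_inv :: "int \<Rightarrow> nat multiset \<Rightarrow> nat multiset" where
  "dyson_inv r Q = (let M = Max_mset Q; R = Q - {#M#}
     in image_mset Suc R + replicate_mset (nat (int M - r) - size R) 1)"

lemma partition_split:
  fixes P :: "nat multiset"
  assumes "0 \<notin># P"
  shows "P = filter_mset (\<lambda>x. 1 < x) P + replicate_mset (count P 1) 1"
proof (rule multiset_eqI)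
  fix x
  show "count P x = count (filter_mset (\<lambda>x. 1 < x) P + replicate_mset (count P 1) 1) x"
    using assms by (cases "x = 0"; cases "x = 1") (auto simp: not_in_iff)
qed

lemma sum_mset_pred:
  "sum_mset {#x - 1. x \<in># filter_mset (\<lambda>x. (1::nat) < x) P#} + size (filter_mset (\<lambda>x. 1 < x) P)
    = sum_mset (filter_mset (\<lambda>x. 1 < x) P)"
  by (induction P) auto

lemma sum_mset_Suc: "sum_mset (image_mset Suc R) = sum_mset R + size R"
  by (induction R) auto

lemma partition_nonempty: "P \<in> partitions n \<Longrightarrow> n \<noteq> 0 \<Longrightarrow> P \<noteq> {#}"
  by (auto simp: partitions_def)

text \<open>Rank at most \<open>r + 1\<close> says that the new part \<open>l + r\<close> is at
  least every shortened part, so that it becomes the greatest. Rank at least \<open>r - 1\<close>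
  says that the restored column is as long as the number of the other parts.\<close>

lemma dyson_bij:
  fixes r :: int
  assumes n0: "n0 \<noteq> 0" and n: "n \<noteq> 0" and nr: "int n = int n0 + r"
  shows "bij_betw (dyson_map r) {P \<in> partitions n0. partition_rank P \<le> r + 1}
    {Q \<in> partitions n. partition_rank Q \<ge> r - 1}"
proof -
  let ?A = "{P \<in> partitions n0. partition_rank P \<le> r + 1}"
  let ?B = "{Q \<in> partitions n. partition_rank Q \<ge> r - 1}"
  have AB: "dyson_map r P \<in> ?B \<and> dyson_inv r (dyson_map r P) = P" if P: "P \<in> ?A" for P
  proof -
    let ?R = "{#x - 1. x \<in># filter_mset (\<lambda>x. 1 < x) P#}"
    define l where "l = size P"
    define M where "M = nat (int l + r)"
    have z: "0 \<notin># P" and s: "sum_mset P = n0" and rk: "int (Max_mset P) \<le> int l + r + 1"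
      using P by (auto simp: partitions_def partition_rank_def l_def)
    have ne: "P \<noteq> {#}" using P n0 partition_nonempty by auto
    note sp = partition_split[OF z]
    have Max1: "Max_mset P \<ge> 1" using ne z
      by (metis Max_in finite_set_mset less_one not_less set_mset_eq_empty_iff)
    have leMax: "x \<le> Max_mset P" if "x \<in># P" for x using that by simp
    have size_sp: "size (filter_mset (\<lambda>x. 1 < x) P) + count P 1 = l"
      unfolding l_def by (subst (3) sp) simp
    have sum_sp: "sum_mset (filter_mset (\<lambda>x. 1 < x) P) + count P 1 = n0"
      unfolding s[symmetric] by (subst (3) sp) simp
    have sumR: "sum_mset ?R + l = n0" using sum_mset_pred[of P] size_sp sum_sp by linarith
    have lr: "int l + r \<ge> 0" using rk Max1 by linarith
    \<comment> \<open>The new part could be 0 only if all parts were 1; then \<open>l = n0\<close>,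
      and the image would have size \<open>n0 + r = 0\<close>.\<close>
    have Mpos: "M > 0"
    proof (rule ccontr)
      assume "\<not> M > 0"
      then have M0: "int l + r = 0" using lr by (simp add: M_def)
      then have "Max_mset P \<le> 1" using rk by linarith
      then have "x \<le> 1" if "x \<in># P" for x using leMax[OF that] by linarith
      then have "filter_mset (\<lambda>x. 1 < x) P = {#}" by (auto simp: not_less)
      then have "l = n0" using size_sp sum_sp by (simp only: size_empty sum_mset.empty)
      then show False using M0 nr n by simp
    qed
    have Mle: "x \<le> M" if x: "x \<in># ?R" for x
    proof -
      obtain y where y: "y \<in># P" "x = y - 1" "1 < y" using x by auto
      show ?thesis using leMax[OF y(1)] y(2,3) rk unfolding M_def by linarith
    qed
    have MaxM: "Max_mset (add_mset M ?R) = M"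
      by (rule Max_eqI) (use Mle in auto)
    have "0 \<notin># add_mset M ?R" using Mpos by auto
    moreover have "sum_mset (add_mset M ?R) = n" using sumR nr lr by (simp add: M_def)
    moreover have "partition_rank (add_mset M ?R) \<ge> r - 1"
      unfolding partition_rank_def MaxM using size_sp lr by (simp add: M_def)
    ultimately have B: "dyson_map r P \<in> ?B"
      by (simp add: dyson_map_def partitions_def M_def l_def)
    have "image_mset Suc ?R = filter_mset (\<lambda>x. 1 < x) P"
      by (simp add: image_mset.compositionality comp_def) (induction P; auto)
    moreover have "nat (int M - r) - size ?R = count P 1"
      using size_sp lr by (simp add: M_def)
    ultimately have "dyson_inv r (add_mset M ?R) = filter_mset (\<lambda>x. 1 < x) P + replicate_mset (count P 1) 1"
      unfolding dyson_inv_def MaxM Let_def by simp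
    then have "dyson_inv r (dyson_map r P) = P"
      using sp by (simp add: dyson_map_def M_def l_def)
    with B show ?thesis by simp
  qed
  have BA: "dyson_inv r Q \<in> ?A \<and> dyson_map r (dyson_inv r Q) = Q" if Q: "Q \<in> ?B" for Q
  proof -
    define M where "M = Max_mset Q"
    define R where "R = Q - {#M#}"
    define l where "l = nat (int M - r)"
    have z: "0 \<notin># Q" and s: "sum_mset Q = n" and rk: "int M - int (size Q) \<ge> r - 1"
      using Q by (auto simp: partitions_def partition_rank_def M_def)
    have ne: "Q \<noteq> {#}" using Q n partition_nonempty by auto
    have MQ: "M \<in># Q" using ne unfolding M_def by (simp add: Max_in)
    have QR: "Q = add_mset M R" using MQ by (simp add: R_def)
    have lr: "int M - r \<ge> int (size R)" using rk QR by simp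
    have Rle: "x \<le> M" if "x \<in># R" for x
    proof -
      have "x \<in># Q" using that unfolding R_def by (rule in_diffD)
      then show ?thesis by (simp add: M_def)
    qed
    have inv: "dyson_inv r Q = image_mset Suc R + replicate_mset (l - size R) 1"
      by (simp add: dyson_inv_def Let_def M_def[symmetric] R_def l_def)
    let ?P = "image_mset Suc R + replicate_mset (l - size R) 1"
    have sizeP: "size ?P = l" using lr by (simp add: l_def)
    have sumP: "sum_mset ?P = n0"
      using s lr nr by (simp add: QR sum_mset_Suc l_def)
    have zP: "0 \<notin># ?P" by auto
    have neP: "?P \<noteq> {#}" using sumP n0 by (metis sum_mset.empty)
    have "Max_mset ?P \<le> M + 1"
      using neP Rle by (subst Max_le_iff) auto
    then have "partition_rank ?P \<le> r + 1"
      unfolding partition_rank_def sizeP using lr by (simp add: l_def)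
    with zP sumP have A: "?P \<in> ?A" by (simp add: partitions_def)
    have zR: "0 \<notin># R" using z QR by auto
    have "filter_mset (\<lambda>x. 1 < x) (image_mset Suc R) = image_mset Suc R"
      using zR by (induction R) auto
    moreover have "filter_mset (\<lambda>x. 1 < x) (replicate_mset (l - size R) (1::nat)) = {#}"
      by auto
    ultimately have "filter_mset (\<lambda>x. 1 < x) ?P = image_mset Suc R" by simp
    then have "{#x - 1. x \<in># filter_mset (\<lambda>x. 1 < x) ?P#} = R"
      by (simp add: image_mset.compositionality comp_def)
    moreover have "nat (int (size ?P) + r) = M" unfolding sizeP using lr by (simp add: l_def)
    ultimately have "dyson_map r ?P = Q" unfolding dyson_map_def QR by simp
    with A inv show ?thesis by simp
  qed
  show ?thesis
    by (rule bij_betw_byWitness[where f' = "dyson_inv r"]) (use AB BA in auto)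
qed

definition rank_le_count :: "int \<Rightarrow> nat \<Rightarrow> real" where
  "rank_le_count m n = (if n = 0 then (if m \<ge> 0 then 1 else 0)
     else real (card {P \<in> partitions n. partition_rank P \<le> m}))"

definition partition_fps :: "real fps" where
  "partition_fps = Abs_fps (\<lambda>n. real (card (partitions n)))"

lemma partitions_0: "partitions 0 = {{#}}"
proof -
  have "P = {#}" if "0 \<notin># P" "sum_mset P = 0" for P :: "nat multiset"
    using that by (cases P) auto
  then show ?thesis by (auto simp: partitions_def)
qed

lemma partition_size_le: "P \<in> partitions n \<Longrightarrow> size P \<le> n"
proof -
  assume P: "P \<in> partitions n"
  have "size P \<le> sum_mset P" if "0 \<notin># P" for P :: "nat multiset"
    using that by (induction P) auto
  then show ?thesis using P by (auto simp: partitions_def)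
qed

lemma partition_Max_size:
  assumes "P \<in> partitions n" "n \<noteq> 0"
  shows "1 \<le> Max_mset P" "Max_mset P + size P \<le> n + 1" "1 \<le> size P"
proof -
  have ne: "P \<noteq> {#}" using assms by (rule partition_nonempty)
  then have M: "Max_mset P \<in># P" by (simp add: Max_in)
  then show "1 \<le> Max_mset P" using assms by (metis (mono_tags, lifting) One_nat_def Suc_leI mem_Collect_eq neq0_conv partitions_def)
  define R where "R = P - {#Max_mset P#}"
  have PR: "P = add_mset (Max_mset P) R" using M by (simp add: R_def)
  have "0 \<notin># R" using assms M unfolding R_def partitions_def by (auto dest: in_diffD)
  then have "R \<in> partitions (sum_mset R)" by (simp add: partitions_def)
  then have "size R \<le> sum_mset R" by (rule partition_size_le)
  moreover have "sum_mset P = n" using assms by (simp add: partitions_def)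
  moreover have "sum_mset P = Max_mset P + sum_mset R" using arg_cong[OF PR, of sum_mset] by simp
  moreover have "size P = Suc (size R)" using arg_cong[OF PR, of size] by simp
  ultimately show "Max_mset P + size P \<le> n + 1" by linarith
  show "1 \<le> size P" using ne by (simp add: Suc_le_eq nonempty_has_size)
qed

lemma rank_le_count_eq_0: "m < 0 \<Longrightarrow> m \<le> - int n \<Longrightarrow> rank_le_count m n = 0"
proof -
  assume m: "m < 0" "m \<le> - int n"
  have "\<not> partition_rank P \<le> m" if "P \<in> partitions n" "n \<noteq> 0" for P
    using partition_Max_size[OF that] partition_size_le[OF that(1)] m by (simp add: partition_rank_def)
  then show ?thesis using m by (auto simp: rank_le_count_def card_eq_0_iff)
qed

text \<open>The extreme ranks, here and in \<open>rank_le_bottom\<close>, replace Dyson's bijection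
  when the partition on the other side would be empty.\<close>

lemma rank_ge_top: "n \<noteq> 0 \<Longrightarrow> {P \<in> partitions n. partition_rank P \<ge> int n - 1} = {{#n#}}"
proof (intro set_eqI iffI)
  fix P assume n: "n \<noteq> 0" and "P \<in> {P \<in> partitions n. partition_rank P \<ge> int n - 1}"
  then have P: "P \<in> partitions n" "int (Max_mset P) - int (size P) \<ge> int n - 1"
    by (auto simp: partition_rank_def)
  note ms = partition_Max_size[OF P(1) n]
  have "size P = 1" using P(2) ms by linarith
  then obtain x where "P = {#x#}" using size_1_singleton_mset by blast
  then show "P \<in> {{#n#}}" using P(1) by (simp add: partitions_def)
qed (auto simp: partitions_def partition_rank_def)

lemma rank_le_bottom: "n \<noteq> 0 \<Longrightarrow> {P \<in> partitions n. partition_rank P \<le> 1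
    - int n} = {replicate_mset n 1}"
proof (intro set_eqI iffI)
  fix P assume n: "n \<noteq> 0" and "P \<in> {P \<in> partitions n. partition_rank P \<le> 1 - int n}"
  then have P: "P \<in> partitions n" "int (Max_mset P) - int (size P) \<le> 1 - int n"
    by (auto simp: partition_rank_def)
  note ms = partition_Max_size[OF P(1) n]
  have M: "Max_mset P = 1" and sz: "size P = n" using P(2) ms partition_size_le[OF P(1)] by linarith+
  have "x = 1" if "x \<in># P" for x
  proof -
    have "x \<le> Max_mset P" using that by simp
    moreover have "x \<noteq> 0" using that P(1) by (metis (mono_tags, lifting) mem_Collect_eq partitions_def)
    ultimately show ?thesis using M by simp
  qed
  then have "P = replicate_mset (size P) 1" by (intro set_mset_subset_singletonD) auto
  then show "P \<in> {replicate_mset n 1}" by (simp add: sz)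
next
  fix P assume n: "n \<noteq> 0" and "P \<in> {replicate_mset n (1::nat)}"
  then show "P \<in> {P \<in> partitions n. partition_rank P \<le> 1 - int n}"
    by (auto simp: partitions_def partition_rank_def)
qed

text \<open>Partitions of \<open>n\<close> of rank at least \<open>m\<close> are the images under
  \<open>dyson_map (m + 1)\<close> of the partitions of \<open>n - m - 1\<close> of rank at most
  \<open>m + 2\<close>. If one of the two sizes is 0, a unique partition of extreme rank takes over.
  At \<open>n = m = 0\<close> the left-hand side is 0 but the right-hand side is 1.\<close>

lemma rank_le_count_dyson:
  assumes "n > 0 \<or> m \<noteq> 0"
  shows "rank_le_count (m - 1) n +
    (if m + 1 \<le> int n then rank_le_count (m + 2) (nat (int n - m - 1)) else 0) = fps_nth partition_fps n"
proof -
  have split: "real (card {P \<in> partitions n. partition_rank P \<le> m - 1})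
      + real (card {P \<in> partitions n. partition_rank P \<ge> m}) = fps_nth partition_fps n"
  proof -
    let ?A = "{P \<in> partitions n. partition_rank P \<le> m - 1}"
    let ?B = "{P \<in> partitions n. partition_rank P \<ge> m}"
    have eq: "partitions n = ?A \<union> ?B" by auto
    have "card (?A \<union> ?B) = card ?A + card ?B"
      by (rule card_Un_disjoint) (auto simp: finite_partitions)
    then have "card (partitions n) = card ?A + card ?B" by (rule trans[OF arg_cong[OF eq]])
    then show ?thesis by (simp add: partition_fps_def)
  qed
  consider (gt) "m + 1 > int n" | (n0) "n = 0" "m \<le> - 1" | (eq) "n \<noteq> 0" "m + 1
      = int n" | (lt) "n \<noteq> 0" "m + 1 < int n"
    by linarith
  then show ?thesis
  proof cases
    case gt
    show ?thesis
    proof (cases "n = 0")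
      case True
      then show ?thesis using gt assms by (simp add: rank_le_count_def partition_fps_def partitions_0)
    next
      case False
      have "\<not> partition_rank P \<ge> m" if "P \<in> partitions n" for P
        using partition_Max_size[OF that False] gt by (simp add: partition_rank_def)
      then have "card {P \<in> partitions n. partition_rank P \<ge> m} = 0" by (simp add: card_eq_0_iff)
      then show ?thesis using split gt False by (simp add: rank_le_count_def)
    qed
  next
    case n0
    show ?thesis
    proof (cases "m = - 1")
      case True
      then show ?thesis using n0 by (simp add: rank_le_count_def partition_fps_def partitions_0)
    next
      case False
      define k where "k = nat (- m - 1)"
      have k: "k \<noteq> 0" "m + 2 = 1 - int k" using n0 False by (auto simp: k_def)
      have "card {P \<in> partitions k. partition_rank P \<le> m + 2} = 1"
        unfolding k(2) rank_le_bottom[OF k(1)] by simp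
      then show ?thesis using n0 k(1)
        by (simp add: rank_le_count_def partition_fps_def partitions_0 k_def[symmetric])
    qed
  next
    case eq
    then have "m = int n - 1" by simp
    then have "card {P \<in> partitions n. partition_rank P \<ge> m} = 1"
      by (simp only: rank_ge_top[OF eq(1)]) simp
    then show ?thesis using eq split by (simp add: rank_le_count_def)
  next
    case lt
    define k where "k = nat (int n - m - 1)"
    have k: "k \<noteq> 0" "int n = int k + (m + 1)" using lt by (auto simp: k_def)
    have "card {P \<in> partitions k. partition_rank P \<le> m + 1 + 1}
        = card {Q \<in> partitions n. partition_rank Q \<ge> m + 1 - 1}"
      using dyson_bij[OF k(1) lt(1) k(2)] by (rule bij_betw_same_card)
    then show ?thesis using split lt k by (simp add: rank_le_count_def k_def[symmetric] add.assoc)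
  qed
qed

section \<open>The crank\<close>

definition gen_fps :: "nat multiset set \<Rightarrow> real fps" where
  "gen_fps A = Abs_fps (\<lambda>n. real (card {P \<in> A. sum_mset P = n}))"

definition parts_in :: "nat set \<Rightarrow> nat multiset set" where
  "parts_in S = {P. set_mset P \<subseteq> S}"

lemma finite_gen:
  fixes A :: "nat multiset set"
  assumes "\<And>P. P \<in> A \<Longrightarrow> 0 \<notin># P" shows "finite {P \<in> A. sum_mset P = n}"
  by (rule finite_subset[OF _ finite_partitions[of n]]) (use assms in \<open>auto simp: partitions_def\<close>)

lemma gen_fps_parts_insert:
  assumes a: "a \<notin> S" "a \<noteq> 0" and S: "0 \<notin> S"
  shows "(1 - fps_X ^ a) * gen_fps (parts_in (insert a S)) = gen_fps (parts_in S)"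
proof (rule fps_ext)
  fix n
  let ?I = "parts_in (insert a S)"
  have fin: "finite {P \<in> ?I. sum_mset P = n}" for n
    by (rule finite_gen) (use a S in \<open>auto simp: parts_in_def\<close>)
  have eq: "{P \<in> ?I. sum_mset P = n} = {P \<in> parts_in S. sum_mset P
      = n} \<union> {P \<in> ?I. sum_mset P = n \<and> a \<in># P}"
    using a by (auto simp: parts_in_def)
  have "card {P \<in> ?I. sum_mset P = n} = card {P \<in> parts_in S. sum_mset P = n}
      + card {P \<in> ?I. sum_mset P = n \<and> a \<in># P}"
    unfolding eq
  proof (rule card_Un_disjoint)
    show "finite {P \<in> parts_in S. sum_mset P = n}" "finite {P \<in> ?I. sum_mset P = n \<and> a \<in># P}"
      by (rule finite_subset[OF _ fin[of n]]; auto simp: parts_in_def)+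
    show "{P \<in> parts_in S. sum_mset P = n} \<inter> {P \<in> ?I. sum_mset P = n \<and> a \<in># P} = {}"
      using a by (auto simp: parts_in_def)
  qed
  also have "card {P \<in> ?I. sum_mset P = n \<and> a \<in># P}
      = (if a \<le> n then card {P \<in> ?I. sum_mset P = n - a} else 0)"
  proof (cases "a \<le> n")
    case True
    have "bij_betw (add_mset a) {P \<in> ?I. sum_mset P = n - a} {P \<in> ?I. sum_mset P = n \<and> a \<in># P}"
      by (rule bij_betw_byWitness[where f' = "\<lambda>P. P - {#a#}"])
        (use True in \<open>auto simp: parts_in_def sum_mset_diff dest: in_diffD\<close>)
    then show ?thesis using True by (simp add: bij_betw_same_card)
  next
    case False
    have "{P \<in> ?I. sum_mset P = n \<and> a \<in># P} = {}"
    proof -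
      have "a \<le> sum_mset P" if "a \<in># P" for P using that by (metis sum_mset.remove le_add1)
      then show ?thesis using False by auto
    qed
    then show ?thesis using False by (simp only: card.empty if_False)
  qed
  finally show "fps_nth ((1 - fps_X ^ a) * gen_fps ?I) n = fps_nth (gen_fps (parts_in S)) n"
    by (simp add: gen_fps_def left_diff_distrib fps_X_power_mult_nth)
qed

text \<open>This is \<open>1 / ((1 - q) ... (1 - q^r))\<close>, used only through
  \<open>bounded_fps_0\<close> and \<open>bounded_fps_Suc\<close>, so that no quotient has to be
  formed.\<close>

definition bounded_fps :: "nat \<Rightarrow> real fps" where
  "bounded_fps r = gen_fps (parts_in {1..r})"

lemma gen_fps_empty: "gen_fps (parts_in {}) = 1"
proof (rule fps_ext)
  fix n :: nat
  have "{P :: nat multiset. P = {#} \<and> sum_mset P = n} = (if n = 0 then {{#}} else {})" by auto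
  then show "fps_nth (gen_fps (parts_in {})) n = fps_nth 1 n"
    by (auto simp: gen_fps_def parts_in_def)
qed

lemma bounded_fps_0: "bounded_fps 0 = 1"
  by (simp add: bounded_fps_def gen_fps_empty)

lemma bounded_fps_Suc: "(1 - fps_X ^ Suc r) * bounded_fps (Suc r) = bounded_fps r"
proof -
  have "{1..Suc r} = insert (Suc r) {1..r}" by auto
  then show ?thesis unfolding bounded_fps_def by (simp only:) (rule gen_fps_parts_insert, auto)
qed

lemma gen_fps_no_ones: "j \<ge> 1 \<Longrightarrow> gen_fps (parts_in {2..j}) = (1 - fps_X) * bounded_fps j"
proof -
  assume "j \<ge> 1"
  then have "{1..j} = insert 1 {2..j}" by auto
  then show ?thesis unfolding bounded_fps_def using gen_fps_parts_insert[of 1 "{2..j}"] by simp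
qed

definition big_parts :: "nat \<Rightarrow> nat \<Rightarrow> nat multiset set" where
  "big_parts r j = {P. size P = r \<and> (\<forall>x\<in>#P. j < x)}"

lemma big_parts_shift: "gen_fps (big_parts r j) = fps_X ^ (r * j) * gen_fps (big_parts r 0)"
proof (rule fps_ext)
  fix n
  have sum: "sum_mset (image_mset (\<lambda>x. x + j) P) = sum_mset P + size P * j" for P :: "nat multiset"
    by (induction P) auto
  have unshift: "image_mset (\<lambda>x. x + j) (image_mset (\<lambda>x. x - j) P) = P" if "\<forall>x\<in>#P. j < x" for P
    using that by (induction P) auto
  have bij: "bij_betw (image_mset (\<lambda>x. x + j)) {P \<in> big_parts r 0. sum_mset P + r * j
      = n} {P \<in> big_parts r j. sum_mset P = n}"
  proof (rule bij_betw_byWitness[where f' = "image_mset (\<lambda>x. x - j)"])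
    show "image_mset (\<lambda>x. x - j) ` {P \<in> big_parts r j. sum_mset P
        = n} \<subseteq> {P \<in> big_parts r 0. sum_mset P + r * j = n}"
    proof
      fix Q assume "Q \<in> image_mset (\<lambda>x. x - j) ` {P \<in> big_parts r j. sum_mset P = n}"
      then obtain P where P: "P \<in> big_parts r j" "sum_mset P = n" "Q = image_mset (\<lambda>x. x - j) P" by auto
      then show "Q \<in> {P \<in> big_parts r 0. sum_mset P + r * j = n}"
        using sum[of "image_mset (\<lambda>x. x - j) P"] unshift[of P] by (auto simp: big_parts_def)
    qed
  qed (use sum unshift in \<open>auto simp: big_parts_def image_mset.compositionality comp_def\<close>)
  have "card {P \<in> big_parts r 0. sum_mset P + r * j = n} =
      (if r * j \<le> n then card {P \<in> big_parts r 0. sum_mset P = n - r * j} else 0)"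
    by (auto intro!: arg_cong[where f = card] simp: card_eq_0_iff)
  then show "fps_nth (gen_fps (big_parts r j)) n = fps_nth (fps_X ^ (r * j) * gen_fps (big_parts r 0)) n"
    using bij_betw_same_card[OF bij] by (simp add: gen_fps_def fps_X_power_mult_nth)
qed

text \<open>Either all parts exceed 1, and \<open>big_parts_shift\<close> applies, or one part 1 can
  be removed. This determines the series of partitions into exactly \<open>r\<close> parts.\<close>

lemma big_parts_0_rec:
  "gen_fps (big_parts (Suc r) 0) = gen_fps (big_parts (Suc r) 1) + fps_X * gen_fps (big_parts r 0)"
proof (rule fps_ext)
  fix n
  let ?A = "{P \<in> big_parts (Suc r) 1. sum_mset P = n}"
  let ?B = "{P \<in> big_parts (Suc r) 0. sum_mset P = n \<and> 1 \<in># P}"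
  have fin: "finite {P \<in> big_parts (Suc r) 0. sum_mset P = n}"
    by (rule finite_gen) (auto simp: big_parts_def)
  have eq: "{P \<in> big_parts (Suc r) 0. sum_mset P = n} = ?A \<union> ?B"
    unfolding big_parts_def by (auto simp: less_Suc_eq_le[symmetric]) (metis Suc_lessI)
  have "card (?A \<union> ?B) = card ?A + card ?B"
  proof (rule card_Un_disjoint)
    show "finite ?A" "finite ?B"
      by (rule finite_subset[OF _ fin]; force simp: big_parts_def)+
  qed (auto simp: big_parts_def)
  then have c: "card {P \<in> big_parts (Suc r) 0. sum_mset P = n} = card ?A + card ?B"
    unfolding eq .
  have "bij_betw (add_mset 1) {P \<in> big_parts r 0. sum_mset P + 1 = n} ?B"
  proof (rule bij_betw_byWitness[where f' = "\<lambda>P. P - {#1#}"])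
    show "(\<lambda>P. P - {#1#}) ` ?B \<subseteq> {P \<in> big_parts r 0. sum_mset P + 1 = n}"
    proof
      fix Q assume "Q \<in> (\<lambda>P. P - {#1#}) ` ?B"
      then obtain P where P: "P \<in> ?B" "Q = P - {#1#}" by blast
      then have "add_mset 1 Q = P" by simp
      then have "add_mset 1 Q \<in> big_parts (Suc r) 0" "sum_mset (add_mset 1 Q) = n" using P(1) by blast+
      then show "Q \<in> {P \<in> big_parts r 0. sum_mset P + 1 = n}" by (auto simp: big_parts_def)
    qed
  qed (auto simp: big_parts_def)
  then have "card ?B = card {P \<in> big_parts r 0. sum_mset P + 1 = n}"
    by (simp add: bij_betw_same_card)
  moreover have "{P \<in> big_parts r 0. sum_mset P + 1 = n} =
      (if n = 0 then {} else {P \<in> big_parts r 0. sum_mset P = n - 1})" by auto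
  ultimately show "fps_nth (gen_fps (big_parts (Suc r) 0)) n =
      fps_nth (gen_fps (big_parts (Suc r) 1) + fps_X * gen_fps (big_parts r 0)) n"
    using c by (simp add: gen_fps_def)
qed

lemma one_minus_X_power_nonzero: "(1 - fps_X ^ Suc r :: real fps) \<noteq> 0"
proof
  assume "(1 - fps_X ^ Suc r :: real fps) = 0"
  then have "fps_nth (1 - fps_X ^ Suc r :: real fps) 0 = fps_nth 0 0" by (simp only:)
  then show False by simp
qed

lemma gen_fps_big_parts_0: "gen_fps (big_parts r 0) = fps_X ^ r * bounded_fps r"
proof (induction r)
  case 0
  have "big_parts 0 0 = parts_in {}" by (auto simp: big_parts_def parts_in_def)
  then show ?case by (simp add: gen_fps_empty bounded_fps_0)
next
  case (Suc r)
  have "gen_fps (big_parts (Suc r) 0) = fps_X ^ Suc r * gen_fps (big_parts (Suc r) 0) + fps_X * gen_fps (big_parts r 0)"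
    using big_parts_0_rec[of r] big_parts_shift[of "Suc r" 1] by simp
  then have "(1 - fps_X ^ Suc r) * gen_fps (big_parts (Suc r) 0) = fps_X * (fps_X ^ r * bounded_fps r)"
    unfolding left_diff_distrib Suc by (simp only: mult_1_left add_diff_cancel_left' diff_eq_eq add.commute)
  also have "\<dots> = (1 - fps_X ^ Suc r) * (fps_X ^ Suc r * bounded_fps (Suc r))"
    unfolding bounded_fps_Suc[of r, symmetric] by (simp only: power_Suc mult_ac)
  finally show ?case using one_minus_X_power_nonzero[of r] by (simp only: mult_cancel_left) simp
qed

lemma gen_fps_big_parts: "gen_fps (big_parts r j) = fps_X ^ (r * j + r) * bounded_fps r"
  unfolding big_parts_shift[of r j] gen_fps_big_parts_0 by (simp add: power_add mult.assoc)

lemma gen_fps_mult: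
  assumes "\<And>P. P \<in> A \<Longrightarrow> 0 \<notin># P" "\<And>P. P \<in> B \<Longrightarrow> 0 \<notin># P"
  shows "fps_nth (gen_fps A * gen_fps B) n =
    real (card {(P, Q). P \<in> A \<and> Q \<in> B \<and> sum_mset P + sum_mset Q = n})"
proof -
  let ?S = "\<lambda>i. {P \<in> A. sum_mset P = i} \<times> {Q \<in> B. sum_mset Q = n - i}"
  have "{(P, Q). P \<in> A \<and> Q \<in> B \<and> sum_mset P + sum_mset Q = n} = (\<Union>i\<in>{0..n}. ?S i)" by auto
  moreover have "card (\<Union>i\<in>{0..n}. ?S i) = (\<Sum>i\<in>{0..n}. card (?S i))"
    by (rule card_UN_disjoint) (auto intro!: finite_cartesian_product finite_gen dest: assms)
  ultimately show ?thesis
    by (simp add: fps_mult_nth gen_fps_def card_cartesian_product)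
qed

text \<open>Such a partition splits into its \<open>j\<close> ones, its parts from 2 to
  \<open>j\<close>, and \<open>r\<close> parts greater than \<open>j\<close>. The factors are
  \<open>q^j\<close>, \<open>(1 - q) * bounded_fps j\<close> and
  \<open>q^(r j + r) * bounded_fps r\<close>.\<close>

lemma fps_nth_crank_class:
  assumes j: "j \<ge> 1"
  shows "real (card {P \<in> partitions n. count P 1 = j \<and> size {#p \<in># P. p > j#} = r}) =
    fps_nth ((1 - fps_X) * (fps_X ^ (r * j + r + j) * bounded_fps r * bounded_fps j)) n"
proof -
  let ?T = "{P \<in> partitions n. count P 1 = j \<and> size {#p \<in># P. p > j#} = r}"
  let ?U = "{(S, B). S \<in> parts_in {2..j} \<and> B \<in> big_parts r j \<and> sum_mset S + sum_mset B = n - j}"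
  have "card ?T = (if j \<le> n then card ?U else 0)"
  proof (cases "j \<le> n")
    case True
    let ?f = "\<lambda>P. ({#p \<in># P. 1 < p \<and> p \<le> j#}, {#p \<in># P. j < p#})"
    let ?g = "\<lambda>(S, B). S + replicate_mset j 1 + B"
    have dec: "{#p \<in># P. 1 < p \<and> p \<le> j#} + replicate_mset (count P 1) 1 + {#p \<in># P. j < p#} = P"
      if "0 \<notin># P" for P
    proof (rule multiset_eqI)
      fix x
      show "count ({#p \<in># P. 1 < p \<and> p \<le> j#} + replicate_mset (count P 1) 1
          + {#p \<in># P. j < p#}) x = count P x"
        using that j by (cases "x = 0"; cases "x = 1") (auto simp: not_in_iff)
    qed
    have "bij_betw ?f ?T ?U"
    proof (rule bij_betw_byWitness[where f' = ?g])
      show "\<forall>P\<in>?T. ?g (?f P) = P"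
      proof
        fix P assume "P \<in> ?T"
        then show "?g (?f P) = P" using dec[of P] by (simp add: partitions_def)
      qed
      show "?f ` ?T \<subseteq> ?U"
      proof
        fix x assume "x \<in> ?f ` ?T"
        then obtain P where P: "P \<in> ?T" "x = ?f P" by auto
        then have z: "0 \<notin># P" "sum_mset P = n" "count P 1 = j" by (auto simp: partitions_def)
        have "sum_mset {#p \<in># P. 1 < p \<and> p \<le> j#} + j + sum_mset {#p \<in># P. j < p#} = n"
          using arg_cong[OF dec[OF z(1)], of sum_mset] z by simp
        then show "x \<in> ?U" using P by (auto simp: parts_in_def big_parts_def)
      qed
      have sep: "{#p \<in># S. 1 < p \<and> p \<le> j#} = S" "{#p \<in># S. j < p#} = {#}" "count S 1 = 0" "0 \<notin># S"
        if "S \<in> parts_in {2..j}" for S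
        using that by (auto simp: parts_in_def filter_mset_eq_conv not_in_iff[symmetric])
      have sepB: "{#p \<in># B. 1 < p \<and> p \<le> j#} = {#}" "{#p \<in># B. j < p#} = B" "count B 1 = 0" "0 \<notin># B"
        if "B \<in> big_parts r j" for B
        using that j by (auto simp: big_parts_def filter_mset_eq_conv not_in_iff[symmetric])
      have rep: "{#p \<in># replicate_mset j (1::nat). 1 < p \<and> p \<le> j#}
          = {#}" "{#p \<in># replicate_mset j (1::nat). j < p#} = {#}"
        using j by auto
      show "\<forall>x\<in>?U. ?f (?g x) = x"
        using sep sepB rep by auto
      show "?g ` ?U \<subseteq> ?T"
      proof
        fix x assume "x \<in> ?g ` ?U"
        then obtain S B where SB: "S \<in> parts_in {2..j}" "B \<in> big_parts r j" "sum_mset S + sum_mset B = n - j"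
          "x = S + replicate_mset j 1 + B" by auto
        then show "x \<in> ?T"
          using sep[OF SB(1)] sepB[OF SB(2)] rep True
          using j by (simp add: partitions_def big_parts_def)
      qed
    qed
    then show ?thesis using True by (simp add: bij_betw_same_card)
  next
    case False
    have "count P 1 \<le> sum_mset P" for P :: "nat multiset" by (induction P) auto
    then have "?T = {}" using False by (auto simp: partitions_def)
    then show ?thesis using False by (simp only: card.empty if_False)
  qed
  also have "real \<dots> = fps_nth (fps_X ^ j * (gen_fps (parts_in {2..j}) * gen_fps (big_parts r j))) n"
    unfolding fps_X_power_mult_nth
    by (subst gen_fps_mult) (auto simp: parts_in_def big_parts_def)
  also have "fps_X ^ j * (gen_fps (parts_in {2..j}) * gen_fps (big_parts r j)) =
      (1 - fps_X) * (fps_X ^ (r * j + r + j) * bounded_fps r * bounded_fps j)"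
    unfolding gen_fps_no_ones[OF j] gen_fps_big_parts by (simp only: power_add mult_ac)
  finally show ?thesis .
qed

text \<open>The generating function of the partitions with \<open>j\<close> ones and \<open>r\<close> parts greater than \<open>j\<close>; for \<open>j = 0\<close>,
  of those without ones and with greatest part \<open>r\<close>, up to its values at \<open>q\<^sup>0\<close> and \<open>q\<^sup>1\<close>. These
  exceptions account for the conventional values of the crank count.\<close>

definition crank_term :: "nat \<Rightarrow> nat \<Rightarrow> real fps" where
  "crank_term r j = (1 - fps_X) * (fps_X ^ (r * j + r + j) * bounded_fps r * bounded_fps j)"

lemma crank_term_low: "n < r * j + r + j \<Longrightarrow> fps_nth (crank_term r j) n = 0"
proof -
  assume n: "n < r * j + r + j"
  have "crank_term r j = fps_X ^ (r * j + r + j) * ((1 - fps_X) * (bounded_fps r * bounded_fps j))"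
    unfolding crank_term_def by (simp only: mult_ac)
  then show ?thesis using n by (simp only: fps_X_power_mult_nth if_True)
qed

lemma bounded_fps_nth_0: "fps_nth (bounded_fps r) 0 = 1"
proof (induction r)
  case (Suc r)
  have "fps_nth ((1 - fps_X ^ Suc r) * bounded_fps (Suc r)) 0 = 1" by (simp only: bounded_fps_Suc Suc)
  then show ?case by (simp only: fps_mult_nth_0) simp
qed (simp add: bounded_fps_0)

lemma bounded_fps_1: "(1 - fps_X) * bounded_fps 1 = 1"
  using bounded_fps_Suc[of 0] by (simp add: bounded_fps_0)

text \<open>For \<open>m >= 2\<close> the series is \<open>q^m / ((1 - q^2) ... (1 - q^m))\<close>.
  For \<open>m = 0\<close> and \<open>m = 1\<close> it is \<open>1 - q\<close> and \<open>q\<close>,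
  without any coefficient from \<open>q^2\<close> on, whence the bound on \<open>n\<close>.\<close>

lemma fps_nth_no_ones_Max:
  assumes n: "n \<ge> 2"
  shows "real (card {P \<in> partitions n. 1 \<notin># P \<and> Max_mset P = m}) = fps_nth (crank_term m 0) n"
proof -
  let ?T = "{P \<in> partitions n. 1 \<notin># P \<and> Max_mset P = m}"
  have W: "crank_term m 0 = fps_X ^ m * ((1 - fps_X) * bounded_fps m)"
    by (simp add: crank_term_def bounded_fps_0 mult_ac)
  have inT: "P \<noteq> {#} \<and> m \<in># P \<and> m \<ge> 2 \<and> (\<forall>x\<in>#P. 2 \<le> x \<and> x \<le> m)" if "P \<in> ?T" for P
  proof -
    have "P \<in> partitions n" using that by simp
    then have ne: "P \<noteq> {#}" by (rule partition_nonempty) (use n in simp)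
    then have "m \<in># P" using that Max_in[of "set_mset P"] by auto
    moreover have "2 \<le> x" if "x \<in># P" for x
    proof -
      have "x \<noteq> 0" "x \<noteq> 1" using that \<open>P \<in> ?T\<close> by (metis (mono_tags, lifting) mem_Collect_eq partitions_def)+
      then show ?thesis by linarith
    qed
    ultimately show ?thesis using ne that by auto
  qed
  show ?thesis
  proof (cases "m \<ge> 2")
    case False
    then have "?T = {}" using inT by blast
    moreover have "fps_nth (crank_term m 0) n = 0"
    proof -
      have "m = 0 \<or> m = 1" using False by linarith
      then show ?thesis
      proof
        assume "m = 0"
        then show ?thesis using n unfolding W by (simp add: bounded_fps_0)
      next
        assume "m = 1"
        then show ?thesis using n unfolding W by (simp add: bounded_fps_1[unfolded One_nat_def])
      qed
    qed
    ultimately show ?thesis by (simp only: card.empty of_nat_0)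
  next
    case True
    let ?A = "{P \<in> parts_in {2..m-1}. sum_mset P = n}"
    have fin: "finite {P \<in> parts_in {2..m}. sum_mset P = n}"
      by (rule finite_gen) (auto simp: parts_in_def)
    have T: "?T = {P \<in> parts_in {2..m}. sum_mset P = n \<and> m \<in># P}"
    proof (intro set_eqI iffI)
      fix P assume P: "P \<in> ?T"
      then show "P \<in> {P \<in> parts_in {2..m}. sum_mset P = n \<and> m \<in># P}"
        using inT[OF P] by (auto simp: parts_in_def partitions_def)
    next
      fix P assume P: "P \<in> {P \<in> parts_in {2..m}. sum_mset P = n \<and> m \<in># P}"
      then have "Max_mset P = m" by (intro Max_eqI) (auto simp: parts_in_def)
      then show "P \<in> ?T" using P by (auto simp: parts_in_def partitions_def)
    qed
    have eq: "{P \<in> parts_in {2..m}. sum_mset P = n} = ?A \<union> ?T"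
    proof (intro set_eqI iffI)
      fix P assume P: "P \<in> {P \<in> parts_in {2..m}. sum_mset P = n}"
      show "P \<in> ?A \<union> ?T"
      proof (cases "m \<in># P")
        case True
        then show ?thesis using P unfolding T by simp
      next
        case False
        have "2 \<le> x \<and> x \<le> m - 1" if "x \<in># P" for x
        proof -
          have "x \<noteq> m" using that False by metis
          moreover have "2 \<le> x" "x \<le> m" using that P by (auto simp: parts_in_def)
          ultimately show ?thesis by linarith
        qed
        then show ?thesis using P by (auto simp: parts_in_def)
      qed
    next
      fix P assume "P \<in> ?A \<union> ?T"
      then show "P \<in> {P \<in> parts_in {2..m}. sum_mset P = n}"
      proof
        assume "P \<in> ?A"
        moreover have "{2..m-1} \<subseteq> {2..m}" by auto
        ultimately show ?thesis unfolding parts_in_def by blast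
      next
        assume "P \<in> ?T"
        then show ?thesis unfolding T by simp
      qed
    qed
    have "card (?A \<union> ?T) = card ?A + card ?T"
    proof (rule card_Un_disjoint)
      show "finite ?A" "finite ?T" using fin unfolding eq by (simp_all only: finite_Un)
      show "?A \<inter> ?T = {}" unfolding T using True by (auto simp: parts_in_def)
    qed
    then have "card {P \<in> parts_in {2..m}. sum_mset P = n} = card ?A + card ?T" unfolding eq .
    then have "real (card ?T) = fps_nth (gen_fps (parts_in {2..m})) n - fps_nth (gen_fps (parts_in {2..m-1})) n"
      by (simp add: gen_fps_def)
    moreover {
    have "(1 - fps_X ^ m) * gen_fps (parts_in {2..m}) = gen_fps (parts_in {2..m-1})"
    proof -
      have "{2..m} = insert m {2..m-1}" using True by auto
      then show ?thesis using gen_fps_parts_insert[of m "{2..m-1}"] True by simp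
    qed
    then have "gen_fps (parts_in {2..m}) - gen_fps (parts_in {2..m-1}) = fps_X ^ m * gen_fps (parts_in {2..m})"
      by (simp add: algebra_simps)
    }
    ultimately have "real (card ?T) = fps_nth (fps_X ^ m * gen_fps (parts_in {2..m})) n"
      by (simp only: fps_sub_nth[symmetric])
    then show ?thesis using True gen_fps_no_ones[of m] by (simp add: W)
  qed
qed

text \<open>Sorted by the number \<open>j\<close> of ones, crank \<open>m\<close> means
  \<open>m + j\<close> parts greater than \<open>j\<close>, which must not be negative. For
  \<open>n <= 1\<close> the stray coefficients of \<open>crank_term 0 0 = 1 - q\<close> and
  \<open>crank_term 1 0 = q\<close>, together with the term for \<open>j = 1\<close>, give exactly
  the conventional counts.\<close>

lemma crank_count_formula:
  "real_of_int (crank_count m n) =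
    (\<Sum>j\<le>n. if m + int j \<ge> 0 then fps_nth (crank_term (nat (m + int j)) j) n else 0)"
proof -
  have W0: "crank_term r 0 = fps_X ^ r * ((1 - fps_X) * bounded_fps r)" for r
    by (simp add: crank_term_def bounded_fps_0 mult_ac)
  consider "n = 0" | "n = 1" | "n \<ge> 2" by linarith
  then show ?thesis
  proof cases
    case 1
    have "(\<Sum>j\<le>0. F j) = F 0" for F :: "nat \<Rightarrow> real" by simp
    then show ?thesis unfolding 1 by (simp only:) (simp add: crank_count_def W0 fps_X_power_mult_nth bounded_fps_nth_0 nat_eq_iff)
  next
    case 2
    have t1: "fps_nth (crank_term r 1) 1 = (if r = 0 then 1 else 0)" for r
    proof (cases "r = 0")
      case True
      have "crank_term 0 1 = fps_X * ((1 - fps_X) * bounded_fps 1)"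
        by (simp add: crank_term_def bounded_fps_0 mult_ac)
      then show ?thesis using True by (simp only: bounded_fps_1) simp
    next
      case False
      then show ?thesis by (simp add: crank_term_low)
    qed
    have t0: "fps_nth (crank_term r 0) 1 = (if r = 0 then - 1 else if r = 1 then 1 else 0)" for r
    proof -
      consider "r = 0" | "r = 1" | "r \<ge> 2" by linarith
      then show ?thesis
      proof cases
        case 1
        then show ?thesis by (simp add: W0 bounded_fps_0)
      next
        case 2
        then show ?thesis unfolding W0 by (simp add: bounded_fps_1[unfolded One_nat_def])
      next
        case 3
        then show ?thesis by (simp add: crank_term_low)
      qed
    qed
    show ?thesis unfolding 2
      using t0 t1 by (auto simp: crank_count_def nat_eq_iff)
  next
    case 3
    define N where "N = {P \<in> partitions n. 1 \<notin># P \<and> int (Max_mset P) = m}"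
    define T where "T j = {P \<in> partitions n. count P 1 = j \<and> int (size {#p \<in># P. p > j#}) - int j = m}" for j
    have "{P \<in> partitions n. partition_crank P = m} = N \<union> (\<Union>j\<in>{1..n}. T j)"
    proof (intro set_eqI iffI)
      fix P assume P: "P \<in> {P \<in> partitions n. partition_crank P = m}"
      have "count P 1 \<le> size P" by (rule count_le_size)
      then have "count P 1 \<le> n" using partition_size_le[of P n] P by auto
      show "P \<in> N \<union> (\<Union>j\<in>{1..n}. T j)"
      proof (cases "1 \<in># P")
        case True
        then have "count P 1 \<in> {1..n}" using \<open>count P 1 \<le> n\<close> by (simp add: Suc_le_eq)
        moreover have "P \<in> T (count P 1)" using P True by (simp add: T_def partition_crank_def)
        ultimately show ?thesis by blast
      next
        case False
        then show ?thesis using P by (simp add: N_def partition_crank_def)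
      qed
    next
      fix P assume "P \<in> N \<union> (\<Union>j\<in>{1..n}. T j)"
      then consider "P \<in> N" | j where "j \<in> {1..n}" "P \<in> T j" by blast
      then show "P \<in> {P \<in> partitions n. partition_crank P = m}"
      proof cases
        case 1
        then show ?thesis by (simp add: N_def partition_crank_def)
      next
        case 2
        then have "count P 1 > 0" by (simp add: T_def)
        then have "1 \<in># P" by (simp only: count_greater_zero_iff)
        then show ?thesis using 2 by (auto simp: T_def partition_crank_def)
      qed
    qed
    moreover have "card (N \<union> (\<Union>j\<in>{1..n}. T j)) = card N + card (\<Union>j\<in>{1..n}. T j)"
    proof (rule card_Un_disjoint)
      show "finite N" unfolding N_def using finite_partitions by simp
      show "finite (\<Union>j\<in>{1..n}. T j)" unfolding T_def using finite_partitions by simp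
      show "N \<inter> (\<Union>j\<in>{1..n}. T j) = {}" by (auto simp: N_def T_def not_in_iff)
    qed
    moreover have "card (\<Union>j\<in>{1..n}. T j) = (\<Sum>j\<in>{1..n}. card (T j))"
      by (rule card_UN_disjoint) (auto simp: T_def finite_partitions)
    ultimately have "real_of_int (crank_count m n) = real (card N) + (\<Sum>j\<in>{1..n}. real (card (T j)))"
      using 3 by (simp add: crank_count_def)
    also have "real (card N) = (if m + int 0 \<ge> 0 then fps_nth (crank_term (nat (m + int 0)) 0) n else 0)"
    proof (cases "m \<ge> 0")
      case True
      then have "N = {P \<in> partitions n. 1 \<notin># P \<and> Max_mset P = nat m}" by (auto simp: N_def)
      then show ?thesis using fps_nth_no_ones_Max[OF 3, of "nat m"] True by simp
    next
      case False
      then have "N = {}" by (auto simp: N_def)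
      then show ?thesis using False by simp
    qed
    also have "(\<Sum>j\<in>{1..n}. real (card (T j))) =
      (\<Sum>j\<in>{1..n}. if m + int j \<ge> 0 then fps_nth (crank_term (nat (m + int j)) j) n else 0)"
    proof (rule sum.cong)
      fix j assume j: "j \<in> {1..n}"
      show "real (card (T j)) = (if m + int j \<ge> 0 then fps_nth (crank_term (nat (m + int j)) j) n else 0)"
      proof (cases "m + int j \<ge> 0")
        case True
        then have "T j = {P \<in> partitions n. count P 1 = j \<and> size {#p \<in># P. p > j#} = nat (m + int j)}"
          by (auto simp: T_def)
        then show ?thesis using fps_nth_crank_class[of j n "nat (m + int j)"] j True
          by (simp add: crank_term_def)
      next
        case False
        then have "T j = {}" by (auto simp: T_def)
        then show ?thesis using False by simp
      qed
    qed simp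
    also have "{..n} = insert 0 {1..n}" by auto
    then have "(if m + int 0 \<ge> 0 then fps_nth (crank_term (nat (m + int 0)) 0) n else 0) +
      (\<Sum>j\<in>{1..n}. if m + int j \<ge> 0 then fps_nth (crank_term (nat (m + int j)) j) n else 0) =
      (\<Sum>j\<le>n. if m + int j \<ge> 0 then fps_nth (crank_term (nat (m + int j)) j) n else 0)" by simp
    finally show ?thesis .
  qed
qed

text \<open>The cut-off \<open>j \<le> n\<close> in \<open>lsum f\<close> is harmless only if \<open>low f\<close>.\<close>

definition low :: "(nat \<Rightarrow> real fps) \<Rightarrow> bool" where
  "low f \<longleftrightarrow> (\<forall>j n. n < j \<longrightarrow> fps_nth (f j) n = 0)"

definition lsum :: "(nat \<Rightarrow> real fps) \<Rightarrow> real fps" where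
  "lsum f = Abs_fps (\<lambda>n. \<Sum>j\<le>n. fps_nth (f j) n)"

lemma lsum_nth: "low f \<Longrightarrow> n \<le> N \<Longrightarrow> fps_nth (lsum f) n = (\<Sum>j\<le>N. fps_nth (f j) n)"
  unfolding lsum_def low_def fps_nth_Abs_fps by (rule sum.mono_neutral_left) auto

lemma lsum_shift: "low f \<Longrightarrow> lsum f = f 0 + lsum (\<lambda>j. f (Suc j))"
proof (rule fps_ext)
  fix n assume f: "low f"
  have f': "low (\<lambda>j. f (Suc j))" using f by (simp add: low_def)
  have "fps_nth (lsum f) n = (\<Sum>j\<le>Suc n. fps_nth (f j) n)" by (rule lsum_nth[OF f]) simp
  also have "\<dots> = fps_nth (f 0) n + (\<Sum>j\<le>n. fps_nth (f (Suc j)) n)" by (rule sum.atMost_Suc_shift)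
  finally show "fps_nth (lsum f) n = fps_nth (f 0 + lsum (\<lambda>j. f (Suc j))) n"
    using lsum_nth[OF f', of n n] by simp
qed

lemma lsum_mult: "low f \<Longrightarrow> g * lsum f = lsum (\<lambda>j. g * f j)"
proof (rule fps_ext)
  fix n assume f: "low f"
  have "fps_nth (g * lsum f) n = (\<Sum>i=0..n. \<Sum>j\<le>n. fps_nth g i * fps_nth (f j) (n - i))"
    unfolding fps_mult_nth using lsum_nth[OF f, of _ n] by (simp add: sum_distrib_left)
  also have "\<dots> = (\<Sum>j\<le>n. fps_nth (g * f j) n)"
    unfolding fps_mult_nth by (rule sum.swap)
  finally show "fps_nth (g * lsum f) n = fps_nth (lsum (\<lambda>j. g * f j)) n"
    by (simp add: lsum_def)
qed

lemma lsum_diff: "lsum f - lsum g = lsum (\<lambda>j. f j - g j)"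
  by (rule fps_ext) (simp add: lsum_def sum_subtractf)

lemma low_X_power: "(\<And>j. j \<le> e j) \<Longrightarrow> low (\<lambda>j. fps_X ^ e j * g j)"
  unfolding low_def by (auto simp: fps_X_power_mult_nth) (meson less_le_trans not_le)

lemma factor_left: "x * (u * v) - x * y * (u * v) = x * ((1 - y) * u * v)"
  and factor_right: "x * (u * v) - x * y * (u * v) = x * (u * ((1 - y) * v))" for x :: "real fps"
  by (simp_all add: algebra_simps)

text \<open>\<open>crank_A m\<close> generates the numbers of partitions with crank at most \<open>m\<close>, and \<open>q\<^sup>m\<close> times it
  those with crank at most \<open>- m\<close>.\<close>

definition crank_A :: "nat \<Rightarrow> real fps" where
  "crank_A m = lsum (\<lambda>j. fps_X ^ ((m + j) * j + j) * (bounded_fps (m + j) * bounded_fps j))"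

definition crank_B :: "nat \<Rightarrow> real fps" where
  "crank_B m = lsum (\<lambda>j. fps_X ^ ((m + j) * j + m + 2 * j) * (bounded_fps (m + j) * bounded_fps j))"

lemma crank_A_low: "low (\<lambda>j. fps_X ^ ((m + j) * j + j) * g j)"
  by (rule low_X_power) simp

lemma crank_B_low: "low (\<lambda>j. fps_X ^ ((m + j) * j + m + 2 * j) * g j)"
  by (rule low_X_power) simp

text \<open>Both series on the left are compared with \<open>lsum D\<close>, which has the exponents
  of \<open>crank_A (Suc m)\<close> and the denominators of \<open>crank_A m\<close>. The factor
  \<open>1 - q^(m+1+j)\<close> lowers a denominator and gives
  \<open>crank_A (Suc m) - crank_B (Suc m) = lsum D\<close>; the factor \<open>1 - q^j\<close> kills
  the term \<open>j = 0\<close>, and a shift of \<open>j\<close> gives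
  \<open>crank_A m - lsum D = q * crank_B (Suc m)\<close>.\<close>

lemma crank_A_diff: "crank_A (Suc m) - crank_A m = (1 - fps_X) * crank_B (Suc m)"
proof -
  let ?w = bounded_fps
  define D where "D j = fps_X ^ ((Suc m + j) * j + j) * (?w (m + j) * ?w j)" for j
  have lowD: "low D" unfolding D_def by (rule crank_A_low)
  have "crank_A (Suc m) - crank_B (Suc m) = lsum D"
    unfolding crank_A_def crank_B_def lsum_diff
  proof (rule arg_cong[where f = lsum], rule ext)
    fix j
    have e: "Suc m + j = Suc (m + j)"
      "Suc (m + j) * j + Suc m + 2 * j = Suc (m + j) * j + j + Suc (m + j)" by simp_all
    have "fps_X ^ ((Suc m + j) * j + j) * (?w (Suc m + j) * ?w j)
        - fps_X ^ ((Suc m + j) * j + Suc m + 2 * j) * (?w (Suc m + j) * ?w j) =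
      fps_X ^ ((Suc m + j) * j + j) * (((1 - fps_X ^ Suc (m + j)) * ?w (Suc (m + j))) * ?w j)"
      unfolding e power_add[of fps_X _ "Suc (m + j)"] by (rule factor_left)
    then show "fps_X ^ ((Suc m + j) * j + j) * (?w (Suc m + j) * ?w j)
        - fps_X ^ ((Suc m + j) * j + Suc m + 2 * j) * (?w (Suc m + j) * ?w j) = D j"
      by (simp only: bounded_fps_Suc D_def)
  qed
  moreover have "crank_A m - lsum D = fps_X * crank_B (Suc m)"
  proof -
    define F where "F j = fps_X ^ ((m + j) * j + j) * (?w (m + j) * ((1 - fps_X ^ j) * ?w j))" for j
    have lowF: "low F" unfolding F_def by (rule crank_A_low)
    have "crank_A m - lsum D = lsum F"
      unfolding crank_A_def lsum_diff
    proof (rule arg_cong[where f = lsum], rule ext)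
      fix j
      have "(Suc m + j) * j + j = (m + j) * j + j + j" by simp
      then have "D j = fps_X ^ ((m + j) * j + j) * fps_X ^ j * (?w (m + j) * ?w j)"
        unfolding D_def by (simp only: power_add)
      then show "fps_X ^ ((m + j) * j + j) * (?w (m + j) * ?w j) - D j = F j"
        unfolding F_def by (simp only: factor_right)
    qed
    also have "\<dots> = F 0 + lsum (\<lambda>j. F (Suc j))" by (rule lsum_shift[OF lowF])
    also have "F 0 = 0" by (simp add: F_def)
    also have "(\<lambda>j. F (Suc j)) = (\<lambda>j. fps_X * (fps_X ^ ((Suc m + j) * j + Suc m
        + 2 * j) * (?w (Suc m + j) * ?w j)))"
    proof (rule ext)
      fix j
      have "(m + Suc j) * Suc j + Suc j = Suc ((Suc m + j) * j + Suc m + 2 * j)" by simp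
      moreover have "m + Suc j = Suc m + j" by simp
      ultimately show "F (Suc j) = fps_X * (fps_X ^ ((Suc m + j) * j + Suc m + 2 * j) * (?w (Suc m + j) * ?w j))"
        unfolding F_def bounded_fps_Suc by (simp only: power_Suc mult_ac)
    qed
    also have "0 + lsum \<dots> = fps_X * crank_B (Suc m)"
      unfolding crank_B_def by (simp only: add_0_left lsum_mult[OF crank_B_low])
    finally show ?thesis .
  qed
  ultimately show ?thesis by (simp add: algebra_simps)
qed

text \<open>The companion for crank exactly \<open>- m\<close>, by the same two cancellations: the
  intermediate series differs from \<open>q^m * crank_A m\<close> by \<open>crank_B m\<close> and
  from \<open>q^(m+1) * crank_A (Suc m)\<close> by \<open>q * crank_B m\<close>.\<close>

lemma crank_A_diff_shift:
  "fps_X ^ m * crank_A m - fps_X ^ Suc m * crank_A (Suc m) = (1 - fps_X) * crank_B m"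
proof -
  let ?w = bounded_fps
  define D where "D j = fps_X ^ ((m + j) * j + m + j) * (?w (m + j) * ((1 - fps_X ^ j) * ?w j))" for j
  have lowD: "low D" unfolding D_def by (rule low_X_power) simp
  have XA: "fps_X ^ m * crank_A m = lsum (\<lambda>j. fps_X ^ ((m + j) * j + m + j) * (?w (m + j) * ?w j))" for m
    unfolding crank_A_def by (subst lsum_mult[OF crank_A_low]) (simp add: power_add mult_ac)
  have "fps_X ^ m * crank_A m - crank_B m = lsum D"
    unfolding XA crank_B_def lsum_diff
  proof (rule arg_cong[where f = lsum], rule ext)
    fix j
    have "(m + j) * j + m + 2 * j = (m + j) * j + m + j + j" by simp
    then show "fps_X ^ ((m + j) * j + m + j) * (?w (m + j) * ?w j)
        - fps_X ^ ((m + j) * j + m + 2 * j) * (?w (m + j) * ?w j) = D j"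
      unfolding D_def by (simp only: power_add[of _ _ j] factor_right)
  qed
  also have "lsum D = D 0 + lsum (\<lambda>j. D (Suc j))" by (rule lsum_shift[OF lowD])
  also have "D 0 = 0" by (simp add: D_def)
  finally have 1: "fps_X ^ m * crank_A m - crank_B m = lsum (\<lambda>j. D (Suc j))" by simp
  have "fps_X ^ Suc m * crank_A (Suc m) - lsum (\<lambda>j. D (Suc j))
      = lsum (\<lambda>j. fps_X * (fps_X ^ ((m + j) * j + m + 2 * j) * (?w (m + j) * ?w j)))"
    unfolding XA lsum_diff
  proof (rule arg_cong[where f = lsum], rule ext)
    fix j
    have e1: "(m + Suc j) * Suc j + m + Suc j = (Suc m + j) * j + Suc m + j + Suc (m + j)" by simp
    have e2: "(Suc m + j) * j + Suc m + j = Suc ((m + j) * j + m + 2 * j)" by simp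
    have e3: "m + Suc j = Suc (m + j)" "Suc m + j = Suc (m + j)" by simp_all
    have "D (Suc j) = fps_X ^ ((Suc m + j) * j + Suc m + j + Suc (m + j)) * (?w (Suc (m + j)) * ?w j)"
      unfolding D_def e1 bounded_fps_Suc by (simp only: e3)
    then have "fps_X ^ ((Suc m + j) * j + Suc m + j) * (?w (Suc m + j) * ?w j) - D (Suc j) =
       fps_X ^ ((Suc m + j) * j + Suc m + j) * (((1 - fps_X ^ Suc (m + j)) * ?w (Suc (m + j))) * ?w j)"
      unfolding e3(2) power_add[of fps_X _ "Suc (m + j)"] by (simp only: factor_left)
    then show "fps_X ^ ((Suc m + j) * j + Suc m + j) * (?w (Suc m + j) * ?w j) - D (Suc j) =
        fps_X * (fps_X ^ ((m + j) * j + m + 2 * j) * (?w (m + j) * ?w j))"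
      unfolding bounded_fps_Suc e2 by (simp only: power_Suc mult_ac)
  qed
  also have "\<dots> = fps_X * crank_B m"
    unfolding crank_B_def by (rule lsum_mult[OF crank_B_low, symmetric])
  finally show ?thesis using 1 by (simp add: algebra_simps)
qed

lemma crank_count_nonneg: "real_of_int (crank_count (int m) n) = fps_nth ((1 - fps_X) * crank_B m) n"
proof -
  have "(1 - fps_X) * crank_B m = lsum (\<lambda>j. crank_term (m + j) j)"
    unfolding crank_B_def
    by (subst lsum_mult[OF crank_B_low]) (simp add: crank_term_def mult_2 add.assoc mult.assoc)
  then show ?thesis
    by (simp add: crank_count_formula lsum_def nat_int_add)
qed

text \<open>\<open>crank_term r j\<close> is symmetric in \<open>r\<close> and \<open>j\<close>.
  Exchanging the number of ones with the number of larger parts negates the crank, so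
  \<open>m\<close> and \<open>- m\<close> share one series.\<close>

lemma crank_count_nonpos: "real_of_int (crank_count (- int m) n) = fps_nth ((1 - fps_X) * crank_B m) n"
proof -
  have "(1 - fps_X) * crank_B m = lsum (\<lambda>j. crank_term j (m + j))"
    unfolding crank_B_def
  proof (subst lsum_mult[OF crank_B_low], rule arg_cong[where f = lsum], rule ext)
    fix j
    have "j * (m + j) + j + (m + j) = (m + j) * j + m + 2 * j" by simp
    then show "(1 - fps_X) * (fps_X ^ ((m + j) * j + m + 2 * j) * (bounded_fps (m + j) * bounded_fps j)) =
        crank_term j (m + j)"
      unfolding crank_term_def by (simp only: mult_ac)
  qed
  moreover have "low (\<lambda>j. crank_term j (m + j))"
    by (auto simp: low_def intro!: crank_term_low)
  moreover have "(\<Sum>j\<le>n + m. if - int m + int j \<ge> 0 then fps_nth (crank_term (nat (- int m + int j)) j) n else 0)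
    = (\<Sum>r\<le>n. fps_nth (crank_term r (m + r)) n)"
  proof -
    have "(\<Sum>j\<le>n + m. if - int m + int j \<ge> 0 then fps_nth (crank_term (nat (- int m + int j)) j) n else 0) =
      (\<Sum>j\<in>{m..n+m}. fps_nth (crank_term (j - m) j) n)"
      by (rule sum.mono_neutral_cong_right) (auto simp: nat_diff_distrib)
    also have "\<dots> = (\<Sum>r\<le>n. fps_nth (crank_term r (m + r)) n)"
      by (rule sum.reindex_bij_witness[where i = "\<lambda>r. m + r" and j = "\<lambda>j. j - m"]) auto
    finally show ?thesis .
  qed
  moreover have "(\<Sum>j\<le>n + m. if - int m + int j \<ge> 0 then fps_nth (crank_term (nat (- int m
      + int j)) j) n else 0) =
     (\<Sum>j\<le>n. if - int m + int j \<ge> 0 then fps_nth (crank_term (nat (- int m + int j)) j) n else 0)"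
    by (rule sum.mono_neutral_right) (auto intro!: crank_term_low)
  ultimately show ?thesis by (simp add: crank_count_formula lsum_def)
qed

section \<open>The logarithmic derivative of the partition series\<close>

definition divisor_part :: "nat \<Rightarrow> real fps" where
  "divisor_part k = Abs_fps (\<lambda>n. if n > 0 \<and> k dvd n then real k else 0)"

text \<open>This identifies \<open>divisor_part k\<close> as \<open>k q^k / (1 - q^k)\<close>, the
  negative of the logarithmic derivative \<open>q d/dq\<close> of \<open>1 - q^k\<close>.\<close>

lemma divisor_part_mult:
  "(1 - fps_X ^ Suc k) * divisor_part (Suc k) = of_nat (Suc k) * fps_X ^ Suc k"
proof (rule fps_ext)
  fix n
  have "fps_nth (divisor_part (Suc k)) n - (if n < Suc k then 0 else fps_nth (divisor_part (Suc k)) (n - Suc k)) =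
      real (Suc k) * (if n = Suc k then 1 else 0)"
  proof (cases "n < Suc k")
    case True
    then show ?thesis by (auto simp: divisor_part_def dest: dvd_imp_le)
  next
    case False
    then show ?thesis using dvd_minus_self[of "Suc k" n] by (auto simp: divisor_part_def)
  qed
  then show "fps_nth ((1 - fps_X ^ Suc k) * divisor_part (Suc k)) n = fps_nth (of_nat (Suc k) * fps_X ^ Suc k) n"
    by (simp only: left_diff_distrib mult_1_left fps_sub_nth fps_X_power_mult_nth fps_nth_of_nat_mult fps_X_power_nth)
qed

lemma fps_XD_mult: "fps_XD (f * g) = fps_XD f * g + f * fps_XD (g :: 'a::comm_ring_1 fps)"
  by (simp add: fps_XD_def algebra_simps)

lemma fps_XD_X_power: "fps_XD (fps_X ^ k) = of_nat k * (fps_X ^ k :: 'a::comm_ring_1 fps)"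
  by (rule fps_ext) (simp add: fps_nth_of_nat_mult)

lemma fps_XD_bounded: "fps_XD (bounded_fps r) = bounded_fps r * (\<Sum>k\<in>{1..r}. divisor_part k)"
proof (induction r)
  case 0
  then show ?case by (simp add: bounded_fps_0 fps_XD_def)
next
  case (Suc r)
  let ?w = "bounded_fps (Suc r)" and ?S = "\<Sum>k\<in>{1..r}. divisor_part k" and ?u = "1 - fps_X ^ Suc r :: real fps"
  have Du: "fps_XD ?u = - (of_nat (Suc r) * fps_X ^ Suc r)"
    using fps_XD_X_power[of "Suc r", where 'a = real] by (simp add: fps_XD_def)
  have "fps_XD (?u * ?w) = ?u * ?w * ?S" unfolding bounded_fps_Suc by (rule Suc)
  then have "?u * fps_XD ?w = ?u * ?w * ?S + of_nat (Suc r) * fps_X ^ Suc r * ?w"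
    unfolding fps_XD_mult Du by (simp add: algebra_simps)
  also have "\<dots> = ?u * (?w * (?S + divisor_part (Suc r)))"
    unfolding divisor_part_mult[symmetric] by (simp only: algebra_simps)
  finally have "fps_XD ?w = ?w * (?S + divisor_part (Suc r))"
    using one_minus_X_power_nonzero[of r] by (simp only: mult_cancel_left) simp
  then show ?case by (simp add: add.commute)
qed

lemma partition_fps_nth_bounded: "n \<le> r \<Longrightarrow> fps_nth (bounded_fps r) n = fps_nth partition_fps n"
proof -
  assume n: "n \<le> r"
  have "{P \<in> parts_in {1..r}. sum_mset P = n} = partitions n"
  proof (intro set_eqI iffI)
    fix P assume P: "P \<in> partitions n"
    have "1 \<le> x \<and> x \<le> r" if "x \<in># P" for x
    proof -
      have "x \<le> sum_mset P" using that by (metis sum_mset.remove le_add1)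
      moreover have "x \<noteq> 0" using that P by (metis (mono_tags, lifting) mem_Collect_eq partitions_def)
      ultimately show ?thesis using P n by (simp add: partitions_def)
    qed
    then show "P \<in> {P \<in> parts_in {1..r}. sum_mset P = n}" using P by (auto simp: parts_in_def partitions_def)
  qed (auto simp: parts_in_def partitions_def)
  then show ?thesis by (simp add: bounded_fps_def gen_fps_def partition_fps_def)
qed

lemma sum_divisor_part_nth:
  "n \<le> r \<Longrightarrow> fps_nth (\<Sum>k\<in>{1..r}. divisor_part k) n = fps_nth (sigma_fps 1) n"
proof -
  assume n: "n \<le> r"
  have "fps_nth (\<Sum>k\<in>{1..r}. divisor_part k) n = (\<Sum>k\<in>{1..r}. if n > 0 \<and> k dvd n then real k else 0)"
    by (simp add: fps_sum_nth divisor_part_def)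
  also have "\<dots> = (\<Sum>k | k \<in> {1..n} \<and> k dvd n. real k)"
    by (rule sum.mono_neutral_cong_right) (use n in \<open>auto dest: dvd_imp_le\<close>)
  finally show ?thesis by (simp add: sigma_fps_def)
qed

text \<open>The infinite product is bypassed: up to \<open>q^n\<close> the partition series agrees
  with \<open>bounded_fps n\<close>, whose logarithmic derivative is a finite sum.\<close>

lemma fps_XD_partition: "fps_XD partition_fps = sigma_fps 1 * partition_fps"
proof (rule fps_ext)
  fix n
  have "fps_nth (fps_XD partition_fps) n = fps_nth (fps_XD (bounded_fps n)) n"
    by (simp add: partition_fps_nth_bounded)
  also have "\<dots> = fps_nth (partition_fps * sigma_fps 1) n"
    unfolding fps_XD_bounded fps_mult_nth
    by (rule sum.cong) (auto simp: partition_fps_nth_bounded sum_divisor_part_nth simp del: One_nat_def)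
  finally show "fps_nth (fps_XD partition_fps) n = fps_nth (sigma_fps 1 * partition_fps) n"
    by (simp only: mult.commute)
qed

section \<open>The crank series, its two symmetries and its moments\<close>

definition crank_series :: "real fps fps" where
  "crank_series = Abs_fps (\<lambda>n. Abs_fps (\<lambda>i. real_of_int (crank_count (int i - int n) n)))"

lemma crank_count_eq_0: "int n < \<bar>m\<bar> \<Longrightarrow> crank_count m n = 0"
proof -
  assume m: "int n < \<bar>m\<bar>"
  have "real_of_int (crank_count m n) = 0"
    unfolding crank_count_formula
  proof (intro sum.neutral ballI)
    fix j assume "j \<in> {..n}"
    then show "(if m + int j \<ge> 0 then fps_nth (crank_term (nat (m + int j)) j) n else 0) = 0"
      using m by (auto intro!: crank_term_low)
  qed
  then show ?thesis by simp
qed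

lemma crank_count_minus: "crank_count (- m) n = crank_count m n"
proof -
  have "real_of_int (crank_count (- m) n) = real_of_int (crank_count m n)"
  proof (cases "m \<ge> 0")
    case True
    then show ?thesis using crank_count_nonneg[of "nat m" n] crank_count_nonpos[of "nat m" n] by simp
  next
    case False
    then show ?thesis using crank_count_nonneg[of "nat (- m)" n] crank_count_nonpos[of "nat (- m)" n] by simp
  qed
  then show ?thesis by simp
qed

lemma zsym_crank_series: "zsym 1 crank_series"
  unfolding zsym_def balanced_def
proof (intro conjI allI impI)
  fix n i :: nat
  {
    assume "2 * n < i"
    then show "coeff2 crank_series n i = 0" by (simp add: crank_series_def crank_count_eq_0)
  next
    assume "i \<le> 2 * n"
    then have "int (2 * n - i) - int n = - (int i - int n)" by simp
    then show "coeff2 crank_series n (2 * n - i) = 1 * coeff2 crank_series n i"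
      unfolding crank_series_def by (simp only: fps_nth_Abs_fps crank_count_minus mult_1_left)
  }
qed

definition crank_cum :: "real fps fps" where
  "crank_cum = fps_const (inverse (1 - fps_X)) * crank_series"

lemma crank_series_cum: "crank_series = fps_const (1 - fps_X) * crank_cum"
proof -
  have "(1 - fps_X) * inverse (1 - fps_X) = (1 :: real fps)"
    by (subst mult.commute) (rule inverse_mult_eq_1, simp)
  then show ?thesis by (simp add: crank_cum_def mult.assoc[symmetric])
qed

text \<open>The coefficient accumulates the counts of cranks up to \<open>i - n\<close>. If this is
  negative, the series has the prefactor \<open>q^(n-i)\<close>, and cancelling it turns the
  exponent \<open>n\<close> into \<open>i\<close>. The formula is visibly symmetric in
  \<open>n\<close> and \<open>i\<close>, which is the exchange symmetry.\<close>

lemma crank_cum_nth: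
  "coeff2 crank_cum n i = (if i \<le> n then fps_nth (crank_A (n - i)) i else fps_nth (crank_A (i - n)) n)"
proof (induction i)
  case 0
  have "coeff2 crank_cum n 0 = real_of_int (crank_count (- int n) n)"
    by (simp add: coeff2_partial_sum[OF crank_series_cum] crank_series_def)
  also have "\<dots> = fps_nth (fps_X ^ n * crank_A n - fps_X ^ Suc n * crank_A (Suc n)) n"
    by (simp only: crank_count_nonpos crank_A_diff_shift)
  also have "\<dots> = fps_nth (crank_A n) 0"
    by (simp only: fps_sub_nth fps_X_power_mult_nth) simp
  finally show ?case by simp
next
  case (Suc i)
  have step: "coeff2 crank_cum n (Suc i) = coeff2 crank_cum n i + real_of_int (crank_count (int (Suc i) - int n) n)"
    by (simp add: coeff2_partial_sum[OF crank_series_cum] crank_series_def)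
  show ?case
  proof (cases "Suc i \<le> n")
    case True
    define m where "m = n - Suc i"
    have m: "n - i = Suc m" "int (Suc i) - int n = - int m" "n = m + Suc i" using True by (auto simp: m_def)
    have "real_of_int (crank_count (int (Suc i) - int n) n) =
        fps_nth (fps_X ^ m * crank_A m - fps_X ^ Suc m * crank_A (Suc m)) n"
      unfolding m(2) by (simp only: crank_count_nonpos crank_A_diff_shift)
    also have "\<dots> = fps_nth (crank_A m) (Suc i) - fps_nth (crank_A (Suc m)) i"
      by (simp only: fps_sub_nth fps_X_power_mult_nth) (simp add: m(3))
    finally show ?thesis using Suc step True m(1) by (simp add: m_def[symmetric])
  next
    case False
    define m where "m = i - n"
    have m: "int (Suc i) - int n = int (Suc m)" "Suc i - n = Suc m" using False by (auto simp: m_def)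
    have "real_of_int (crank_count (int (Suc i) - int n) n) = fps_nth (crank_A (Suc m) - crank_A m) n"
      unfolding m(1) by (simp only: crank_count_nonneg crank_A_diff)
    moreover have "coeff2 crank_cum n i = fps_nth (crank_A m) n"
      using Suc False by (cases "i = n") (auto simp: m_def)
    ultimately show ?thesis using step False m(2) by simp
  qed
qed

lemma swap2_crank_cum: "swap2 crank_cum = crank_cum"
  by (rule fps2_eqI) (auto simp: crank_cum_nth)

lemma sum_centered: "(\<Sum>i\<le>2*n. g (int i - int n)) = (\<Sum>k\<in>{- int n..int n}. g k)"
  by (rule sum.reindex_bij_witness[where i = "\<lambda>k. nat (k + int n)" and j = "\<lambda>i. int i - int n"]) auto

lemma crank_moment_eq: "real_of_int (crank_moment a n) = fps_nth (zmoment a crank_series) n"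
proof -
  have "crank_moment a n = (\<Sum>k\<in>{- int n..int n}. k ^ a * crank_count k n)"
    unfolding crank_moment_def
  proof (rule Sum_any.expand_superset)
    show "{k. k ^ a * crank_count k n \<noteq> 0} \<subseteq> {- int n..int n}"
    proof
      fix k assume "k \<in> {k. k ^ a * crank_count k n \<noteq> 0}"
      then have "crank_count k n \<noteq> 0" by auto
      then have "\<not> int n < \<bar>k\<bar>" using crank_count_eq_0 by blast
      then show "k \<in> {- int n..int n}" by auto
    qed
  qed simp
  then have "real_of_int (crank_moment a n)
      = (\<Sum>k\<in>{- int n..int n}. real_of_int k ^ a * real_of_int (crank_count k n))"
    by simp
  also have "\<dots> = (\<Sum>i\<le>2*n. real_of_int (int i - int n) ^ a * real_of_int (crank_count (int i - int n) n))"
    by (rule sum_centered[symmetric])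
  finally show ?thesis by (simp add: zmoment_def crank_series_def)
qed

lemma card_fibers:
  assumes "finite A" "finite S" "\<And>x. x \<in> A \<Longrightarrow> f x \<in> S"
  shows "card A = (\<Sum>k\<in>S. card {x \<in> A. f x = k})"
proof -
  have "A = (\<Union>k\<in>S. {x \<in> A. f x = k})" using assms by auto
  moreover have "card (\<Union>k\<in>S. {x \<in> A. f x = k}) = (\<Sum>k\<in>S. card {x \<in> A. f x = k})"
    by (rule card_UN_disjoint) (use assms in auto)
  ultimately show ?thesis by metis
qed

lemma partitions_1: "partitions 1 = {{#1#}}"
proof (intro set_eqI iffI)
  fix P :: "nat multiset" assume P: "P \<in> partitions 1"
  then have "size P = 1" using partition_Max_size[OF P] by simp
  then obtain x where "P = {#x#}" using size_1_singleton_mset by blast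
  then show "P \<in> {{#1#}}" using P by (simp add: partitions_def)
qed (simp add: partitions_def)

text \<open>At \<open>n = 1\<close> the conventional values \<open>- 1\<close>, \<open>1\<close>,
  \<open>1\<close> still add up to the number of partitions.\<close>

lemma crank_mass: "zmoment 0 crank_series = partition_fps"
proof (rule fps_ext)
  fix n
  have "fps_nth (zmoment 0 crank_series) n = (\<Sum>k\<in>{- int n..int n}. real_of_int (crank_count k n))"
    by (simp add: zmoment_def crank_series_def sum_centered[of "\<lambda>k. real_of_int (crank_count k n)"])
  also have "\<dots> = real (card (partitions n))"
  proof -
    consider "n = 0" | "n = 1" | "n \<ge> 2" by linarith
    then show ?thesis
    proof cases
      case 1
      then show ?thesis by (simp add: crank_count_def partitions_0)
    next
      case 2
      have "{- int 1..int 1} = {-1, 0, 1}" by auto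
      then show ?thesis unfolding 2 partitions_1 by (simp add: crank_count_def)
    next
      case 3
      have c: "crank_count k n = int (card {P \<in> partitions n. partition_crank P = k})" for k
        using 3 by (simp add: crank_count_def)
      have "card (partitions n) = (\<Sum>k\<in>{- int n..int n}. card {P \<in> partitions n. partition_crank P = k})"
      proof (rule card_fibers)
        fix P assume P: "P \<in> partitions n"
        then have "crank_count (partition_crank P) n \<noteq> 0"
          by (auto simp: c card_eq_0_iff finite_partitions)
        then have "\<bar>partition_crank P\<bar> \<le> int n" using crank_count_eq_0 not_le by blast
        then show "partition_crank P \<in> {- int n..int n}" by auto
      qed (simp_all add: finite_partitions)
      then show ?thesis by (simp add: c)
    qed
  qed
  finally show "fps_nth (zmoment 0 crank_series) n = fps_nth partition_fps n"
    by (simp add: partition_fps_def)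
qed

lemma partition_fps_0: "fps_nth partition_fps 0 = 1"
  by (simp add: partition_fps_def partitions_0)

section \<open>Rank counts: support, moments as finite sums, and accumulation\<close>

lemma rank_count_eq_0: "int n \<le> \<bar>m\<bar> \<Longrightarrow> m \<noteq> 0 \<Longrightarrow> rank_count m n = 0"
proof -
  assume m: "int n \<le> \<bar>m\<bar>" "m \<noteq> 0"
  have "partition_rank P \<noteq> m" if "P \<in> partitions n" "n \<noteq> 0" for P
    using partition_Max_size[OF that] partition_size_le[OF that(1)] m by (auto simp: partition_rank_def)
  then show ?thesis using m by (auto simp: rank_count_def card_eq_0_iff)
qed

definition rank_fps :: "nat \<Rightarrow> real fps" where
  "rank_fps a = Abs_fps (\<lambda>n. real_of_int (rank_moment a n))"

lemma rank_fps_nth: "fps_nth (rank_fps a) n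
    = (\<Sum>k\<in>{- int n..int n}. real_of_int k ^ a * real_of_int (rank_count k n))"
proof -
  have "rank_moment a n = (\<Sum>k\<in>{- int n..int n}. k ^ a * rank_count k n)"
    unfolding rank_moment_def
  proof (rule Sum_any.expand_superset)
    show "{k. k ^ a * rank_count k n \<noteq> 0} \<subseteq> {- int n..int n}"
    proof
      fix k assume "k \<in> {k. k ^ a * rank_count k n \<noteq> 0}"
      then have "rank_count k n \<noteq> 0" by auto
      then have "\<not> (int n \<le> \<bar>k\<bar> \<and> k \<noteq> 0)" using rank_count_eq_0 by blast
      then show "k \<in> {- int n..int n}" by auto
    qed
  qed simp
  then show ?thesis by (simp add: rank_fps_def)
qed

lemma rank_mass: "rank_fps 0 = partition_fps"
proof (rule fps_ext)
  fix n
  show "fps_nth (rank_fps 0) n = fps_nth partition_fps n"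
  proof (cases "n = 0")
    case True
    then show ?thesis by (simp add: rank_fps_nth rank_count_def partition_fps_def partitions_0)
  next
    case False
    have "card (partitions n) = (\<Sum>k\<in>{- int n..int n}. card {P \<in> partitions n. partition_rank P = k})"
    proof (rule card_fibers)
      fix P assume P: "P \<in> partitions n"
      show "partition_rank P \<in> {- int n..int n}"
        using partition_Max_size[OF P False] by (simp add: partition_rank_def)
    qed (simp_all add: finite_partitions)
    then show ?thesis using False by (simp add: rank_fps_nth rank_count_def partition_fps_def)
  qed
qed

lemma rank_le_count_diff: "rank_le_count m n = rank_le_count (m - 1) n + real_of_int (rank_count m n)"
proof (cases "n = 0")
  case False
  have eq: "{P \<in> partitions n. partition_rank P \<le> m} =
      {P \<in> partitions n. partition_rank P \<le> m - 1} \<union> {P \<in> partitions n. partition_rank P = m}" by auto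
  have "card {P \<in> partitions n. partition_rank P \<le> m} =
      card {P \<in> partitions n. partition_rank P \<le> m - 1} + card {P \<in> partitions n. partition_rank P = m}"
    unfolding eq by (rule card_Un_disjoint) (auto simp: finite_partitions)
  then show ?thesis using False by (simp add: rank_le_count_def rank_count_def)
qed (simp add: rank_le_count_def rank_count_def)

definition crank_cube :: "real fps fps" where
  "crank_cube = qdiag (inverse partition_fps) ^ 2 * crank_series ^ 3"

section \<open>Rank moments\<close>

lemma crank_cube:
  shows balanced_crank_cube: "balanced crank_cube"
    and zmoment_0_crank_cube: "zmoment 0 crank_cube = partition_fps"
    and zderiv_crank_cube: "zderiv crank_cube = crank_cube * zlog + crank_cube * zlog + crank_cube * zlog"
    and crank_cube_rank: "crank_cube = fps_const (1 - fps_X) ^ 3 * Abs_fps (\<lambda>n. Abs_fps (\<lambda>i.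
      (3 * real n + (real i - real n + 1) * (real i - real n + 2) / 2) * rank_le_count (int i - int n
          + 1) n))"
proof -
  have "fps_nth partition_fps 0 \<noteq> 0" by (simp add: partition_fps_0)
  note pde = rank_crank_pde[OF swap2_crank_cum crank_series_cum zsym_crank_series this crank_mass
    fps_XD_partition rank_le_count_dyson rank_le_count_eq_0 crank_cube_def]
  show "balanced crank_cube" by (rule pde(1))
  show "zmoment 0 crank_cube = partition_fps" by (rule pde(2))
  show "zderiv crank_cube = crank_cube * zlog + crank_cube * zlog + crank_cube * zlog" by (rule pde(3))
  show "crank_cube = fps_const (1 - fps_X) ^ 3 * Abs_fps (\<lambda>n. Abs_fps (\<lambda>i.
      (3 * real n + (real i - real n + 1) * (real i - real n + 2) / 2) * rank_le_count (int i - int n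
          + 1) n))"
    by (rule pde(4))
qed

lemma coeff2_int_diff:
  assumes "\<And>i. coeff2 A n i = u (int i)" "\<And>i. i < 0 \<Longrightarrow> u i = 0"
  shows "coeff2 (fps_const (1 - fps_X) * A) n i = u (int i) - u (int i - 1)"
  unfolding coeff2_one_minus_x_mult assms(1) using assms(2)[of "- 1"]
  by (cases i) auto

text \<open>Multiplication by \<open>(1 - z)^3\<close> is a third difference of \<open>c\<close>
  times the accumulated rank count. Written with single counts, the leftover term in
  \<open>rank_le_count (k - 2)\<close> has the third difference of the quadratic \<open>c\<close> as
  its factor, which is 0.\<close>

lemma coeff2_crank_cube:
  fixes n i :: nat
  defines "k \<equiv> int i - int n"
  defines "r \<equiv> \<lambda>m. real_of_int (rank_count m n)"
  defines "c \<equiv> \<lambda>m. 3 * real n + real_of_int m * (real_of_int m + 1) / 2"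
  shows "coeff2 crank_cube n i = c (k + 1) * r (k + 1) + (c (k - 2) - 3 * c (k - 1)) * r k + c (k
      - 2) * r (k - 1)"
proof -
  define u where "u i = c (i - int n + 1) * rank_le_count (i - int n + 1) n" for i
  define Y where "Y = Abs_fps (\<lambda>n. Abs_fps (\<lambda>i.
      (3 * real n + (real i - real n + 1) * (real i - real n + 2) / 2) * rank_le_count (int i - int n
          + 1) n))"
  have u: "coeff2 Y n i = u (int i)" for i
    by (simp add: Y_def u_def c_def algebra_simps)
  have u0: "u i = 0" if "i < 0" for i
  proof (cases "i - int n + 1 < 0")
    case True
    then show ?thesis using that by (simp add: u_def rank_le_count_eq_0)
  next
    case False
    \<comment> \<open>Here \<open>rank_le_count 0 0 = 1\<close>, but its factor \<open>c 0\<close>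
      is 0.\<close>
    then have "n = 0" "i = - 1" using that by auto
    then show ?thesis by (simp add: u_def c_def)
  qed
  let ?d = "\<lambda>A. fps_const (1 - fps_X) * A"
  have "crank_cube = ?d (?d (?d Y))"
    unfolding crank_cube_rank Y_def by (simp only: power3_eq_cube mult.assoc)
  moreover have d1: "coeff2 (?d Y) n i = u (int i) - u (int i - 1)" for i
    by (rule coeff2_int_diff[OF u u0])
  moreover have d2: "coeff2 (?d (?d Y)) n i = (u (int i) - u (int i - 1)) - (u (int i - 1) - u (int i
      - 1 - 1))" for i
    by (rule coeff2_int_diff[where u = "\<lambda>i. u i - u (i - 1)", OF d1]) (simp add: u0)
  moreover have "coeff2 (?d (?d (?d Y))) n i = ((u (int i) - u (int i - 1)) - (u (int i - 1) - u (int i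
      - 1 - 1)))
      - ((u (int i - 1) - u (int i - 1 - 1)) - (u (int i - 1 - 1) - u (int i - 1 - 1 - 1)))"
    by (rule coeff2_int_diff[where u = "\<lambda>i. (u i - u (i - 1)) - (u (i - 1) - u (i - 1
        - 1))", OF d2]) (simp add: u0)
  ultimately have "coeff2 crank_cube n i = u (int i) - 3 * u (int i - 1) + 3 * u (int i - 2) - u (int i - 3)"
    by (simp add: algebra_simps)
  also have "u (int i) = c (k + 1) * rank_le_count (k + 1) n" by (simp add: u_def k_def)
  also have "u (int i - 1) = c k * rank_le_count k n" by (simp add: u_def k_def)
  also have "u (int i - 2) = c (k - 1) * rank_le_count (k - 1) n" by (simp add: u_def k_def)
  also have "u (int i - 3) = c (k - 2) * rank_le_count (k - 2) n" by (simp add: u_def k_def)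
  also have "rank_le_count (k + 1) n = rank_le_count (k - 2) n + r (k - 1) + r k + r (k + 1)"
    using rank_le_count_diff[of "k + 1" n] rank_le_count_diff[of k n] rank_le_count_diff[of "k
        - 1" n] by (simp add: r_def)
  also have "rank_le_count k n = rank_le_count (k - 2) n + r (k - 1) + r k"
    using rank_le_count_diff[of k n] rank_le_count_diff[of "k - 1" n] by (simp add: r_def)
  also have "rank_le_count (k - 1) n = rank_le_count (k - 2) n + r (k - 1)"
    using rank_le_count_diff[of "k - 1" n] by (simp add: r_def)
  finally show ?thesis by (simp add: c_def field_simps)
qed

text \<open>Shifting the summation index by one in the outer terms collects everything at a single
  rank \<open>k\<close>. The moment of the cube is thereby a sum of rank counts with polynomial
  weight, that is, a combination of rank moments.\<close>

lemma cube_moment: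
  "fps_nth (zmoment a crank_cube) n = (\<Sum>k\<in>{- int n..int n}.
    ((real_of_int k - 1) ^ a * (3 * real n + real_of_int k * (real_of_int k + 1) / 2)
     + (real_of_int k + 1) ^ a * (3 * real n + real_of_int k * (real_of_int k - 1) / 2)
     + real_of_int k ^ a * (1 - 6 * real n - real_of_int k ^ 2)) * real_of_int (rank_count k n))"
proof -
  define r where "r m = real_of_int (rank_count m n)" for m
  define c where "c m = 3 * real n + real_of_int m * (real_of_int m + 1) / 2" for m :: int
  let ?I = "{- int n..int n}"
  have "fps_nth (zmoment a crank_cube) n = (\<Sum>i\<le>2*n. real_of_int (int i
      - int n) ^ a * coeff2 crank_cube n i)"
    by (simp add: zmoment_def)
  also have "\<dots> = (\<Sum>k\<in>?I. real_of_int k ^ a * (c (k + 1) * r (k + 1) + (c (k - 2)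
      - 3 * c (k - 1)) * r k + c (k - 2) * r (k - 1)))"
    unfolding coeff2_crank_cube c_def r_def by (rule sum_centered[of "\<lambda>k. real_of_int k ^ a * (
      (3 * real n + real_of_int (k + 1) * (real_of_int (k + 1) + 1) / 2) * real_of_int (rank_count (k + 1) n)
      + (3 * real n + real_of_int (k - 2) * (real_of_int (k - 2) + 1) / 2
        - 3 * (3 * real n + real_of_int (k - 1) * (real_of_int (k - 1)
            + 1) / 2)) * real_of_int (rank_count k n)
      + (3 * real n + real_of_int (k - 2) * (real_of_int (k - 2) + 1) / 2) * real_of_int (rank_count (k
          - 1) n))" n])
  also have "\<dots> = (\<Sum>k\<in>?I. real_of_int k ^ a * (c (k + 1) * r (k + 1)))
      + (\<Sum>k\<in>?I. real_of_int k ^ a * ((c (k - 2) - 3 * c (k - 1)) * r k))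
      + (\<Sum>k\<in>?I. real_of_int k ^ a * (c (k - 2) * r (k - 1)))"
    by (simp only: distrib_left sum.distrib)
  also have "(\<Sum>k\<in>?I. real_of_int k ^ a * (c (k + 1) * r (k + 1))) =
      (\<Sum>k\<in>{- int n + 1..int n + 1}. (real_of_int k - 1) ^ a * (c k * r k))"
    by (rule sum.reindex_bij_witness[where i = "\<lambda>k. k - 1" and j = "\<lambda>k. k + 1"]) auto
  also have "\<dots> = (\<Sum>k\<in>{- int n..int n + 1}. (real_of_int k - 1) ^ a * (c k * r k))"
  proof (rule sum.mono_neutral_left)
    \<comment> \<open>For \<open>n > 0\<close> no partition of \<open>n\<close> has rank
      \<open>- n\<close>; for \<open>n = 0\<close> the count is 1 but
      \<open>c 0 = 0\<close>.\<close>
    have z: "c k * r k = 0" if "k = - int n" for k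
      using that rank_count_eq_0[of n k] by (cases "n = 0") (simp_all add: c_def r_def)
    show "\<forall>k\<in>{- int n..int n + 1} - {- int n + 1..int n + 1}. (real_of_int k
        - 1) ^ a * (c k * r k) = 0"
    proof
      fix k assume "k \<in> {- int n..int n + 1} - {- int n + 1..int n + 1}"
      then have "k = - int n" by auto
      then have "c k * r k = 0" by (rule z)
      then show "(real_of_int k - 1) ^ a * (c k * r k) = 0" by (simp only: mult_zero_right)
    qed
  qed auto
  also have "\<dots> = (\<Sum>k\<in>?I. (real_of_int k - 1) ^ a * (c k * r k))"
    by (rule sum.mono_neutral_right) (auto simp: r_def intro!: rank_count_eq_0)
  also have "(\<Sum>k\<in>?I. real_of_int k ^ a * (c (k - 2) * r (k - 1))) =
      (\<Sum>k\<in>{- int n - 1..int n - 1}. (real_of_int k + 1) ^ a * (c (k - 1) * r k))"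
    by (rule sum.reindex_bij_witness[where i = "\<lambda>k. k + 1" and j = "\<lambda>k. k - 1"]) auto
  also have "\<dots> = (\<Sum>k\<in>{- int n - 1..int n}. (real_of_int k + 1) ^ a * (c (k - 1) * r k))"
  proof (rule sum.mono_neutral_left)
    have z: "c (k - 1) * r k = 0" if "k = int n" for k
      using that rank_count_eq_0[of n k] by (cases "n = 0") (simp_all add: c_def r_def)
    show "\<forall>k\<in>{- int n - 1..int n} - {- int n - 1..int n - 1}. (real_of_int k
        + 1) ^ a * (c (k - 1) * r k) = 0"
    proof
      fix k assume "k \<in> {- int n - 1..int n} - {- int n - 1..int n - 1}"
      then have "k = int n" by auto
      then have "c (k - 1) * r k = 0" by (rule z)
      then show "(real_of_int k + 1) ^ a * (c (k - 1) * r k) = 0" by (simp only: mult_zero_right)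
    qed
  qed auto
  also have "\<dots> = (\<Sum>k\<in>?I. (real_of_int k + 1) ^ a * (c (k - 1) * r k))"
    by (rule sum.mono_neutral_right) (auto simp: r_def intro!: rank_count_eq_0)
  also have "(\<Sum>k\<in>?I. (real_of_int k - 1) ^ a * (c k * r k))
      + (\<Sum>k\<in>?I. real_of_int k ^ a * ((c (k - 2) - 3 * c (k - 1)) * r k))
      + (\<Sum>k\<in>?I. (real_of_int k + 1) ^ a * (c (k - 1) * r k)) =
    (\<Sum>k\<in>?I. ((real_of_int k - 1) ^ a * c k + (real_of_int k + 1) ^ a * c (k - 1)
      + real_of_int k ^ a * (c (k - 2) - 3 * c (k - 1))) * r k)"
    unfolding sum.distrib[symmetric] by (rule sum.cong) (simp_all add: algebra_simps)
  also have "\<dots> = (\<Sum>k\<in>?I. ((real_of_int k - 1) ^ a * (3 * real n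
      + real_of_int k * (real_of_int k + 1) / 2)
     + (real_of_int k + 1) ^ a * (3 * real n + real_of_int k * (real_of_int k - 1) / 2)
     + real_of_int k ^ a * (1 - 6 * real n - real_of_int k ^ 2)) * r k)"
  proof (rule sum.cong)
    fix k :: int
    have "c (k - 2) - 3 * c (k - 1) = 1 - 6 * real n - real_of_int k ^ 2"
      by (simp add: c_def field_simps power2_eq_square)
    moreover have "c (k - 1) = 3 * real n + real_of_int k * (real_of_int k - 1) / 2"
      by (simp add: c_def field_simps)
    moreover have "c k = 3 * real n + real_of_int k * (real_of_int k + 1) / 2" by (simp add: c_def)
    ultimately show "((real_of_int k - 1) ^ a * c k + (real_of_int k + 1) ^ a * c (k - 1)
      + real_of_int k ^ a * (c (k - 2) - 3 * c (k - 1))) * r k =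
      ((real_of_int k - 1) ^ a * (3 * real n + real_of_int k * (real_of_int k + 1) / 2)
     + (real_of_int k + 1) ^ a * (3 * real n + real_of_int k * (real_of_int k - 1) / 2)
     + real_of_int k ^ a * (1 - 6 * real n - real_of_int k ^ 2)) * r k"
      by (simp only:)
  qed simp
  finally show ?thesis by (simp add: r_def)
qed

text \<open>\<open>s = 1\<close> gives the crank moments, \<open>s
    = 3\<close> those of the cube of the crank series.\<close>

lemma moment_recurrence:
  fixes f S z :: "nat \<Rightarrow> real fps" and s :: "real fps"
  assumes rec: "\<And>a. f (Suc a) = s * (\<Sum>b\<le>a. of_nat (a choose b) * f b * z (a - b))"
    and z: "\<And>i. z i = (if odd i then 2 * S i else 0)"
  shows "f 2 = 2 * s * (S 1 * f 0)"
    and "f 4 = 2 * s * (S 3 * f 0 + 3 * S 1 * f 2)"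
    and "f 6 = 2 * s * (S 5 * f 0 + 10 * S 3 * f 2 + 5 * S 1 * f 4)"
    and "f 8 = 2 * s * (S 7 * f 0 + 21 * S 5 * f 2 + 35 * S 3 * f 4 + 7 * S 1 * f 6)"
    and "f 10 = 2 * s * (S 9 * f 0 + 36 * S 7 * f 2 + 126 * S 5 * f 4 + 84 * S 3 * f 6 + 9 * S 1 * f 8)"
    and "f 12 = 2 * s * (S 11 * f 0 + 55 * S 9 * f 2 + 330 * S 7 * f 4 + 462 * S 5 * f 6 + 165 * S 3 * f 8
      + 11 * S 1 * f 10)"
proof -
  \<comment> \<open>For odd order each product pairs an odd moment of \<open>f\<close>, 0 by
    induction, or an even moment of \<open>z\<close>, 0 by assumption.\<close>
  have o: "odd a \<Longrightarrow> f a = 0" for a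
  proof (induction a rule: less_induct)
    case (less a)
    then obtain k where a: "a = Suc k" "even k" by (cases a) auto
    have "f b * z (k - b) = 0" if "b \<le> k" for b
      using less.IH[of b] a that by (cases "odd b") (auto simp: z)
    then have "(\<Sum>b\<le>k. of_nat (k choose b) * f b * z (k - b)) = 0"
      by (intro sum.neutral ballI) (simp add: mult.assoc)
    then show ?case unfolding a rec by simp
  qed
  have "f (Suc 1) = 2 * s * (S 1 * f 0)"
    unfolding rec[of 1] using o[of 1] by (simp add: z)
  then show "f 2 = 2 * s * (S 1 * f 0)" by (simp add: numeral_2_eq_2)
  have "(\<Sum>b\<le>3. g b) = g 0 + g 1 + g 2 + g 3" for g :: "nat \<Rightarrow> real fps"
    by (simp add: numeral_eq_Suc)
  note r = rec[of 3, unfolded this]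
  have c: "(3::nat) choose 2 = 3"
    by (simp_all add: numeral_eq_Suc)
  have "f 1 = 0" "f 3 = 0" by (rule o, simp)+
  then show "f 4 = 2 * s * (S 3 * f 0 + 3 * S 1 * f 2)"
    using r by (simp add: z c algebra_simps)
  have "(\<Sum>b\<le>5. g b) = g 0 + g 1 + g 2 + g 3 + g 4 + g 5" for g :: "nat \<Rightarrow> real fps"
    by (simp add: numeral_eq_Suc)
  note r = rec[of 5, unfolded this]
  have c: "(5::nat) choose 2 = 10" "(5::nat) choose 4 = 5"
    by (simp_all add: numeral_eq_Suc)
  have "f 1 = 0" "f 3 = 0" "f 5 = 0" by (rule o, simp)+
  then show "f 6 = 2 * s * (S 5 * f 0 + 10 * S 3 * f 2 + 5 * S 1 * f 4)"
    using r by (simp add: z c algebra_simps)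
  have "(\<Sum>b\<le>7. g b) = g 0 + g 1 + g 2 + g 3 + g 4 + g 5 + g 6
      + g 7" for g :: "nat \<Rightarrow> real fps"
    by (simp add: numeral_eq_Suc)
  note r = rec[of 7, unfolded this]
  have c: "(7::nat) choose 2 = 21" "(7::nat) choose 4 = 35" "(7::nat) choose 6 = 7"
    by (simp_all add: numeral_eq_Suc)
  have "f 1 = 0" "f 3 = 0" "f 5 = 0" "f 7 = 0" by (rule o, simp)+
  then show "f 8 = 2 * s * (S 7 * f 0 + 21 * S 5 * f 2 + 35 * S 3 * f 4 + 7 * S 1 * f 6)"
    using r by (simp add: z c algebra_simps)
  have "(\<Sum>b\<le>9. g b) = g 0 + g 1 + g 2 + g 3 + g 4 + g 5 + g 6 + g 7 + g 8
      + g 9" for g :: "nat \<Rightarrow> real fps"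
    by (simp add: numeral_eq_Suc)
  note r = rec[of 9, unfolded this]
  have c: "(9::nat) choose 2 = 36" "(9::nat) choose 4 = 126" "(9::nat) choose 6 = 84" "(9::nat) choose 8 = 9"
    by (simp_all add: numeral_eq_Suc)
  have "f 1 = 0" "f 3 = 0" "f 5 = 0" "f 7 = 0" "f 9 = 0" by (rule o, simp)+
  then show "f 10 = 2 * s * (S 9 * f 0 + 36 * S 7 * f 2 + 126 * S 5 * f 4 + 84 * S 3 * f 6 + 9 * S 1 * f 8)"
    using r by (simp add: z c algebra_simps)
  have "(\<Sum>b\<le>11. g b) = g 0 + g 1 + g 2 + g 3 + g 4 + g 5 + g 6 + g 7 + g 8 + g 9 + g 10
      + g 11" for g :: "nat \<Rightarrow> real fps"
    by (simp add: numeral_eq_Suc)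
  note r = rec[of 11, unfolded this]
  have c: "(11::nat) choose 2 = 55" "(11::nat) choose 4 = 330" "(11::nat) choose 6
      = 462" "(11::nat) choose 8 = 165" "(11::nat) choose 10 = 11"
    by (simp_all add: numeral_eq_Suc)
  have "f 1 = 0" "f 3 = 0" "f 5 = 0" "f 7 = 0" "f 9 = 0" "f 11 = 0" by (rule o, simp)+
  then show "f 12 = 2 * s * (S 11 * f 0 + 55 * S 9 * f 2 + 330 * S 7 * f 4 + 462 * S 5 * f 6 + 165 * S 3 * f 8
      + 11 * S 1 * f 10)"
    using r by (simp add: z c algebra_simps)
qed

text \<open>For even \<open>a\<close> the powers \<open>x^(a+2)\<close> and \<open>y x^a\<close>
  cancel, and \<open>x^a\<close> keeps the factor \<open>(a - 1)(a - 2) / 2\<close>: here 3, below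
  10, 21, 36, 55. As it is not 0, each of these rank moments can be solved for in terms of lower
  ones.\<close>

lemma rank_poly_4:
  "((x - 1) ^ 4 * (3 * y + x * (x + 1) / 2) + (x + 1) ^ 4 * (3 * y + x * (x - 1) / 2)
    + x ^ 4 * (1 - 6 * y - x ^ 2)) * r =
   (3) * (x ^ 4 * r) + (-3 + 36 * y) * (x ^ 2 * r) + (6 * y) * (x ^ 0 * r)" for x y r :: real
  by (simp add: field_simps eval_nat_numeral)

lemma cube_moment_4:
  "fps_nth (zmoment 4 crank_cube) n =
    (3) * fps_nth (rank_fps 4) n + (-3 + 36 * real n) * fps_nth (rank_fps 2) n
        + (6 * real n) * fps_nth (rank_fps 0) n"
  by (simp only: cube_moment rank_poly_4 sum.distrib sum_distrib_left[symmetric] rank_fps_nth)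

lemma rank_poly_6:
  "((x - 1) ^ 6 * (3 * y + x * (x + 1) / 2) + (x + 1) ^ 6 * (3 * y + x * (x - 1) / 2)
    + x ^ 6 * (1 - 6 * y - x ^ 2)) * r =
   (10) * (x ^ 6 * r) + (-5 + 90 * y) * (x ^ 4 * r) + (-5 + 90 * y) * (x ^ 2 * r)
       + (6 * y) * (x ^ 0 * r)" for x y r :: real
  by (simp add: field_simps eval_nat_numeral)

lemma cube_moment_6:
  "fps_nth (zmoment 6 crank_cube) n =
    (10) * fps_nth (rank_fps 6) n + (-5 + 90 * real n) * fps_nth (rank_fps 4) n + (-5
        + 90 * real n) * fps_nth (rank_fps 2) n + (6 * real n) * fps_nth (rank_fps 0) n"
  by (simp only: cube_moment rank_poly_6 sum.distrib sum_distrib_left[symmetric] rank_fps_nth)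

lemma rank_poly_8:
  "((x - 1) ^ 8 * (3 * y + x * (x + 1) / 2) + (x + 1) ^ 8 * (3 * y + x * (x - 1) / 2)
    + x ^ 8 * (1 - 6 * y - x ^ 2)) * r =
   (21) * (x ^ 8 * r) + (14 + 168 * y) * (x ^ 6 * r) + (-28 + 420 * y) * (x ^ 4 * r) + (-7
       + 168 * y) * (x ^ 2 * r) + (6 * y) * (x ^ 0 * r)" for x y r :: real
  by (simp add: field_simps eval_nat_numeral)

lemma cube_moment_8:
  "fps_nth (zmoment 8 crank_cube) n =
    (21) * fps_nth (rank_fps 8) n + (14 + 168 * real n) * fps_nth (rank_fps 6) n + (-28
        + 420 * real n) * fps_nth (rank_fps 4) n + (-7 + 168 * real n) * fps_nth (rank_fps 2) n
        + (6 * real n) * fps_nth (rank_fps 0) n"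
  by (simp only: cube_moment rank_poly_8 sum.distrib sum_distrib_left[symmetric] rank_fps_nth)

lemma rank_poly_10:
  "((x - 1) ^ 10 * (3 * y + x * (x + 1) / 2) + (x + 1) ^ 10 * (3 * y + x * (x - 1) / 2)
    + x ^ 10 * (1 - 6 * y - x ^ 2)) * r =
   (36) * (x ^ 10 * r) + (90 + 270 * y) * (x ^ 8 * r) + (-42 + 1260 * y) * (x ^ 6 * r) + (-75
       + 1260 * y) * (x ^ 4 * r) + (-9 + 270 * y) * (x ^ 2 * r) + (6 * y) * (x ^ 0 * r)" for x y r :: real
  by (simp add: field_simps eval_nat_numeral)

lemma cube_moment_10:
  "fps_nth (zmoment 10 crank_cube) n =
    (36) * fps_nth (rank_fps 10) n + (90 + 270 * real n) * fps_nth (rank_fps 8) n + (-42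
        + 1260 * real n) * fps_nth (rank_fps 6) n + (-75 + 1260 * real n) * fps_nth (rank_fps 4) n
        + (-9 + 270 * real n) * fps_nth (rank_fps 2) n + (6 * real n) * fps_nth (rank_fps 0) n"
  by (simp only: cube_moment rank_poly_10 sum.distrib sum_distrib_left[symmetric] rank_fps_nth)

lemma rank_poly_12:
  "((x - 1) ^ 12 * (3 * y + x * (x + 1) / 2) + (x + 1) ^ 12 * (3 * y + x * (x - 1) / 2)
    + x ^ 12 * (1 - 6 * y - x ^ 2)) * r =
   (55) * (x ^ 12 * r) + (275 + 396 * y) * (x ^ 10 * r) + (132 + 2970 * y) * (x ^ 8 * r) + (-297
       + 5544 * y) * (x ^ 6 * r) + (-154 + 2970 * y) * (x ^ 4 * r) + (-11 + 396 * y) * (x ^ 2 * r)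
       + (6 * y) * (x ^ 0 * r)" for x y r :: real
  by (simp add: field_simps eval_nat_numeral)

lemma cube_moment_12:
  "fps_nth (zmoment 12 crank_cube) n =
    (55) * fps_nth (rank_fps 12) n + (275 + 396 * real n) * fps_nth (rank_fps 10) n + (132
        + 2970 * real n) * fps_nth (rank_fps 8) n + (-297 + 5544 * real n) * fps_nth (rank_fps 6) n
        + (-154 + 2970 * real n) * fps_nth (rank_fps 4) n + (-11
        + 396 * real n) * fps_nth (rank_fps 2) n + (6 * real n) * fps_nth (rank_fps 0) n"
  by (simp only: cube_moment rank_poly_12 sum.distrib sum_distrib_left[symmetric] rank_fps_nth)

section \<open>Convolutions of divisor sums\<close>

text \<open>Choosing divisors \<open>a\<close> of \<open>m\<close> and \<open>b\<close> of
  \<open>n - m\<close> fixes the cofactors \<open>x\<close>, \<open>y\<close>; convolutions of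
  divisor sums are thus sums over these quadruples, in which cofactors can be traded against
  divisors.\<close>

definition quads :: "nat \<Rightarrow> (nat \<times> nat \<times> nat \<times> nat) set" where
  "quads n = {(a, b, x, y). a \<ge> 1 \<and> b \<ge> 1 \<and> x \<ge> 1 \<and> y \<ge> 1 \<and> a * x + b * y = n}"

lemma finite_quads: "finite (quads n)"
proof (rule finite_subset)
  show "quads n \<subseteq> {..n} \<times> {..n} \<times> {..n} \<times> {..n}"
  proof
    fix q assume "q \<in> quads n"
    then obtain a b x y where q: "q = (a, b, x, y)" "a \<ge> 1" "b \<ge> 1" "x \<ge> 1" "y \<ge> 1" "a * x + b * y = n"
      by (auto simp: quads_def)
    have "a \<le> a * x" "x \<le> a * x" "b \<le> b * y" "y \<le> b * y" using q by auto
    then have "a \<le> n" "b \<le> n" "x \<le> n" "y \<le> n" using q(6) by linarith+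
    then show "q \<in> {..n} \<times> {..n} \<times> {..n} \<times> {..n}" by (simp add: q(1))
  qed
qed auto

definition divs :: "nat \<Rightarrow> nat set" where
  "divs n = {d. d \<in> {1..n} \<and> d dvd n}"

lemma finite_divs: "finite (divs n)" by (simp add: divs_def)

text \<open>A quadruple \<open>(a, b, x, y)\<close> with \<open>x > y\<close> corresponds to \<open>(a, a + b, x - y, y)\<close>
  (Skoruppa's method for convolutions of divisor sums).\<close>

lemma sum_quads_shift:
  fixes f :: "real \<Rightarrow> real \<Rightarrow> real"
  shows "(\<Sum>(a, b, x, y)\<in>{(a, b, x, y) \<in> quads n. x > y}. f (real a) (real b)) =
    (\<Sum>(a, b, x, y)\<in>{(a, b, x, y) \<in> quads n. b > a}. f (real a) (real b - real a))"
proof (rule sum.reindex_bij_witness[where j = "\<lambda>(a, b, x, y). (a, a + b, x - y, y)"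
      and i = "\<lambda>(a, b, x, y). (a, b - a, x + y, y)"])
  fix q assume "q \<in> {(a, b, x, y) \<in> quads n. x > y}"
  then obtain a b x y where q: "q = (a, b, x, y)" "(a, b, x, y) \<in> quads n" "x > y" by auto
  then obtain u where u: "x = y + u" "u > 0" using less_imp_add_positive by blast
  show "(case case q of (a, b, x, y) \<Rightarrow> (a, a + b, x
      - y, y) of (a, b, x, y) \<Rightarrow> (a, b - a, x + y, y)) = q"
    "(case q of (a, b, x, y) \<Rightarrow> (a, a + b, x - y, y)) \<in> {(a, b, x, y) \<in> quads n. b > a}"
    "(case case q of (a, b, x, y) \<Rightarrow> (a, a + b, x
        - y, y) of (a, b, x, y) \<Rightarrow> f (real a) (real b - real a)) =
       (case q of (a, b, x, y) \<Rightarrow> f (real a) (real b))"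
    using q u by (auto simp: quads_def algebra_simps)
next
  fix q assume "q \<in> {(a, b, x, y) \<in> quads n. b > a}"
  then obtain a b x y where q: "q = (a, b, x, y)" "(a, b, x, y) \<in> quads n" "b > a" by auto
  then obtain u where u: "b = a + u" "u > 0" using less_imp_add_positive by blast
  show "(case case q of (a, b, x, y) \<Rightarrow> (a, b - a, x
      + y, y) of (a, b, x, y) \<Rightarrow> (a, a + b, x - y, y)) = q"
    "(case q of (a, b, x, y) \<Rightarrow> (a, b - a, x + y, y)) \<in> {(a, b, x, y) \<in> quads n. x > y}"
    using q u by (auto simp: quads_def algebra_simps)
qed

lemma sum_quads_swap:
  fixes f :: "nat \<Rightarrow> nat \<Rightarrow> nat \<Rightarrow> nat \<Rightarrow> real"
  shows "(\<Sum>(a, b, x, y)\<in>{(a, b, x, y) \<in> quads n. P a b x y}. f a b x y) =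
    (\<Sum>(a, b, x, y)\<in>{(a, b, x, y) \<in> quads n. P b a y x}. f b a y x)"
  by (rule sum.reindex_bij_witness[where j = "\<lambda>(a, b, x, y). (b, a, y, x)"
      and i = "\<lambda>(a, b, x, y). (b, a, y, x)"]) (auto simp: quads_def add.commute)

lemma sum_quads_split:
  fixes g :: "nat \<Rightarrow> nat \<Rightarrow> nat \<Rightarrow> nat \<Rightarrow> real" and u v :: "nat \<Rightarrow> nat \<Rightarrow> nat \<Rightarrow> nat \<Rightarrow> nat"
  shows "(\<Sum>(a, b, x, y)\<in>quads n. g a b x y) =
    (\<Sum>(a, b, x, y)\<in>{(a, b, x, y) \<in> quads n. u a b x y > v a b x y}. g a b x y)
    + (\<Sum>(a, b, x, y)\<in>{(a, b, x, y) \<in> quads n. v a b x y > u a b x y}. g a b x y)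
    + (\<Sum>(a, b, x, y)\<in>{(a, b, x, y) \<in> quads n. u a b x y = v a b x y}. g a b x y)"
proof -
  let ?S1 = "{(a, b, x, y) \<in> quads n. u a b x y > v a b x y}"
  let ?S2 = "{(a, b, x, y) \<in> quads n. v a b x y > u a b x y}"
  let ?S3 = "{(a, b, x, y) \<in> quads n. u a b x y = v a b x y}"
  let ?g = "\<lambda>(a, b, x, y). g a b x y"
  have fin: "finite ?S1" "finite ?S2" "finite ?S3"
    by (auto intro: finite_subset[OF _ finite_quads[of n]])
  have "quads n = (?S1 \<union> ?S2) \<union> ?S3" by (auto simp: not_less_iff_gr_or_eq)
  then have "sum ?g (quads n) = sum ?g ((?S1 \<union> ?S2) \<union> ?S3)" by (rule arg_cong)
  also have "\<dots> = sum ?g (?S1 \<union> ?S2) + sum ?g ?S3"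
    by (rule sum.union_disjoint) (use fin in auto)
  also have "sum ?g (?S1 \<union> ?S2) = sum ?g ?S1 + sum ?g ?S2"
    by (rule sum.union_disjoint) (use fin in auto)
  finally show ?thesis .
qed

lemma sum_quads_equal_xy:
  fixes f :: "real \<Rightarrow> real \<Rightarrow> real"
  shows "(\<Sum>(a, b, x, y)\<in>{(a, b, x, y) \<in> quads n. x = y}. f (real a) (real b)) =
    (\<Sum>d\<in>divs n. \<Sum>a\<in>{1..<d}. f (real a) (real d - real a))"
proof -
  have "(\<Sum>(a, b, x, y)\<in>{(a, b, x, y) \<in> quads n. x = y}. f (real a) (real b)) =
      (\<Sum>(d, a)\<in>(SIGMA d:divs n. {1..<d}). f (real a) (real d - real a))"
  proof (rule sum.reindex_bij_witness[where j = "\<lambda>(a, b, x, y). (a + b, a)"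
        and i = "\<lambda>(d, a). (a, d - a, n div d, n div d)"])
    fix q assume "q \<in> {(a, b, x, y) \<in> quads n. x = y}"
    then obtain a b x where q: "q = (a, b, x, x)" "a \<ge> 1" "b \<ge> 1" "x \<ge> 1" "(a + b) * x = n"
      by (auto simp: quads_def algebra_simps)
    have "n div (a + b) = x" using q by (auto simp flip: q(5))
    moreover have "a + b \<le> n" using q by (metis le_add1 mult_le_mono2 nat_mult_1_right)
    ultimately show "(case case q of (a, b, x, y) \<Rightarrow> (a
        + b, a) of (d, a) \<Rightarrow> (a, d - a, n div d, n div d)) = q"
      "(case q of (a, b, x, y) \<Rightarrow> (a + b, a)) \<in> (SIGMA d:divs n. {1..<d})"
      "(case case q of (a, b, x, y) \<Rightarrow> (a + b, a) of (d, a) \<Rightarrow> f (real a) (real d - real a)) =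
         (case q of (a, b, x, y) \<Rightarrow> f (real a) (real b))"
      using q by (auto simp: divs_def) (metis dvd_triv_left)
  next
    fix p assume "p \<in> (SIGMA d:divs n. {1..<d})"
    then obtain d a k where p: "p = (d, a)" "1 \<le> a" "a < d" "n = d * k" "d \<le> n" "d \<ge> 1"
      by (auto simp: divs_def elim!: dvdE)
    then have k: "n div d = k" "k \<ge> 1" by (auto simp: Suc_le_eq intro!: Nat.gr0I)
    have "a * k + (d - a) * k = n" using p by (simp flip: add_mult_distrib)
    then show "(case case p of (d, a) \<Rightarrow> (a, d
        - a, n div d, n div d) of (a, b, x, y) \<Rightarrow> (a + b, a)) = p"
      "(case p of (d, a) \<Rightarrow> (a, d - a, n div d, n div d)) \<in> {(a, b, x, y) \<in> quads n. x = y}"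
      using p k by (auto simp: quads_def)
  qed
  then show ?thesis by (simp add: sum.Sigma finite_divs)
qed

lemma sum_quads_equal_ab:
  fixes f :: "real \<Rightarrow> real"
  shows "(\<Sum>(a, b, x, y)\<in>{(a, b, x, y) \<in> quads n. a = b}. f (real a)) =
    (\<Sum>d\<in>divs n. (real n / real d - 1) * f (real d))"
proof -
  have "(\<Sum>(a, b, x, y)\<in>{(a, b, x, y) \<in> quads n. a = b}. f (real a)) =
      (\<Sum>(d, x)\<in>(SIGMA d:divs n. {1..<n div d}). f (real d))"
  proof (rule sum.reindex_bij_witness[where j = "\<lambda>(a, b, x, y). (a, x)"
        and i = "\<lambda>(d, x). (d, d, x, n div d - x)"])
    fix q assume "q \<in> {(a, b, x, y) \<in> quads n. a = b}"
    then obtain a x y where q: "q = (a, a, x, y)" "a \<ge> 1" "x \<ge> 1" "y \<ge> 1" "a * (x + y) = n"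
      by (auto simp: quads_def algebra_simps)
    have "n div a = x + y" using q by (auto simp flip: q(5))
    moreover have "a \<le> n" using q by (metis le_add1 mult_le_mono2 nat_mult_1_right le_trans)
    ultimately show "(case case q of (a, b, x, y) \<Rightarrow> (a, x) of (d, x) \<Rightarrow> (d, d, x, n div d - x)) = q"
      "(case q of (a, b, x, y) \<Rightarrow> (a, x)) \<in> (SIGMA d:divs n. {1..<n div d})"
      "(case case q of (a, b, x, y) \<Rightarrow> (a, x) of (d, x) \<Rightarrow> f (real d))
          = (case q of (a, b, x, y) \<Rightarrow> f (real a))"
      using q by (auto simp: divs_def)
  next
    fix p assume "p \<in> (SIGMA d:divs n. {1..<n div d})"
    then obtain d x k where p: "p = (d, x)" "1 \<le> x" "x < n div d" "n = d * k" "d \<le> n" "d \<ge> 1"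
      by (auto simp: divs_def elim!: dvdE)
    then have k: "n div d = k" by auto
    then have "d * x + d * (k - x) = n" using p by (simp flip: add_mult_distrib2)
    then show "(case case p of (d, x) \<Rightarrow> (d, d, x, n div d - x) of (a, b, x, y) \<Rightarrow> (a, x)) = p"
      "(case p of (d, x) \<Rightarrow> (d, d, x, n div d - x)) \<in> {(a, b, x, y) \<in> quads n. a = b}"
      using p k by (auto simp: quads_def)
  qed
  also have "\<dots> = (\<Sum>d\<in>divs n. real (n div d - 1) * f (real d))"
    by (simp add: sum.Sigma[symmetric] finite_divs)
  also have "\<dots> = (\<Sum>d\<in>divs n. (real n / real d - 1) * f (real d))"
  proof (rule sum.cong)
    fix d assume "d \<in> divs n"
    then have d: "d dvd n" "d \<ge> 1" "d \<le> n" by (auto simp: divs_def)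
    then have "n div d \<ge> 1" by (simp add: Suc_le_eq div_greater_zero_iff)
    then show "real (n div d - 1) * f (real d) = (real n / real d - 1) * f (real d)"
      using d by (simp add: of_nat_diff real_of_nat_div)
  qed simp
  finally show ?thesis .
qed

text \<open>By \<open>sym\<close> the sum of \<open>f a b\<close> is twice its part with
  \<open>x > y\<close>, by \<open>cyc\<close> that of \<open>f a (b - a)\<close> is twice its part
  with \<open>b > a\<close>, apart from the diagonals \<open>x = y\<close> and \<open>a = b\<close>.
  \<open>sum_quads_shift\<close> identifies the two halves, so only the diagonals survive.\<close>

lemma sum_quads_identity:
  fixes f :: "real \<Rightarrow> real \<Rightarrow> real"
  assumes sym: "\<And>a b. f a b = f b a" and cyc: "\<And>a b. f a (b - a) = f b (a - b)"
  shows "(\<Sum>(a, b, x, y)\<in>quads n. f (real a) (real b) - f (real a) (real b - real a)) =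
    (\<Sum>d\<in>divs n. (\<Sum>a\<in>{1..<d}. f (real a) (real d - real a)) - (real n / real d - 1) * f (real d) 0)"
proof -
  let ?F = "\<lambda>a b. f (real a) (real b)" and ?G = "\<lambda>a b. f (real a) (real b - real a)"
  have "(\<Sum>(a, b, x, y)\<in>quads n. ?F a b) =
      (\<Sum>(a, b, x, y)\<in>{(a, b, x, y) \<in> quads n. x > y}. ?F a b)
    + (\<Sum>(a, b, x, y)\<in>{(a, b, x, y) \<in> quads n. y > x}. ?F a b)
    + (\<Sum>(a, b, x, y)\<in>{(a, b, x, y) \<in> quads n. x = y}. ?F a b)"
    by (rule sum_quads_split)
  also have "(\<Sum>(a, b, x, y)\<in>{(a, b, x, y) \<in> quads n. y > x}. ?F a b) =
      (\<Sum>(a, b, x, y)\<in>{(a, b, x, y) \<in> quads n. x > y}. ?F a b)"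
    by (subst sum_quads_swap) (simp add: sym[of "real _" "real _"] sym)
  finally have 1: "(\<Sum>(a, b, x, y)\<in>quads n. ?F a b) =
      2 * (\<Sum>(a, b, x, y)\<in>{(a, b, x, y) \<in> quads n. b > a}. ?G a b)
    + (\<Sum>d\<in>divs n. \<Sum>a\<in>{1..<d}. f (real a) (real d - real a))"
    by (simp only: sum_quads_shift sum_quads_equal_xy)
  have "(\<Sum>(a, b, x, y)\<in>quads n. ?G a b) =
      (\<Sum>(a, b, x, y)\<in>{(a, b, x, y) \<in> quads n. a > b}. ?G a b)
    + (\<Sum>(a, b, x, y)\<in>{(a, b, x, y) \<in> quads n. b > a}. ?G a b)
    + (\<Sum>(a, b, x, y)\<in>{(a, b, x, y) \<in> quads n. a = b}. ?G a b)"
    by (rule sum_quads_split)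
  also have "(\<Sum>(a, b, x, y)\<in>{(a, b, x, y) \<in> quads n. a > b}. ?G a b) =
      (\<Sum>(a, b, x, y)\<in>{(a, b, x, y) \<in> quads n. b > a}. ?G a b)"
    by (subst sum_quads_swap) (simp only: cyc)
  also have "(\<Sum>(a, b, x, y)\<in>{(a, b, x, y) \<in> quads n. a = b}. ?G a b) =
      (\<Sum>(a, b, x, y)\<in>{(a, b, x, y) \<in> quads n. a = b}. f (real a) 0)"
    by (rule sum.cong) auto
  also have "\<dots> = (\<Sum>d\<in>divs n. (real n / real d - 1) * f (real d) 0)"
    by (rule sum_quads_equal_ab)
  finally have 2: "(\<Sum>(a, b, x, y)\<in>quads n. ?G a b) =
      2 * (\<Sum>(a, b, x, y)\<in>{(a, b, x, y) \<in> quads n. b > a}. ?G a b)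
    + (\<Sum>d\<in>divs n. (real n / real d - 1) * f (real d) 0)" by (simp only: mult_2)
  have "(\<Sum>(a, b, x, y)\<in>quads n. ?F a b - ?G a b) = (\<Sum>(a, b, x, y)\<in>quads n. ?F a b)
      - (\<Sum>(a, b, x, y)\<in>quads n. ?G a b)"
    by (simp add: sum_subtractf case_prod_unfold)
  also have "\<dots> = (\<Sum>d\<in>divs n. (\<Sum>a\<in>{1..<d}. f (real a) (real d - real a))
      - (real n / real d - 1) * f (real d) 0)"
    unfolding 1 2 by (simp add: sum_subtractf)
  finally show ?thesis .
qed

lemma sigma_fps_nth: "fps_nth (sigma_fps k) n = (\<Sum>d\<in>divs n. real d ^ k)"
  by (simp add: sigma_fps_def divs_def)

lemma sigma_mult_nth:
  "fps_nth (sigma_fps i * sigma_fps j) n = (\<Sum>(a, b, x, y)\<in>quads n. real a ^ i * real b ^ j)"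
proof -
  have "(\<Sum>(a, b, x, y)\<in>quads n. real a ^ i * real b ^ j) =
      (\<Sum>(m, a, b)\<in>(SIGMA m:{0..n}. divs m \<times> divs (n - m)). real a ^ i * real b ^ j)"
  proof (rule sum.reindex_bij_witness[where j = "\<lambda>(a, b, x, y). (a * x, a, b)"
        and i = "\<lambda>(m, a, b). (a, b, m div a, (n - m) div b)"])
    fix q assume "q \<in> quads n"
    then obtain a b x y where q: "q = (a, b, x, y)" "a \<ge> 1" "b \<ge> 1" "x \<ge> 1" "y \<ge> 1" "a * x + b * y = n"
      by (auto simp: quads_def)
    have *: "n - a * x = b * y" "a * x \<le> n" "a * x div a = x" "b * y div b
        = y" "a \<le> a * x" "b \<le> b * y" using q by auto
    then show "(case case q of (a, b, x, y) \<Rightarrow> (a * x, a, b) of (m, a, b) \<Rightarrow> (a, b, m div a, (n - m) div b)) = q"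
      "(case q of (a, b, x, y) \<Rightarrow> (a * x, a, b)) \<in> (SIGMA m:{0..n}. divs m \<times> divs (n - m))"
      "(case case q of (a, b, x, y) \<Rightarrow> (a * x, a, b) of (m, a, b) \<Rightarrow> real a ^ i * real b ^ j) =
        (case q of (a, b, x, y) \<Rightarrow> real a ^ i * real b ^ j)"
      using q(1-5) by (auto simp: divs_def)
  next
    fix p assume "p \<in> (SIGMA m:{0..n}. divs m \<times> divs (n - m))"
    then obtain m a b k l where p: "p = (m, a, b)" "m \<le> n" "m = a * k" "n - m
        = b * l" "1 \<le> a" "a \<le> m" "1 \<le> b" "b \<le> n - m"
      by (auto simp: divs_def elim!: dvdE)
    then have "m div a = k" "(n - m) div b = l" "k \<ge> 1" "l \<ge> 1" "a * k + b * l = n"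
      by (auto simp: Suc_le_eq intro!: Nat.gr0I)
    then show "(case case p of (m, a, b) \<Rightarrow> (a, b, m div a, (n
        - m) div b) of (a, b, x, y) \<Rightarrow> (a * x, a, b)) = p"
      "(case p of (m, a, b) \<Rightarrow> (a, b, m div a, (n - m) div b)) \<in> quads n"
      using p by (auto simp: quads_def)
  qed
  also have "\<dots> = (\<Sum>m=0..n. \<Sum>(a, b)\<in>divs m \<times> divs (n - m). real a ^ i * real b ^ j)"
    by (subst sum.Sigma) (auto simp: finite_divs)
  also have "\<dots> = fps_nth (sigma_fps i * sigma_fps j) n"
    by (simp add: fps_mult_nth sigma_fps_nth sum_product sum.cartesian_product)
  finally show ?thesis ..
qed

text \<open>By \<open>step\<close> and \<open>init\<close>, \<open>G N d\<close> is \<open>K\<close>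
  times the sum of \<open>f a (d - a)\<close> over \<open>1 <= a < N\<close>; \<open>K\<close>
  clears the denominators of that power sum. The edge \<open>b = 0\<close> yields
  \<open>n d^k\<close>, the source of the derivatives \<open>fps_XD\<close>.\<close>

lemma sum_quads_polynomial:
  fixes f G :: "real \<Rightarrow> real \<Rightarrow> real"
  assumes sym: "\<And>a b. f a b = f b a" and cyc: "\<And>a b. f a (b - a) = f b (a - b)"
    and step: "\<And>N d. G (N + 1) d = G N d + K * f N (d - N)" and init: "\<And>d. G 1 d = 0"
    and edge: "\<And>d. f d 0 = c * d ^ Suc k"
  shows "(\<Sum>(a, b, x, y)\<in>quads n. K * (f (real a) (real b) - f (real a) (real b - real a))) =
    (\<Sum>d\<in>divs n. G (real d) (real d) - K * c * (real n * real d ^ k - real d ^ Suc k))"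
proof -
  have F: "K * (\<Sum>a\<in>{1..<N}. f (real a) (d - real a)) = G (real N) d" if "N \<ge> 1" for N d
    using that
  proof (induction N rule: nat_induct_at_least)
    case (Suc N)
    then have "K * (\<Sum>a\<in>{1..<Suc N}. f (real a) (d - real a)) = G (real N) d
        + K * f (real N) (d - real N)"
      by (simp add: distrib_left)
    then show ?case using step[of "real N" d] by (simp add: add.commute)
  qed (simp add: init)
  have "(\<Sum>(a, b, x, y)\<in>quads n. K * (f (real a) (real b) - f (real a) (real b - real a))) =
      (\<Sum>d\<in>divs n. K * ((\<Sum>a\<in>{1..<d}. f (real a) (real d - real a)) - (real n / real d
          - 1) * f (real d) 0))"
    using sum_quads_identity[of f n, OF sym cyc] by (simp add: sum_distrib_left[symmetric] case_prod_unfold)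
  also have "\<dots> = (\<Sum>d\<in>divs n. G (real d) (real d) - K * c * (real n * real d ^ k
      - real d ^ Suc k))"
  proof (rule sum.cong)
    fix d assume "d \<in> divs n"
    then have d: "d \<ge> 1" by (simp add: divs_def)
    have "(real n / real d - 1) * f (real d) 0 = c * (real n * real d ^ k - real d ^ Suc k)"
      using d by (simp add: edge field_simps)
    then show "K * ((\<Sum>a\<in>{1..<d}. f (real a) (real d - real a)) - (real n / real d
        - 1) * f (real d) 0) =
        G (real d) (real d) - K * c * (real n * real d ^ k - real d ^ Suc k)"
      using F[OF d, of "real d"] by (simp add: right_diff_distrib)
  qed simp
  finally show ?thesis .
qed

text \<open>Each \<open>f\<close> below is chosen such that \<open>f a b\<close> and \<open>f a (b
    - a)\<close> are symmetric and their difference has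
  only odd powers of \<open>a\<close> and \<open>b\<close>; \<open>G\<close> is the corresponding power sum.\<close>

lemma sigma_1_1:
  "12 * (sigma_fps 1 * sigma_fps 1) =
    5 * sigma_fps 3 + sigma_fps 1 - 6 * fps_XD (sigma_fps 1)"
  (is "?L = ?R")
proof (rule fps_ext)
  fix n
  \<comment> \<open>Let \<open>p = a^2 + a b + b^2\<close> and \<open>r = a b (a + b)\<close>.
    Polynomials in \<open>p\<close> and \<open>r^2\<close> are invariant under permutations of
    \<open>a, b, - a - b\<close> and under a common sign, so \<open>f a (b - a) = f a (- b)\<close>
    and the difference is twice the part odd in \<open>b\<close>. In this and the next five lemmas
    \<open>f\<close> is \<open>p\<close>, \<open>p^2\<close>, \<open>r^2\<close>,
    \<open>p^3 - 6 r^2\<close>, \<open>p r^2\<close>, \<open>p^2 r^2\<close>.\<close>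
  define f where "f a b = a^2 + a * b + b^2" for a b :: real
  define G where "G N d = 2 * N^3 - 3 * N^2 * d - 3 * N^2 + 6 * N * d^2 + 3 * N * d + N
      - 6 * d^2" for N d :: real
  have g: "12 * (a ^ 1 * b ^ 1) = 6 * (f a b - f a (b - a))" for a b
    unfolding f_def by algebra
  have "fps_nth ?L n = (\<Sum>(a, b, x, y)\<in>quads n. 6 * (f (real a) (real b) - f (real a) (real b
      - real a)))"
    by (simp only: fps_add_nth fps_sub_nth fps_nth_numeral_mult sigma_mult_nth sum_distrib_left
      sum.distrib[symmetric] sum_subtractf[symmetric] case_prod_unfold g[symmetric])
  also have "\<dots> = (\<Sum>d\<in>divs n. G (real d) (real d) - 6 * 1 * (real n * real d ^ 1
      - real d ^ Suc 1))"
  proof (rule sum_quads_polynomial[where f = f and G = G])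
    show "f a b = f b a" "f a (b - a) = f b (a - b)" for a b unfolding f_def by algebra+
    show "G (N + 1) d = G N d + 6 * f N (d - N)" for N d unfolding f_def G_def by algebra
    show "f d 0 = 1 * d ^ Suc 1" for d by (simp add: f_def eval_nat_numeral mult.assoc)
  qed (simp add: G_def)
  also have "\<dots> = (\<Sum>d\<in>divs n. 5 * real d ^ 3 + real d ^ 1 - 6 * (real n * real d ^ 1))"
    unfolding G_def power_Suc by (rule sum.cong[OF refl]) algebra
  also have "\<dots> = fps_nth ?R n"
    by (simp only: fps_add_nth fps_sub_nth fps_nth_numeral_mult sigma_fps_nth fps_XD_nth sum_distrib_left
      sum.distrib sum_subtractf)
  finally show "fps_nth ?L n = fps_nth ?R n" .
qed

lemma sigma_1_3:
  "120 * (sigma_fps 1 * sigma_fps 3) + 120 * (sigma_fps 3 * sigma_fps 1) =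
    21 * sigma_fps 5 + 10 * sigma_fps 3 - sigma_fps 1 - 30 * fps_XD (sigma_fps 3)"
  (is "?L = ?R")
proof (rule fps_ext)
  fix n
  define f where "f a b = (a^2 + a * b + b^2)^2" for a b :: real
  define G where "G N d = 6 * N^5 - 15 * N^4 * d - 15 * N^4 + 30 * N^3 * d^2 + 30 * N^3 * d + 10 * N^3
      - 30 * N^2 * d^3 - 45 * N^2 * d^2 - 15 * N^2 * d + 30 * N * d^4 + 30 * N * d^3 + 15 * N * d^2 - N
      - 30 * d^4" for N d :: real
  have g: "120 * (a ^ 1 * b ^ 3) + 120 * (a ^ 3 * b ^ 1) = 30 * (f a b - f a (b - a))" for a b
    unfolding f_def by algebra
  have "fps_nth ?L n = (\<Sum>(a, b, x, y)\<in>quads n. 30 * (f (real a) (real b) - f (real a) (real b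
      - real a)))"
    by (simp only: fps_add_nth fps_sub_nth fps_nth_numeral_mult sigma_mult_nth sum_distrib_left
      sum.distrib[symmetric] sum_subtractf[symmetric] case_prod_unfold g[symmetric])
  also have "\<dots> = (\<Sum>d\<in>divs n. G (real d) (real d) - 30 * 1 * (real n * real d ^ 3
      - real d ^ Suc 3))"
  proof (rule sum_quads_polynomial[where f = f and G = G])
    show "f a b = f b a" "f a (b - a) = f b (a - b)" for a b unfolding f_def by algebra+
    show "G (N + 1) d = G N d + 30 * f N (d - N)" for N d unfolding f_def G_def by algebra
    show "f d 0 = 1 * d ^ Suc 3" for d by (simp add: f_def eval_nat_numeral mult.assoc)
  qed (simp add: G_def)
  also have "\<dots> = (\<Sum>d\<in>divs n. 21 * real d ^ 5 + 10 * real d ^ 3 - real d ^ 1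
      - 30 * (real n * real d ^ 3))"
    unfolding G_def power_Suc by (rule sum.cong[OF refl]) algebra
  also have "\<dots> = fps_nth ?R n"
    by (simp only: fps_add_nth fps_sub_nth fps_nth_numeral_mult sigma_fps_nth fps_XD_nth sum_distrib_left
      sum.distrib sum_subtractf)
  finally show "fps_nth ?L n = fps_nth ?R n" .
qed

lemma sigma_3_3:
  "120 * (sigma_fps 3 * sigma_fps 3) =
    sigma_fps 7 - sigma_fps 3"
  (is "?L = ?R")
proof (rule fps_ext)
  fix n
  define f where "f a b = a^2 * b^2 * (a + b)^2" for a b :: real
  define G where "G N d = 6 * N^5 * d^2 - 15 * N^4 * d^3 - 15 * N^4 * d^2 + 10 * N^3 * d^4
      + 30 * N^3 * d^3 + 10 * N^3 * d^2 - 15 * N^2 * d^4 - 15 * N^2 * d^3 + 5 * N * d^4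
      - N * d^2" for N d :: real
  have g: "120 * (a ^ 3 * b ^ 3) = 30 * (f a b - f a (b - a))" for a b
    unfolding f_def by algebra
  have "fps_nth ?L n = (\<Sum>(a, b, x, y)\<in>quads n. 30 * (f (real a) (real b) - f (real a) (real b
      - real a)))"
    by (simp only: fps_add_nth fps_sub_nth fps_nth_numeral_mult sigma_mult_nth sum_distrib_left
      sum.distrib[symmetric] sum_subtractf[symmetric] case_prod_unfold g[symmetric])
  also have "\<dots> = (\<Sum>d\<in>divs n. G (real d) (real d) - 30 * 0 * (real n * real d ^ 5
      - real d ^ Suc 5))"
  proof (rule sum_quads_polynomial[where f = f and G = G])
    show "f a b = f b a" "f a (b - a) = f b (a - b)" for a b unfolding f_def by algebra+
    show "G (N + 1) d = G N d + 30 * f N (d - N)" for N d unfolding f_def G_def by algebra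
    show "f d 0 = 0 * d ^ Suc 5" for d by (simp add: f_def eval_nat_numeral mult.assoc)
  qed (simp add: G_def)
  also have "\<dots> = (\<Sum>d\<in>divs n. real d ^ 7 - real d ^ 3)"
    unfolding G_def power_Suc by (rule sum.cong[OF refl]) algebra
  also have "\<dots> = fps_nth ?R n"
    by (simp only: fps_add_nth fps_sub_nth fps_nth_numeral_mult sigma_fps_nth fps_XD_nth sum_distrib_left
      sum.distrib sum_subtractf)
  finally show "fps_nth ?L n = fps_nth ?R n" .
qed

lemma sigma_1_5:
  "504 * (sigma_fps 1 * sigma_fps 5) - 840 * (sigma_fps 3 * sigma_fps 3) + 504 * (sigma_fps 5 * sigma_fps 1) =
    33 * sigma_fps 7 + 42 * sigma_fps 5 + 7 * sigma_fps 3 + 2 * sigma_fps 1 - 84 * fps_XD (sigma_fps 5)"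
  (is "?L = ?R")
proof (rule fps_ext)
  fix n
  define f where "f a b = a^6 + 3 * a^5 * b - 5 * a^3 * b^3 + 3 * a * b^5 + b^6" for a b :: real
  define G where "G N d = 12 * N^7 - 42 * N^6 * d - 42 * N^6 + 126 * N^5 * d + 42 * N^5
      + 105 * N^4 * d^3 - 105 * N^4 * d - 210 * N^3 * d^3 - 14 * N^3 - 126 * N^2 * d^5
      + 105 * N^2 * d^3 + 21 * N^2 * d + 84 * N * d^6 + 126 * N * d^5 + 2 * N - 84 * d^6" for N d :: real
  have g: "504 * (a ^ 1 * b ^ 5) - 840 * (a ^ 3 * b ^ 3) + 504 * (a ^ 5 * b ^ 1) = 84 * (f a b - f a (b
      - a))" for a b
    unfolding f_def by algebra
  have "fps_nth ?L n = (\<Sum>(a, b, x, y)\<in>quads n. 84 * (f (real a) (real b) - f (real a) (real b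
      - real a)))"
    by (simp only: fps_add_nth fps_sub_nth fps_nth_numeral_mult sigma_mult_nth sum_distrib_left
      sum.distrib[symmetric] sum_subtractf[symmetric] case_prod_unfold g[symmetric])
  also have "\<dots> = (\<Sum>d\<in>divs n. G (real d) (real d) - 84 * 1 * (real n * real d ^ 5
      - real d ^ Suc 5))"
  proof (rule sum_quads_polynomial[where f = f and G = G])
    show "f a b = f b a" "f a (b - a) = f b (a - b)" for a b unfolding f_def by algebra+
    show "G (N + 1) d = G N d + 84 * f N (d - N)" for N d unfolding f_def G_def by algebra
    show "f d 0 = 1 * d ^ Suc 5" for d by (simp add: f_def eval_nat_numeral mult.assoc)
  qed (simp add: G_def)
  also have "\<dots> = (\<Sum>d\<in>divs n. 33 * real d ^ 7 + 42 * real d ^ 5 + 7 * real d ^ 3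
      + 2 * real d ^ 1 - 84 * (real n * real d ^ 5))"
    unfolding G_def power_Suc by (rule sum.cong[OF refl]) algebra
  also have "\<dots> = fps_nth ?R n"
    by (simp only: fps_add_nth fps_sub_nth fps_nth_numeral_mult sigma_fps_nth fps_XD_nth sum_distrib_left
      sum.distrib sum_subtractf)
  finally show "fps_nth ?L n = fps_nth ?R n" .
qed

lemma sigma_3_5:
  "2520 * (sigma_fps 3 * sigma_fps 5) + 2520 * (sigma_fps 5 * sigma_fps 3) =
    11 * sigma_fps 9 - 21 * sigma_fps 5 + 10 * sigma_fps 3"
  (is "?L = ?R")
proof (rule fps_ext)
  fix n
  define f where "f a b = a^6 * b^2 + 3 * a^5 * b^3 + 4 * a^4 * b^4 + 3 * a^3 * b^5
      + a^2 * b^6" for a b :: real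
  define G where "G N d = 60 * N^7 * d^2 - 210 * N^6 * d^3 - 210 * N^6 * d^2 + 336 * N^5 * d^4
      + 630 * N^5 * d^3 + 210 * N^5 * d^2 - 315 * N^4 * d^5 - 840 * N^4 * d^4 - 525 * N^4 * d^3
      + 140 * N^3 * d^6 + 630 * N^3 * d^5 + 560 * N^3 * d^4 - 70 * N^3 * d^2 - 210 * N^2 * d^6
      - 315 * N^2 * d^5 + 105 * N^2 * d^3 + 70 * N * d^6 - 56 * N * d^4 + 10 * N * d^2" for N d :: real
  have g: "2520 * (a ^ 3 * b ^ 5) + 2520 * (a ^ 5 * b ^ 3) = 420 * (f a b - f a (b - a))" for a b
    unfolding f_def by algebra
  have "fps_nth ?L n = (\<Sum>(a, b, x, y)\<in>quads n. 420 * (f (real a) (real b) - f (real a) (real b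
      - real a)))"
    by (simp only: fps_add_nth fps_sub_nth fps_nth_numeral_mult sigma_mult_nth sum_distrib_left
      sum.distrib[symmetric] sum_subtractf[symmetric] case_prod_unfold g[symmetric])
  also have "\<dots> = (\<Sum>d\<in>divs n. G (real d) (real d) - 420 * 0 * (real n * real d ^ 7
      - real d ^ Suc 7))"
  proof (rule sum_quads_polynomial[where f = f and G = G])
    show "f a b = f b a" "f a (b - a) = f b (a - b)" for a b unfolding f_def by algebra+
    show "G (N + 1) d = G N d + 420 * f N (d - N)" for N d unfolding f_def G_def by algebra
    show "f d 0 = 0 * d ^ Suc 7" for d by (simp add: f_def eval_nat_numeral mult.assoc)
  qed (simp add: G_def)
  also have "\<dots> = (\<Sum>d\<in>divs n. 11 * real d ^ 9 - 21 * real d ^ 5 + 10 * real d ^ 3)"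
    unfolding G_def power_Suc by (rule sum.cong[OF refl]) algebra
  also have "\<dots> = fps_nth ?R n"
    by (simp only: fps_add_nth fps_sub_nth fps_nth_numeral_mult sigma_fps_nth fps_XD_nth sum_distrib_left
      sum.distrib sum_subtractf)
  finally show "fps_nth ?L n = fps_nth ?R n" .
qed

text \<open>Divisibility of \<open>f\<close> by \<open>b^2\<close> excludes a derivative term. The
  proportion of the two kinds of products equals that of \<open>441 * 240 * 480\<close> to
  \<open>250 * 504^2\<close>, as needed for \<open>E12\<close>.\<close>

lemma sigma_3_7_5_5:
  "5040 * (sigma_fps 3 * sigma_fps 7) + 12600 * (sigma_fps 5 * sigma_fps 5)
      + 5040 * (sigma_fps 7 * sigma_fps 3) =
    13 * sigma_fps 11 - 42 * sigma_fps 7 + 50 * sigma_fps 5 - 21 * sigma_fps 3"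
  (is "?L = ?R")
proof (rule fps_ext)
  fix n
  define f where "f a b = a^8 * b^2 + 4 * a^7 * b^3 + 8 * a^6 * b^4 + 10 * a^5 * b^5 + 8 * a^4 * b^6
      + 4 * a^3 * b^7 + a^2 * b^8" for a b :: real
  define G where "G N d = 70 * N^9 * d^2 - 315 * N^8 * d^3 - 315 * N^8 * d^2 + 720 * N^7 * d^4
      + 1260 * N^7 * d^3 + 420 * N^7 * d^2 - 1050 * N^6 * d^5 - 2520 * N^6 * d^4 - 1470 * N^6 * d^3
      + 1008 * N^5 * d^6 + 3150 * N^5 * d^5 + 2520 * N^5 * d^4 - 294 * N^5 * d^2 - 630 * N^4 * d^7
      - 2520 * N^4 * d^6 - 2625 * N^4 * d^5 + 735 * N^4 * d^3 + 210 * N^3 * d^8 + 1260 * N^3 * d^7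
      + 1680 * N^3 * d^6 - 840 * N^3 * d^4 + 140 * N^3 * d^2 - 315 * N^2 * d^8 - 630 * N^2 * d^7
      + 525 * N^2 * d^5 - 210 * N^2 * d^3 + 105 * N * d^8 - 168 * N * d^6 + 120 * N * d^4
      - 21 * N * d^2" for N d :: real
  have g: "5040 * (a ^ 3 * b ^ 7) + 12600 * (a ^ 5 * b ^ 5) + 5040 * (a ^ 7 * b ^ 3) = 630 * (f a b
      - f a (b - a))" for a b
    unfolding f_def by algebra
  have "fps_nth ?L n = (\<Sum>(a, b, x, y)\<in>quads n. 630 * (f (real a) (real b) - f (real a) (real b
      - real a)))"
    by (simp only: fps_add_nth fps_sub_nth fps_nth_numeral_mult sigma_mult_nth sum_distrib_left
      sum.distrib[symmetric] sum_subtractf[symmetric] case_prod_unfold g[symmetric])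
  also have "\<dots> = (\<Sum>d\<in>divs n. G (real d) (real d) - 630 * 0 * (real n * real d ^ 9
      - real d ^ Suc 9))"
  proof (rule sum_quads_polynomial[where f = f and G = G])
    show "f a b = f b a" "f a (b - a) = f b (a - b)" for a b unfolding f_def by algebra+
    show "G (N + 1) d = G N d + 630 * f N (d - N)" for N d unfolding f_def G_def by algebra
    show "f d 0 = 0 * d ^ Suc 9" for d by (simp add: f_def eval_nat_numeral mult.assoc)
  qed (simp add: G_def)
  also have "\<dots> = (\<Sum>d\<in>divs n. 13 * real d ^ 11 - 42 * real d ^ 7 + 50 * real d ^ 5
      - 21 * real d ^ 3)"
    unfolding G_def power_Suc by (rule sum.cong[OF refl]) algebra
  also have "\<dots> = fps_nth ?R n"
    by (simp only: fps_add_nth fps_sub_nth fps_nth_numeral_mult sigma_fps_nth fps_XD_nth sum_distrib_left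
      sum.distrib sum_subtractf)
  finally show "fps_nth ?L n = fps_nth ?R n" .
qed

section \<open>Ramanujan's differential equations\<close>

definition E2 :: "real fps" where "E2 = 1 - 24 * sigma_fps 1"
definition E4 :: "real fps" where "E4 = 1 + 240 * sigma_fps 3"
definition E6 :: "real fps" where "E6 = 1 - 504 * sigma_fps 5"

lemma fps_XD_numeral_mult: "fps_XD (numeral k * f) = numeral k * fps_XD (f :: real fps)"
  by (rule fps_ext) (simp add: fps_nth_numeral_mult)

lemma fps_XD_1 [simp]: "fps_XD (1 :: real fps) = 0" by (simp add: fps_XD_def)

lemma fps_XD_diff: "fps_XD (f - g) = fps_XD f - fps_XD (g :: real fps)"
  by (rule fps_ext) (simp add: algebra_simps)

lemma ramanujan_E2: "12 * fps_XD E2 = E2 * E2 - E4"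
proof -
  have "E2 * E2 = 1 - 48 * sigma_fps 1 + 48 * (12 * (sigma_fps 1 * sigma_fps 1))"
    by (simp add: E2_def algebra_simps)
  also have "\<dots> = E4 - 288 * fps_XD (sigma_fps 1)"
    unfolding sigma_1_1 by (simp add: E4_def algebra_simps)
  finally show ?thesis by (simp add: E2_def fps_XD_diff fps_XD_numeral_mult)
qed

lemma ramanujan_E4: "3 * fps_XD E4 = E2 * E4 - E6"
proof -
  have "E2 * E4 = 1 - 24 * sigma_fps 1 + 240 * sigma_fps 3
      - 24 * (120 * (sigma_fps 1 * sigma_fps 3) + 120 * (sigma_fps 3 * sigma_fps 1))"
    by (simp add: E2_def E4_def algebra_simps)
  also have "\<dots> = E6 + 720 * fps_XD (sigma_fps 3)"
    unfolding sigma_1_3 by (simp add: E6_def algebra_simps)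
  finally show ?thesis by (simp add: E4_def fps_XD_numeral_mult)
qed

lemma E8: "E4 * E4 = 1 + 480 * sigma_fps 7"
proof -
  have "E4 * E4 = 1 + 480 * sigma_fps 3 + 480 * (120 * (sigma_fps 3 * sigma_fps 3))"
    by (simp add: E4_def algebra_simps)
  then show ?thesis unfolding sigma_3_3 by (simp add: algebra_simps)
qed

lemma ramanujan_E6: "2 * fps_XD E6 = E2 * E6 - E4 * E4"
proof -
  \<comment> \<open>The last term restores what \<open>sigma_1_5\<close> subtracts:
    \<open>12 * 840 = 84 * 120\<close>.\<close>
  have "E2 * E6 = 1 - 24 * sigma_fps 1 - 504 * sigma_fps 5
      + 12 * (504 * (sigma_fps 1 * sigma_fps 5) - 840 * (sigma_fps 3 * sigma_fps 3) + 504 * (sigma_fps 5 * sigma_fps 1))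
      + 84 * (120 * (sigma_fps 3 * sigma_fps 3))"
    by (simp add: E2_def E6_def algebra_simps)
  also have "\<dots> = 1 + 480 * sigma_fps 7 - 1008 * fps_XD (sigma_fps 5)"
    unfolding sigma_1_5 sigma_3_3 by (simp add: algebra_simps)
  finally show ?thesis unfolding E8 by (simp add: E6_def fps_XD_diff fps_XD_numeral_mult)
qed

lemma E10: "E4 * E6 = 1 - 264 * sigma_fps 9"
proof -
  have "E4 * E6 = 1 + 240 * sigma_fps 3 - 504 * sigma_fps 5
      - 24 * (2520 * (sigma_fps 3 * sigma_fps 5) + 2520 * (sigma_fps 5 * sigma_fps 3))"
    by (simp add: E4_def E6_def algebra_simps)
  then show ?thesis unfolding sigma_3_5 by (simp add: algebra_simps)
qed

lemma E12: "441 * (E4 * (E4 * E4)) + 250 * (E6 * E6) = 691 + 65520 * sigma_fps 11"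
proof -
  have "441 * (E4 * (E4 * E4)) + 250 * (E6 * E6) = 691 + 105840 * sigma_fps 3 - 252000 * sigma_fps 5
      + 211680 * sigma_fps 7
      + 5040 * (5040 * (sigma_fps 3 * sigma_fps 7) + 12600 * (sigma_fps 5 * sigma_fps 5)
        + 5040 * (sigma_fps 7 * sigma_fps 3))"
    unfolding E8 by (simp add: E4_def E6_def algebra_simps)
  then show ?thesis unfolding sigma_3_7_5_5 by (simp add: algebra_simps)
qed

section \<open>The series of \<open>p23\<close> and its differential equation\<close>

definition real_fps :: "int fps \<Rightarrow> real fps" where
  "real_fps f = Abs_fps (\<lambda>n. real_of_int (fps_nth f n))"

lemma real_fps_mult: "real_fps (f * g) = real_fps f * real_fps g"
  by (rule fps_ext) (simp add: real_fps_def fps_mult_nth)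

lemma real_fps_power: "real_fps (f ^ n) = real_fps f ^ n"
proof (induction n)
  case 0
  show ?case by (rule fps_ext) (simp add: real_fps_def)
qed (simp add: real_fps_mult)

lemma real_fps_prod: "real_fps (\<Prod>i\<le>(N::nat). f i) = (\<Prod>i\<le>N. real_fps (f i))"
  by (induction N) (simp_all add: real_fps_mult)

definition prod23 :: "nat \<Rightarrow> real fps" where
  "prod23 N = (\<Prod>k\<le>N. (1 - fps_X ^ Suc k) ^ 23)"

lemma real_fps_prod23: "real_fps (\<Prod>k\<le>N. (1 - fps_X ^ Suc k) ^ 23) = prod23 N"
proof -
  have "real_fps (1 - fps_X ^ Suc k) = 1 - fps_X ^ Suc k" for k
    by (rule fps_ext) (simp add: real_fps_def fps_X_power_nth del: power_Suc)
  then show ?thesis by (simp only: real_fps_prod real_fps_power prod23_def)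
qed

lemma fps_XD_power: "fps_XD (f ^ Suc n) = of_nat (Suc n) * f ^ n * fps_XD (f :: real fps)"
  by (simp only: fps_XD_def o_apply fps_deriv_power fps_of_nat diff_Suc_1) (simp only: mult_ac)

lemma fps_XD_prod23: "fps_XD (prod23 N) = - (23 * prod23 N * (\<Sum>k\<in>{1..Suc N}. divisor_part k))"
proof -
  have fac: "fps_XD ((1 - fps_X ^ Suc k) ^ 23) = - (23 * (1 - fps_X ^ Suc k) ^ 23 * divisor_part (Suc k))" for k
  proof -
    define u where "u = (1 - fps_X ^ Suc k :: real fps)"
    have Du: "fps_XD u = - (u * divisor_part (Suc k))"
      unfolding u_def using fps_XD_X_power[of "Suc k", where 'a = real]
      by (simp only: fps_XD_diff fps_XD_1 divisor_part_mult) simp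
    have "fps_XD (u ^ Suc 22) = of_nat (Suc 22) * u ^ 22 * fps_XD u" by (rule fps_XD_power)
    also have "\<dots> = - (of_nat (Suc 22) * u ^ Suc 22 * divisor_part (Suc k))"
      unfolding Du power_Suc by (simp only: mult_minus_right mult_minus_left mult_ac)
    finally show ?thesis by (simp add: u_def)
  qed
  show ?thesis
  proof (induction N)
    case 0
    show ?case using fac[of 0] by (simp add: prod23_def)
  next
    case (Suc N)
    let ?v = "(1 - fps_X ^ Suc (Suc N)) ^ 23 :: real fps"
    have p: "prod23 (Suc N) = prod23 N * ?v" by (simp only: prod23_def prod.atMost_Suc)
    have s: "(\<Sum>k\<in>{1..Suc (Suc N)}. divisor_part k) = (\<Sum>k\<in>{1..Suc N}. divisor_part k)
        + divisor_part (Suc (Suc N))"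
      by simp
    show ?case unfolding p s fps_XD_mult Suc fac by (simp only: algebra_simps) (simp add: algebra_simps)
  qed
qed

definition p23_fps :: "real fps" where
  "p23_fps = Abs_fps (\<lambda>m. real_of_int (p23 m))"

lemma prod23_int_stable:
  fixes f :: "nat \<Rightarrow> int fps"
  defines "f \<equiv> \<lambda>k. (1 - fps_X ^ Suc k) ^ 23"
  assumes "m \<le> N"
  shows "fps_nth (\<Prod>i\<le>N. f i) m = fps_nth (\<Prod>i\<le>m. f i) m"
  using assms(2)
proof (induction N rule: dec_induct)
  case (step N)
  have "(1 - fps_X ^ Suc (Suc N)) - 1 dvd f (Suc N) - 1 ^ 23"
    unfolding f_def power_diff_sumr2 by (rule dvd_triv_left)
  then have "(fps_X :: int fps) ^ Suc (Suc N) dvd f (Suc N) - 1" by (simp del: power_Suc)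
  then obtain u where "f (Suc N) - 1 = fps_X ^ Suc (Suc N) * u" by (rule dvdE)
  then have u: "f (Suc N) = 1 + fps_X ^ Suc (Suc N) * u" by (simp only: diff_eq_eq add.commute)
  have "(\<Prod>i\<le>Suc N. f i) = (\<Prod>i\<le>N. f i) + fps_X ^ Suc (Suc N) * (u * (\<Prod>i\<le>N. f i))"
    by (simp only: prod.atMost_Suc u) (simp only: algebra_simps mult_1_left)
  then show ?case using step by (simp add: fps_X_power_mult_nth del: power_Suc prod.atMost_Suc)
qed simp

lemma p23_nth: "p23 m = fps_nth (\<Prod>k\<le>m. (1 - fps_X ^ Suc k) ^ 23) m"
proof -
  define f :: "nat \<Rightarrow> int fps" where "f k = (1 - fps_X ^ Suc k) ^ 23" for k
  define g where "g = Abs_fps (\<lambda>m. fps_nth (\<Prod>i\<le>m. f i) m)"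
  have lim: "(\<lambda>n. \<Prod>i\<le>n. f i) \<longlonglongrightarrow> g"
  proof (rule tendsto_fpsI)
    fix m
    show "\<forall>\<^sub>F n in sequentially. fps_nth (\<Prod>i\<le>n. f i) m = fps_nth g m"
      unfolding g_def fps_nth_Abs_fps using eventually_ge_at_top[of m]
      by eventually_elim (unfold f_def, rule prod23_int_stable)
  qed
  have g0: "g \<noteq> 0"
  proof
    assume "g = 0"
    then have "fps_nth g 0 = 0" by simp
    then show False by (simp add: g_def f_def fps_power_zeroth)
  qed
  have f0: "f k \<noteq> 0" for k
  proof
    assume "f k = 0"
    then have "fps_nth (f k) 0 = 0" by simp
    then show False by (simp add: f_def fps_power_zeroth)
  qed
  have "prodinf f = g"
    unfolding prodinf_def
  proof (rule the_equality)
    show "f has_prod g" using lim g0 by (simp add: has_prod_def raw_has_prod_def)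
    fix p assume "f has_prod p"
    \<comment> \<open>\<open>has_prod\<close> tolerates finitely many zero factors;
      \<open>f0\<close> excludes that alternative and leaves the plain limit of partial
      products.\<close>
    then have "(\<lambda>n. \<Prod>i\<le>n. f i) \<longlonglongrightarrow> p"
      using f0 by (auto simp: has_prod_def raw_has_prod_def)
    then show "p = g" using lim by (rule LIMSEQ_unique)
  qed
  then have "p23 m = fps_nth g m" by (simp only: p23_def f_def[abs_def])
  then show ?thesis by (simp only: g_def fps_nth_Abs_fps f_def)
qed

lemma prod23_nth: "m \<le> N \<Longrightarrow> fps_nth (prod23 N) m = fps_nth p23_fps m"
  using prod23_int_stable[of m N]
  by (simp add: real_fps_prod23[symmetric] real_fps_def p23_fps_def p23_nth)

lemma fps_XD_p23: "fps_XD p23_fps = - (23 * (p23_fps * sigma_fps 1))"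
proof (rule fps_ext)
  fix n
  have "fps_nth (fps_XD p23_fps) n = fps_nth (fps_XD (prod23 n)) n" by (simp add: prod23_nth)
  also have "\<dots> = - (23 * fps_nth (prod23 n * (\<Sum>k\<in>{1..Suc n}. divisor_part k)) n)"
    unfolding fps_XD_prod23 by (simp only: fps_neg_nth mult.assoc fps_nth_numeral_mult)
  also have "fps_nth (prod23 n * (\<Sum>k\<in>{1..Suc n}. divisor_part k)) n = fps_nth (p23_fps * sigma_fps 1) n"
    unfolding fps_mult_nth
  proof (rule sum.cong)
    fix i assume "i \<in> {0..n}"
    then have "i \<le> n" "n - i \<le> Suc n" by auto
    then show "fps_nth (prod23 n) i * fps_nth (\<Sum>k\<in>{1..Suc n}. divisor_part k) (n - i) =
        fps_nth p23_fps i * fps_nth (sigma_fps 1) (n - i)"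
      by (simp only: prod23_nth sum_divisor_part_nth)
  qed simp
  finally show "fps_nth (fps_XD p23_fps) n = fps_nth (- (23 * (p23_fps * sigma_fps 1))) n"
    by (simp only: fps_neg_nth fps_nth_numeral_mult)
qed

lemma p23_fps_0: "fps_nth p23_fps 0 = 1"
  unfolding prod23_nth[of 0 0, symmetric, OF order_refl] by (simp add: prod23_def fps_power_zeroth)

text \<open>At \<open>q^n\<close> the equation expresses \<open>(n - 1) F_n\<close> through earlier
  coefficients, because \<open>sigma_fps 1\<close> has no constant term. Only \<open>F_1\<close> is
  free.\<close>

lemma ode_unique:
  fixes F :: "real fps"
  assumes F: "fps_XD F = F - 23 * (F * sigma_fps 1)" and F1: "fps_nth F 1 = 0"
  shows "F = 0"
proof -
  have "fps_nth F n = 0" for n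
  proof (induction n rule: less_induct)
    case (less n)
    have "fps_nth (F * sigma_fps 1) n = 0"
      unfolding fps_mult_nth
    proof (rule sum.neutral, rule ballI)
      fix i assume "i \<in> {0..n}"
      then show "fps_nth F i * fps_nth (sigma_fps 1) (n - i) = 0"
        using less[of i] by (cases "i = n") (simp_all add: sigma_fps_def)
    qed
    then have "fps_nth (F - 23 * (F * sigma_fps 1)) n = fps_nth F n"
      by (simp only: fps_sub_nth fps_nth_numeral_mult)
    then have "(real n - 1) * fps_nth F n = 0"
      unfolding F[symmetric] by (simp add: algebra_simps)
    then show ?case using F1 by (cases "n = 1") auto
  qed
  then show ?thesis by (intro fps_ext) simp
qed

definition delta_fps :: "real fps" where "delta_fps = E4 * (E4 * E4) - E6 * E6"

lemma fps_XD_delta: "fps_XD delta_fps = E2 * delta_fps"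
proof -
  have "fps_XD delta_fps = (3 * fps_XD E4) * (E4 * E4) - (2 * fps_XD E6) * E6"
    by (simp add: delta_fps_def fps_XD_diff fps_XD_mult algebra_simps)
  also have "\<dots> = E2 * delta_fps"
    unfolding ramanujan_E4 ramanujan_E6 by (simp add: delta_fps_def algebra_simps)
  finally show ?thesis .
qed

lemma sigma_fps_small: "fps_nth (sigma_fps a) 0 = 0" "fps_nth (sigma_fps a) 1 = 1"
proof -
  have "{d. d \<in> {1..1} \<and> d dvd (1::nat)} = {1}" by auto
  then show "fps_nth (sigma_fps a) 0 = 0" "fps_nth (sigma_fps a) 1 = 1"
    by (simp_all only: sigma_fps_def fps_nth_Abs_fps) simp_all
qed

text \<open>The exponent 23 is 24 - 1: \<open>fps_XD\<close> multiplies the left series by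
  \<open>E2 + sigma_fps 1 = 1 - 23 * sigma_fps 1\<close>, and so it does for \<open>q\<close> times
  the product. The constant \<open>1728 = 3 * 240 + 2 * 504\<close> compares the coefficients of
  \<open>q\<close>.\<close>

lemma delta_partition_p23: "partition_fps * delta_fps = 1728 * (fps_X * p23_fps)"
proof -
  define F where "F = partition_fps * delta_fps - 1728 * (fps_X * p23_fps)"
  have E2s: "E2 = 1 - 24 * sigma_fps 1" by (rule E2_def)
  have D1: "fps_XD (partition_fps * delta_fps) = partition_fps * delta_fps - 23 * (partition_fps * delta_fps * sigma_fps 1)"
    unfolding fps_XD_mult fps_XD_partition fps_XD_delta E2s by (simp add: algebra_simps)
  have D2: "fps_XD (fps_X * p23_fps) = fps_X * p23_fps - 23 * (fps_X * p23_fps * sigma_fps 1)"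
  proof -
    have "fps_XD (fps_X :: real fps) = fps_X" using fps_XD_X_power[of 1, where 'a = real] by simp
    then show ?thesis unfolding fps_XD_mult fps_XD_p23 by (simp add: algebra_simps)
  qed
  have "fps_XD F = F - 23 * (F * sigma_fps 1)"
    unfolding F_def fps_XD_diff fps_XD_numeral_mult D1 D2 by (simp add: algebra_simps)
  moreover have "fps_nth F 1 = 0"
  proof -
    have E: "fps_nth E4 0 = 1" "fps_nth E4 1 = 240" "fps_nth E6 0 = 1" "fps_nth E6 1 = - 504"
      by (simp_all add: E4_def E6_def fps_nth_numeral_mult sigma_fps_small[unfolded One_nat_def])
    have "fps_nth delta_fps 0 = 0" "fps_nth delta_fps 1 = 1728"
      using E by (simp_all add: delta_fps_def fps_mult_nth_1 fps_mult_nth_0)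
    then show ?thesis
      by (simp add: F_def fps_mult_nth_1 fps_nth_numeral_mult partition_fps_0 p23_fps_0)
  qed
  ultimately have "F = 0" by (rule ode_unique)
  then show ?thesis by (simp add: F_def)
qed

section \<open>Eisenstein monomials times the partition series\<close>

definition qmono :: "nat \<Rightarrow> nat \<Rightarrow> nat \<Rightarrow> real fps" where
  "qmono i j k = partition_fps * E2 ^ i * E4 ^ j * E6 ^ k"

lemma qmono_mult:
  "E2 * qmono i j k = qmono (Suc i) j k" "E4 * qmono i j k = qmono i (Suc j) k" "E6 * qmono i j k = qmono i j (Suc k)"
  by (simp_all add: qmono_def mult_ac)

text \<open>Logarithmic differentiation by Ramanujan's equations; 24 is a common denominator. Where
  \<open>i - 1\<close>, \<open>j - 1\<close> or \<open>k - 1\<close> is truncated, its factor is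
  0.\<close>

lemma fps_XD_qmono:
  "24 * fps_XD (qmono i j k) = (qmono i j k - qmono (Suc i) j k)
    + of_nat (2 * i) * (qmono (Suc i) j k - qmono (i - 1) (Suc j) k)
    + of_nat (8 * j) * (qmono (Suc i) j k - qmono i (j - 1) (Suc k))
    + of_nat (12 * k) * (qmono (Suc i) j k - qmono i (j + 2) (k - 1))"
proof -
  have P: "24 * fps_XD partition_fps = (1 - E2) * partition_fps"
    by (simp add: fps_XD_partition E2_def algebra_simps)
  have e2: "24 * fps_XD (E2 ^ i) = of_nat (2 * i) * (E2 ^ Suc i - E2 ^ (i - 1) * E4)"
  proof (cases i)
    case (Suc l)
    have "24 * fps_XD (E2 ^ Suc l) = of_nat (2 * Suc l) * E2 ^ l * (12 * fps_XD E2)"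
      unfolding fps_XD_power by (simp add: mult_ac)
    then show ?thesis unfolding ramanujan_E2 Suc by (simp add: algebra_simps)
  qed simp
  have e4: "24 * fps_XD (E4 ^ j) = of_nat (8 * j) * (E2 * E4 ^ j - E4 ^ (j - 1) * E6)"
  proof (cases j)
    case (Suc l)
    have "24 * fps_XD (E4 ^ Suc l) = of_nat (8 * Suc l) * E4 ^ l * (3 * fps_XD E4)"
      unfolding fps_XD_power by (simp add: mult_ac)
    then show ?thesis unfolding ramanujan_E4 Suc by (simp add: algebra_simps)
  qed simp
  have e6: "24 * fps_XD (E6 ^ k) = of_nat (12 * k) * (E2 * E6 ^ k - E4 * E4 * E6 ^ (k - 1))"
  proof (cases k)
    case (Suc l)
    have "24 * fps_XD (E6 ^ Suc l) = of_nat (12 * Suc l) * E6 ^ l * (2 * fps_XD E6)"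
      unfolding fps_XD_power by (simp add: mult_ac)
    then show ?thesis unfolding ramanujan_E6 Suc by (simp add: algebra_simps)
  qed simp
  have "24 * fps_XD (qmono i j k) = (24 * fps_XD partition_fps) * E2 ^ i * E4 ^ j * E6 ^ k
      + partition_fps * (24 * fps_XD (E2 ^ i)) * E4 ^ j * E6 ^ k
      + partition_fps * E2 ^ i * (24 * fps_XD (E4 ^ j)) * E6 ^ k
      + partition_fps * E2 ^ i * E4 ^ j * (24 * fps_XD (E6 ^ k))"
    unfolding qmono_def fps_XD_mult by (simp only: algebra_simps)
  then show ?thesis unfolding P e2 e4 e6 qmono_def
    by (simp only: algebra_simps power_Suc power_add power2_eq_square mult_1_left)
qed

section \<open>Weight twelve\<close>

lemma sigma_fps_mult:
  "24 * (sigma_fps 1 * x) = x - E2 * x"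
  "240 * (sigma_fps 3 * x) = E4 * x - x"
  "504 * (sigma_fps 5 * x) = x - E6 * x"
  "480 * (sigma_fps 7 * x) = E4 * (E4 * x) - x"
  "264 * (sigma_fps 9 * x) = x - E4 * (E6 * x)"
  "65520 * (sigma_fps 11 * x) = 441 * (E4 * (E4 * (E4 * x))) + 250 * (E6 * (E6 * x)) - 691 * x"
proof -
  show "24 * (sigma_fps 1 * x) = x - E2 * x" "240 * (sigma_fps 3 * x) = E4 * x - x"
    "504 * (sigma_fps 5 * x) = x - E6 * x"
    by (simp_all add: E2_def E4_def E6_def algebra_simps)
  have "480 * (sigma_fps 7 * x) = (E4 * E4) * x - x" unfolding E8 by (simp add: algebra_simps)
  then show "480 * (sigma_fps 7 * x) = E4 * (E4 * x) - x" by (simp only: mult.assoc)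
  have "264 * (sigma_fps 9 * x) = x - (E4 * E6) * x" unfolding E10 by (simp add: algebra_simps)
  then show "264 * (sigma_fps 9 * x) = x - E4 * (E6 * x)" by (simp only: mult.assoc)
  have "65520 * (sigma_fps 11 * x) = (441 * (E4 * (E4 * E4)) + 250 * (E6 * E6)) * x - 691 * x"
    unfolding E12 by (simp add: algebra_simps)
  then show "65520 * (sigma_fps 11 * x) = 441 * (E4 * (E4 * (E4 * x))) + 250 * (E6 * (E6 * x)) - 691 * x"
    by (simp only: distrib_right mult.assoc)
qed

lemma qmono_mult_numeral:
  "E2 * (numeral w * qmono i j k) = numeral w * qmono (Suc i) j k"
  "E4 * (numeral w * qmono i j k) = numeral w * qmono i (Suc j) k"
  "E6 * (numeral w * qmono i j k) = numeral w * qmono i j (Suc k)"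
  by (simp_all add: qmono_def mult_ac)

lemma qmono_0: "qmono 0 0 0 = partition_fps"
  by (simp add: qmono_def)

lemmas qmono_mult_simps = qmono_mult qmono_mult_numeral distrib_left right_diff_distrib numeral_2_eq_2[symmetric]

text \<open>The factor \<open>1\<close> is the instance of \<open>s\<close> in
  \<open>moment_recurrence\<close>.\<close>

lemma crank_recurrence:
  "zmoment (Suc a) crank_series = 1 * (\<Sum>b\<le>a. of_nat (a choose b) * zmoment b crank_series * zmoment (a - b) zlog)"
proof -
  have bal: "balanced crank_series" "balanced zlog"
    using zsym_crank_series zsym_zlog by (simp_all add: zsym_def)
  have "zderiv crank_series = crank_series * zlog"
    by (rule zderiv_eq_mult_zlog[OF swap2_crank_cum crank_series_cum zsym_crank_series])
  then show ?thesis using zmoment_zderiv[of a crank_series] by (simp add: zmoment_mult bal)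
qed

lemmas crank_zmoment_rec = moment_recurrence[OF crank_recurrence zmoment_zlog, unfolded crank_mass qmono_0[symmetric]]

lemmas cube_zmoment_rec = moment_recurrence[OF zmoment_Suc_logderiv[OF balanced_crank_cube zderiv_crank_cube]
  zmoment_zlog, unfolded zmoment_0_crank_cube qmono_0[symmetric]]

text \<open>The multiplier on the left clears all denominators. In the higher moments it is arranged
  so that each summand consists of an Eisenstein constant times a divisor-sum series and an earlier
  moment with its own multiplier; the same holds for the cube.\<close>

lemma crank_zmoment_2:
  "12 * zmoment 2 crank_series = qmono 0 0 0 - qmono 1 0 0"
  (is "_ = ?R")
proof -
  have "12 * zmoment 2 crank_series = 24 * (sigma_fps 1 * qmono 0 0 0)"
    unfolding crank_zmoment_rec by (simp add: algebra_simps)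
  also have "\<dots> = ?R"
    unfolding sigma_fps_mult by (simp add: qmono_mult_simps)
  finally show ?thesis .
qed

lemma crank_zmoment_4:
  "240 * zmoment 4 crank_series = 3 * qmono 0 0 0 - 10 * qmono 1 0 0 + 2 * qmono 0 1 0 + 5 * qmono 2 0 0"
  (is "_ = ?R")
proof -
  have "240 * zmoment 4 crank_series = 2 * (240 * (sigma_fps 3 * qmono 0 0 0))
      + 5 * (24 * (sigma_fps 1 * (12 * zmoment 2 crank_series)))"
    unfolding crank_zmoment_rec by (simp add: algebra_simps)
  also have "\<dots> = ?R"
    unfolding sigma_fps_mult crank_zmoment_2 by (simp add: qmono_mult_simps)
  finally show ?thesis .
qed

lemma crank_zmoment_6:
  "4032 * zmoment 6 crank_series = 9 * qmono 0 0 0 - 63 * qmono 1 0 0 + 42 * qmono 0 1 0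
      + 105 * qmono 2 0 0 - 16 * qmono 0 0 1 - 42 * qmono 1 1 0 - 35 * qmono 3 0 0"
  (is "_ = ?R")
proof -
  have "4032 * zmoment 6 crank_series = 16 * (504 * (sigma_fps 5 * qmono 0 0 0))
      + 28 * (240 * (sigma_fps 3 * (12 * zmoment 2 crank_series)))
      + 7 * (24 * (sigma_fps 1 * (240 * zmoment 4 crank_series)))"
    unfolding crank_zmoment_rec by (simp add: algebra_simps)
  also have "\<dots> = ?R"
    unfolding sigma_fps_mult crank_zmoment_2 crank_zmoment_4 by (simp add: qmono_mult_simps)
  finally show ?thesis .
qed

lemma crank_zmoment_8:
  "34560 * zmoment 8 crank_series = 15 * qmono 0 0 0 - 180 * qmono 1 0 0 + 252 * qmono 0 1 0
      + 630 * qmono 2 0 0 - 320 * qmono 0 0 1 - 840 * qmono 1 1 0 - 700 * qmono 3 0 0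
      + 228 * qmono 0 2 0 + 320 * qmono 1 0 1 + 420 * qmono 2 1 0 + 175 * qmono 4 0 0"
  (is "_ = ?R")
proof -
  have "34560 * zmoment 8 crank_series = 144 * (480 * (sigma_fps 7 * qmono 0 0 0))
      + 240 * (504 * (sigma_fps 5 * (12 * zmoment 2 crank_series)))
      + 42 * (240 * (sigma_fps 3 * (240 * zmoment 4 crank_series)))
      + 5 * (24 * (sigma_fps 1 * (4032 * zmoment 6 crank_series)))"
    unfolding crank_zmoment_rec by (simp add: algebra_simps)
  also have "\<dots> = ?R"
    unfolding sigma_fps_mult crank_zmoment_2 crank_zmoment_4 crank_zmoment_6 by (simp add: qmono_mult_simps)
  finally show ?thesis .
qed

lemma crank_zmoment_10:
  "506880 * zmoment 10 crank_series = 45 * qmono 0 0 0 - 825 * qmono 1 0 0 + 1980 * qmono 0 1 0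
      + 4950 * qmono 2 0 0 - 5280 * qmono 0 0 1 - 13860 * qmono 1 1 0 - 11550 * qmono 3 0 0
      + 12540 * qmono 0 2 0 + 17600 * qmono 1 0 1 + 23100 * qmono 2 1 0 + 9625 * qmono 4 0 0
      - 7360 * qmono 0 1 1 - 12540 * qmono 1 2 0 - 8800 * qmono 2 0 1 - 7700 * qmono 3 1 0
      - 1925 * qmono 5 0 0"
  (is "_ = ?R")
proof -
  have "506880 * zmoment 10 crank_series = 3840 * (264 * (sigma_fps 9 * qmono 0 0 0))
      + 6336 * (480 * (sigma_fps 7 * (12 * zmoment 2 crank_series)))
      + 1056 * (504 * (sigma_fps 5 * (240 * zmoment 4 crank_series)))
      + 88 * (240 * (sigma_fps 3 * (4032 * zmoment 6 crank_series)))
      + 11 * (24 * (sigma_fps 1 * (34560 * zmoment 8 crank_series)))"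
    unfolding crank_zmoment_rec by (simp add: algebra_simps)
  also have "\<dots> = ?R"
    unfolding sigma_fps_mult crank_zmoment_2 crank_zmoment_4 crank_zmoment_6 crank_zmoment_8 by (simp add: qmono_mult_simps)
  finally show ?thesis .
qed

lemma crank_zmoment_12:
  "50319360 * zmoment 12 crank_series = 945 * qmono 0 0 0 - 24570 * qmono 1 0 0 + 90090 * qmono 0 1 0
      + 225225 * qmono 2 0 0 - 411840 * qmono 0 0 1 - 1081080 * qmono 1 1 0 - 900900 * qmono 3 0 0
      + 2054052 * qmono 0 2 0 + 2882880 * qmono 1 0 1 + 3783780 * qmono 2 1 0 + 1576575 * qmono 4 0 0
      - 4018560 * qmono 0 1 1 - 6846840 * qmono 1 2 0 - 4804800 * qmono 2 0 1 - 4204200 * qmono 3 1 0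
      - 1051050 * qmono 5 0 0 + 750080 * qmono 0 0 2 + 1710408 * qmono 0 3 0 + 4018560 * qmono 1 1 1
      + 3423420 * qmono 2 2 0 + 1601600 * qmono 3 0 1 + 1051050 * qmono 4 1 0 + 175175 * qmono 6 0 0"
  (is "_ = ?R")
proof -
  have "50319360 * zmoment 12 crank_series = 1536 * (65520 * (sigma_fps 11 * qmono 0 0 0))
      + 1747200 * (264 * (sigma_fps 9 * (12 * zmoment 2 crank_series)))
      + 288288 * (480 * (sigma_fps 7 * (240 * zmoment 4 crank_series)))
      + 22880 * (504 * (sigma_fps 5 * (4032 * zmoment 6 crank_series)))
      + 2002 * (240 * (sigma_fps 3 * (34560 * zmoment 8 crank_series)))
      + 91 * (24 * (sigma_fps 1 * (506880 * zmoment 10 crank_series)))"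
    unfolding crank_zmoment_rec by (simp add: algebra_simps)
  also have "\<dots> = ?R"
    unfolding sigma_fps_mult crank_zmoment_2 crank_zmoment_4 crank_zmoment_6 crank_zmoment_8 crank_zmoment_10 by (simp add: qmono_mult_simps)
  finally show ?thesis .
qed

lemma cube_zmoment_2:
  "4 * zmoment 2 crank_cube = qmono 0 0 0 - qmono 1 0 0"
  (is "_ = ?R")
proof -
  have "4 * zmoment 2 crank_cube = 24 * (sigma_fps 1 * qmono 0 0 0)"
    unfolding cube_zmoment_rec by (simp add: algebra_simps)
  also have "\<dots> = ?R"
    unfolding sigma_fps_mult by (simp add: qmono_mult_simps)
  finally show ?thesis .
qed

lemma cube_zmoment_4:
  "80 * zmoment 4 crank_cube = 13 * qmono 0 0 0 - 30 * qmono 1 0 0 + 2 * qmono 0 1 0 + 15 * qmono 2 0 0"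
  (is "_ = ?R")
proof -
  have "80 * zmoment 4 crank_cube = 2 * (240 * (sigma_fps 3 * qmono 0 0 0))
      + 15 * (24 * (sigma_fps 1 * (4 * zmoment 2 crank_cube)))"
    unfolding cube_zmoment_rec by (simp add: algebra_simps)
  also have "\<dots> = ?R"
    unfolding sigma_fps_mult cube_zmoment_2 by (simp add: qmono_mult_simps)
  finally show ?thesis .
qed

lemma cube_zmoment_6:
  "1344 * zmoment 6 crank_cube = 205 * qmono 0 0 0 - 819 * qmono 1 0 0 + 126 * qmono 0 1 0
      + 945 * qmono 2 0 0 - 16 * qmono 0 0 1 - 126 * qmono 1 1 0 - 315 * qmono 3 0 0"
  (is "_ = ?R")
proof -
  have "1344 * zmoment 6 crank_cube = 16 * (504 * (sigma_fps 5 * qmono 0 0 0))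
      + 84 * (240 * (sigma_fps 3 * (4 * zmoment 2 crank_cube)))
      + 21 * (24 * (sigma_fps 1 * (80 * zmoment 4 crank_cube)))"
    unfolding cube_zmoment_rec by (simp add: algebra_simps)
  also have "\<dots> = ?R"
    unfolding sigma_fps_mult cube_zmoment_2 cube_zmoment_4 by (simp add: qmono_mult_simps)
  finally show ?thesis .
qed

lemma cube_zmoment_8:
  "3840 * zmoment 8 crank_cube = 671 * qmono 0 0 0 - 4100 * qmono 1 0 0 + 1092 * qmono 0 1 0
      + 8190 * qmono 2 0 0 - 320 * qmono 0 0 1 - 2520 * qmono 1 1 0 - 6300 * qmono 3 0 0
      + 132 * qmono 0 2 0 + 320 * qmono 1 0 1 + 1260 * qmono 2 1 0 + 1575 * qmono 4 0 0"
  (is "_ = ?R")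
proof -
  have "3840 * zmoment 8 crank_cube = 48 * (480 * (sigma_fps 7 * qmono 0 0 0))
      + 240 * (504 * (sigma_fps 5 * (4 * zmoment 2 crank_cube)))
      + 42 * (240 * (sigma_fps 3 * (80 * zmoment 4 crank_cube)))
      + 5 * (24 * (sigma_fps 1 * (1344 * zmoment 6 crank_cube)))"
    unfolding cube_zmoment_rec by (simp add: algebra_simps)
  also have "\<dots> = ?R"
    unfolding sigma_fps_mult cube_zmoment_2 cube_zmoment_4 cube_zmoment_6 by (simp add: qmono_mult_simps)
  finally show ?thesis .
qed

lemma cube_zmoment_10:
  "56320 * zmoment 10 crank_cube = 12775 * qmono 0 0 0 - 110715 * qmono 1 0 0 + 45100 * qmono 0 1 0
      + 338250 * qmono 2 0 0 - 22880 * qmono 0 0 1 - 180180 * qmono 1 1 0 - 450450 * qmono 3 0 0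
      + 21780 * qmono 0 2 0 + 52800 * qmono 1 0 1 + 207900 * qmono 2 1 0 + 259875 * qmono 4 0 0
      - 4800 * qmono 0 1 1 - 21780 * qmono 1 2 0 - 26400 * qmono 2 0 1 - 69300 * qmono 3 1 0
      - 51975 * qmono 5 0 0"
  (is "_ = ?R")
proof -
  have "56320 * zmoment 10 crank_cube = 1280 * (264 * (sigma_fps 9 * qmono 0 0 0))
      + 6336 * (480 * (sigma_fps 7 * (4 * zmoment 2 crank_cube)))
      + 1056 * (504 * (sigma_fps 5 * (80 * zmoment 4 crank_cube)))
      + 88 * (240 * (sigma_fps 3 * (1344 * zmoment 6 crank_cube)))
      + 33 * (24 * (sigma_fps 1 * (3840 * zmoment 8 crank_cube)))"
    unfolding cube_zmoment_rec by (simp add: algebra_simps)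
  also have "\<dots> = ?R"
    unfolding sigma_fps_mult cube_zmoment_2 cube_zmoment_4 cube_zmoment_6 cube_zmoment_8 by (simp add: qmono_mult_simps)
  finally show ?thesis .
qed

lemma cube_zmoment_12:
  "5591040 * zmoment 12 crank_cube = 1793613 * qmono 0 0 0 - 20925450 * qmono 1 0 0
      + 12090078 * qmono 0 1 0 + 90675585 * qmono 2 0 0 - 9380800 * qmono 0 0 1
      - 73873800 * qmono 1 1 0 - 184684500 * qmono 3 0 0 + 15459444 * qmono 0 2 0
      + 37477440 * qmono 1 0 1 + 147567420 * qmono 2 1 0 + 184459275 * qmono 4 0 0
      - 7862400 * qmono 0 1 1 - 35675640 * qmono 1 2 0 - 43243200 * qmono 2 0 1
      - 113513400 * qmono 3 1 0 - 85135050 * qmono 5 0 0 + 494080 * qmono 0 0 2 + 1595160 * qmono 0 3 0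
      + 7862400 * qmono 1 1 1 + 17837820 * qmono 2 2 0 + 14414400 * qmono 3 0 1
      + 28378350 * qmono 4 1 0 + 14189175 * qmono 6 0 0"
  (is "_ = ?R")
proof -
  have "5591040 * zmoment 12 crank_cube = 512 * (65520 * (sigma_fps 11 * qmono 0 0 0))
      + 1747200 * (264 * (sigma_fps 9 * (4 * zmoment 2 crank_cube)))
      + 288288 * (480 * (sigma_fps 7 * (80 * zmoment 4 crank_cube)))
      + 22880 * (504 * (sigma_fps 5 * (1344 * zmoment 6 crank_cube)))
      + 6006 * (240 * (sigma_fps 3 * (3840 * zmoment 8 crank_cube)))
      + 273 * (24 * (sigma_fps 1 * (56320 * zmoment 10 crank_cube)))"
    unfolding cube_zmoment_rec by (simp add: algebra_simps)
  also have "\<dots> = ?R"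
    unfolding sigma_fps_mult cube_zmoment_2 cube_zmoment_4 cube_zmoment_6 cube_zmoment_8 cube_zmoment_10 by (simp add: qmono_mult_simps)
  finally show ?thesis .
qed

section \<open>Multiplication by \<open>n\<close> on the coefficients of the monomials\<close>

definition qcoeff :: "nat \<Rightarrow> nat \<Rightarrow> nat \<Rightarrow> nat \<Rightarrow> real" where
  "qcoeff n i j k = fps_nth (qmono i j k) n"

lemma n_mult_qcoeff:
  "24 * (real n * qcoeff n i j k) = (qcoeff n i j k - qcoeff n (Suc i) j k)
    + real (2 * i) * (qcoeff n (Suc i) j k - qcoeff n (i - 1) (Suc j) k)
    + real (8 * j) * (qcoeff n (Suc i) j k - qcoeff n i (j - 1) (Suc k))
    + real (12 * k) * (qcoeff n (Suc i) j k - qcoeff n i (j + 2) (k - 1))"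
  using arg_cong[OF fps_XD_qmono[of i j k], of "\<lambda>f. fps_nth f n"]
  by (simp only: fps_add_nth fps_sub_nth fps_nth_numeral_mult fps_nth_of_nat_mult fps_XD_nth qcoeff_def)

text \<open>These are all 16 monomials of weight at most 10; those of weight 12 are reached only
  after the last multiplication by \<open>n\<close>.\<close>

lemma n_mult_qcoeff_numeral:
  "real n * qcoeff n 0 0 0 = 1 / 24 * qcoeff n 0 0 0 - 1 / 24 * qcoeff n 1 0 0"
  "real n * qcoeff n 1 0 0 = 1 / 24 * qcoeff n 1 0 0 - 1 / 12 * qcoeff n 0 1 0 + 1 / 24 * qcoeff n 2 0 0"
  "real n * qcoeff n 0 1 0 = 1 / 24 * qcoeff n 0 1 0 - 1 / 3 * qcoeff n 0 0 1 + 7 / 24 * qcoeff n 1 1 0"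
  "real n * qcoeff n 2 0 0 = 1 / 24 * qcoeff n 2 0 0 - 1 / 6 * qcoeff n 1 1 0 + 1 / 8 * qcoeff n 3 0 0"
  "real n * qcoeff n 0 0 1 = 1 / 24 * qcoeff n 0 0 1 - 1 / 2 * qcoeff n 0 2 0 + 11 / 24 * qcoeff n 1 0 1"
  "real n * qcoeff n 1 1 0 = 1 / 24 * qcoeff n 1 1 0 - 1 / 12 * qcoeff n 0 2 0 - 1 / 3 * qcoeff n 1 0 1
      + 3 / 8 * qcoeff n 2 1 0"
  "real n * qcoeff n 3 0 0 = 1 / 24 * qcoeff n 3 0 0 - 1 / 4 * qcoeff n 2 1 0 + 5 / 24 * qcoeff n 4 0 0"
  "real n * qcoeff n 0 2 0 = 1 / 24 * qcoeff n 0 2 0 - 2 / 3 * qcoeff n 0 1 1 + 5 / 8 * qcoeff n 1 2 0"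
  "real n * qcoeff n 1 0 1 = 1 / 24 * qcoeff n 1 0 1 - 1 / 12 * qcoeff n 0 1 1 - 1 / 2 * qcoeff n 1 2 0
      + 13 / 24 * qcoeff n 2 0 1"
  "real n * qcoeff n 2 1 0 = 1 / 24 * qcoeff n 2 1 0 - 1 / 6 * qcoeff n 1 2 0 - 1 / 3 * qcoeff n 2 0 1
      + 11 / 24 * qcoeff n 3 1 0"
  "real n * qcoeff n 4 0 0 = 1 / 24 * qcoeff n 4 0 0 - 1 / 3 * qcoeff n 3 1 0 + 7 / 24 * qcoeff n 5 0 0"
  "real n * qcoeff n 0 1 1 = 1 / 24 * qcoeff n 0 1 1 - 1 / 3 * qcoeff n 0 0 2 - 1 / 2 * qcoeff n 0 3 0
      + 19 / 24 * qcoeff n 1 1 1"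
  "real n * qcoeff n 1 2 0 = 1 / 24 * qcoeff n 1 2 0 - 1 / 12 * qcoeff n 0 3 0 - 2 / 3 * qcoeff n 1 1 1
      + 17 / 24 * qcoeff n 2 2 0"
  "real n * qcoeff n 2 0 1 = 1 / 24 * qcoeff n 2 0 1 - 1 / 6 * qcoeff n 1 1 1 - 1 / 2 * qcoeff n 2 2 0
      + 5 / 8 * qcoeff n 3 0 1"
  "real n * qcoeff n 3 1 0 = 1 / 24 * qcoeff n 3 1 0 - 1 / 4 * qcoeff n 2 2 0 - 1 / 3 * qcoeff n 3 0 1
      + 13 / 24 * qcoeff n 4 1 0"
  "real n * qcoeff n 5 0 0 = 1 / 24 * qcoeff n 5 0 0 - 5 / 12 * qcoeff n 4 1 0 + 3 / 8 * qcoeff n 6 0 0"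
  using n_mult_qcoeff[of n 0 0 0]
    n_mult_qcoeff[of n 1 0 0]
    n_mult_qcoeff[of n 0 1 0]
    n_mult_qcoeff[of n 2 0 0]
    n_mult_qcoeff[of n 0 0 1]
    n_mult_qcoeff[of n 1 1 0]
    n_mult_qcoeff[of n 3 0 0]
    n_mult_qcoeff[of n 0 2 0]
    n_mult_qcoeff[of n 1 0 1]
    n_mult_qcoeff[of n 2 1 0]
    n_mult_qcoeff[of n 4 0 0]
    n_mult_qcoeff[of n 0 1 1]
    n_mult_qcoeff[of n 1 2 0]
    n_mult_qcoeff[of n 2 0 1]
    n_mult_qcoeff[of n 3 1 0]
    n_mult_qcoeff[of n 5 0 0]
  by (simp_all add: numeral_2_eq_2[symmetric])

lemma n_mult_left_commute: "real n * (c * x) = c * (real n * x)" for c x :: real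
  by (rule mult.left_commute)

lemmas n_linear = distrib_left right_diff_distrib mult_minus_right n_mult_left_commute n_mult_qcoeff_numeral

lemma crank_coeff_2: "fps_nth (zmoment 2 crank_series) n = 1 / 12 * qcoeff n 0 0 0 - 1 / 12 * qcoeff n 1 0 0"
  using arg_cong[OF crank_zmoment_2, of "\<lambda>f. fps_nth f n"]
  by (simp only: fps_add_nth fps_sub_nth fps_neg_nth fps_nth_numeral_mult qcoeff_def[symmetric])

lemma crank_coeff_4: "fps_nth (zmoment 4 crank_series) n = 1 / 80 * qcoeff n 0 0 0
    - 1 / 24 * qcoeff n 1 0 0 + 1 / 120 * qcoeff n 0 1 0 + 1 / 48 * qcoeff n 2 0 0"
  using arg_cong[OF crank_zmoment_4, of "\<lambda>f. fps_nth f n"]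
  by (simp only: fps_add_nth fps_sub_nth fps_neg_nth fps_nth_numeral_mult qcoeff_def[symmetric])

lemma crank_coeff_6: "fps_nth (zmoment 6 crank_series) n = 1 / 448 * qcoeff n 0 0 0
    - 1 / 64 * qcoeff n 1 0 0 + 1 / 96 * qcoeff n 0 1 0 + 5 / 192 * qcoeff n 2 0 0
    - 1 / 252 * qcoeff n 0 0 1 - 1 / 96 * qcoeff n 1 1 0 - 5 / 576 * qcoeff n 3 0 0"
  using arg_cong[OF crank_zmoment_6, of "\<lambda>f. fps_nth f n"]
  by (simp only: fps_add_nth fps_sub_nth fps_neg_nth fps_nth_numeral_mult qcoeff_def[symmetric])

lemma crank_coeff_8: "fps_nth (zmoment 8 crank_series) n = 1 / 2304 * qcoeff n 0 0 0
    - 1 / 192 * qcoeff n 1 0 0 + 7 / 960 * qcoeff n 0 1 0 + 7 / 384 * qcoeff n 2 0 0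
    - 1 / 108 * qcoeff n 0 0 1 - 7 / 288 * qcoeff n 1 1 0 - 35 / 1728 * qcoeff n 3 0 0
    + 19 / 2880 * qcoeff n 0 2 0 + 1 / 108 * qcoeff n 1 0 1 + 7 / 576 * qcoeff n 2 1 0
    + 35 / 6912 * qcoeff n 4 0 0"
  using arg_cong[OF crank_zmoment_8, of "\<lambda>f. fps_nth f n"]
  by (simp only: fps_add_nth fps_sub_nth fps_neg_nth fps_nth_numeral_mult qcoeff_def[symmetric])

lemma crank_coeff_10: "fps_nth (zmoment 10 crank_series) n = 1 / 11264 * qcoeff n 0 0 0
    - 5 / 3072 * qcoeff n 1 0 0 + 1 / 256 * qcoeff n 0 1 0 + 5 / 512 * qcoeff n 2 0 0
    - 1 / 96 * qcoeff n 0 0 1 - 7 / 256 * qcoeff n 1 1 0 - 35 / 1536 * qcoeff n 3 0 0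
    + 19 / 768 * qcoeff n 0 2 0 + 5 / 144 * qcoeff n 1 0 1 + 35 / 768 * qcoeff n 2 1 0
    + 175 / 9216 * qcoeff n 4 0 0 - 23 / 1584 * qcoeff n 0 1 1 - 19 / 768 * qcoeff n 1 2 0
    - 5 / 288 * qcoeff n 2 0 1 - 35 / 2304 * qcoeff n 3 1 0 - 35 / 9216 * qcoeff n 5 0 0"
  using arg_cong[OF crank_zmoment_10, of "\<lambda>f. fps_nth f n"]
  by (simp only: fps_add_nth fps_sub_nth fps_neg_nth fps_nth_numeral_mult qcoeff_def[symmetric])

lemma crank_coeff_12: "fps_nth (zmoment 12 crank_series) n = 1 / 53248 * qcoeff n 0 0 0
    - 1 / 2048 * qcoeff n 1 0 0 + 11 / 6144 * qcoeff n 0 1 0 + 55 / 12288 * qcoeff n 2 0 0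
    - 11 / 1344 * qcoeff n 0 0 1 - 11 / 512 * qcoeff n 1 1 0 - 55 / 3072 * qcoeff n 3 0 0
    + 209 / 5120 * qcoeff n 0 2 0 + 11 / 192 * qcoeff n 1 0 1 + 77 / 1024 * qcoeff n 2 1 0
    + 385 / 12288 * qcoeff n 4 0 0 - 23 / 288 * qcoeff n 0 1 1 - 209 / 1536 * qcoeff n 1 2 0
    - 55 / 576 * qcoeff n 2 0 1 - 385 / 4608 * qcoeff n 3 1 0 - 385 / 18432 * qcoeff n 5 0 0
    + 293 / 19656 * qcoeff n 0 0 2 + 10181 / 299520 * qcoeff n 0 3 0 + 23 / 288 * qcoeff n 1 1 1
    + 209 / 3072 * qcoeff n 2 2 0 + 55 / 1728 * qcoeff n 3 0 1 + 385 / 18432 * qcoeff n 4 1 0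
    + 385 / 110592 * qcoeff n 6 0 0"
  using arg_cong[OF crank_zmoment_12, of "\<lambda>f. fps_nth f n"]
  by (simp only: fps_add_nth fps_sub_nth fps_neg_nth fps_nth_numeral_mult qcoeff_def[symmetric])

lemma cube_coeff_4: "fps_nth (zmoment 4 crank_cube) n = 13 / 80 * qcoeff n 0 0 0
    - 3 / 8 * qcoeff n 1 0 0 + 1 / 40 * qcoeff n 0 1 0 + 3 / 16 * qcoeff n 2 0 0"
  using arg_cong[OF cube_zmoment_4, of "\<lambda>f. fps_nth f n"]
  by (simp only: fps_add_nth fps_sub_nth fps_neg_nth fps_nth_numeral_mult qcoeff_def[symmetric])

lemma cube_coeff_6: "fps_nth (zmoment 6 crank_cube) n = 205 / 1344 * qcoeff n 0 0 0
    - 39 / 64 * qcoeff n 1 0 0 + 3 / 32 * qcoeff n 0 1 0 + 45 / 64 * qcoeff n 2 0 0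
    - 1 / 84 * qcoeff n 0 0 1 - 3 / 32 * qcoeff n 1 1 0 - 15 / 64 * qcoeff n 3 0 0"
  using arg_cong[OF cube_zmoment_6, of "\<lambda>f. fps_nth f n"]
  by (simp only: fps_add_nth fps_sub_nth fps_neg_nth fps_nth_numeral_mult qcoeff_def[symmetric])

lemma cube_coeff_8: "fps_nth (zmoment 8 crank_cube) n = 671 / 3840 * qcoeff n 0 0 0
    - 205 / 192 * qcoeff n 1 0 0 + 91 / 320 * qcoeff n 0 1 0 + 273 / 128 * qcoeff n 2 0 0
    - 1 / 12 * qcoeff n 0 0 1 - 21 / 32 * qcoeff n 1 1 0 - 105 / 64 * qcoeff n 3 0 0
    + 11 / 320 * qcoeff n 0 2 0 + 1 / 12 * qcoeff n 1 0 1 + 21 / 64 * qcoeff n 2 1 0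
    + 105 / 256 * qcoeff n 4 0 0"
  using arg_cong[OF cube_zmoment_8, of "\<lambda>f. fps_nth f n"]
  by (simp only: fps_add_nth fps_sub_nth fps_neg_nth fps_nth_numeral_mult qcoeff_def[symmetric])

lemma cube_coeff_10: "fps_nth (zmoment 10 crank_cube) n = 2555 / 11264 * qcoeff n 0 0 0
    - 2013 / 1024 * qcoeff n 1 0 0 + 205 / 256 * qcoeff n 0 1 0 + 3075 / 512 * qcoeff n 2 0 0
    - 13 / 32 * qcoeff n 0 0 1 - 819 / 256 * qcoeff n 1 1 0 - 4095 / 512 * qcoeff n 3 0 0
    + 99 / 256 * qcoeff n 0 2 0 + 15 / 16 * qcoeff n 1 0 1 + 945 / 256 * qcoeff n 2 1 0
    + 4725 / 1024 * qcoeff n 4 0 0 - 15 / 176 * qcoeff n 0 1 1 - 99 / 256 * qcoeff n 1 2 0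
    - 15 / 32 * qcoeff n 2 0 1 - 315 / 256 * qcoeff n 3 1 0 - 945 / 1024 * qcoeff n 5 0 0"
  using arg_cong[OF cube_zmoment_10, of "\<lambda>f. fps_nth f n"]
  by (simp only: fps_add_nth fps_sub_nth fps_neg_nth fps_nth_numeral_mult qcoeff_def[symmetric])

lemma cube_coeff_12: "fps_nth (zmoment 12 crank_cube) n = 597871 / 1863680 * qcoeff n 0 0 0
    - 7665 / 2048 * qcoeff n 1 0 0 + 22143 / 10240 * qcoeff n 0 1 0 + 66429 / 4096 * qcoeff n 2 0 0
    - 2255 / 1344 * qcoeff n 0 0 1 - 6765 / 512 * qcoeff n 1 1 0 - 33825 / 1024 * qcoeff n 3 0 0
    + 14157 / 5120 * qcoeff n 0 2 0 + 429 / 64 * qcoeff n 1 0 1 + 27027 / 1024 * qcoeff n 2 1 0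
    + 135135 / 4096 * qcoeff n 4 0 0 - 45 / 32 * qcoeff n 0 1 1 - 3267 / 512 * qcoeff n 1 2 0
    - 495 / 64 * qcoeff n 2 0 1 - 10395 / 512 * qcoeff n 3 1 0 - 31185 / 2048 * qcoeff n 5 0 0
    + 193 / 2184 * qcoeff n 0 0 2 + 1899 / 6656 * qcoeff n 0 3 0 + 45 / 32 * qcoeff n 1 1 1
    + 3267 / 1024 * qcoeff n 2 2 0 + 165 / 64 * qcoeff n 3 0 1 + 10395 / 2048 * qcoeff n 4 1 0
    + 10395 / 4096 * qcoeff n 6 0 0"
  using arg_cong[OF cube_zmoment_12, of "\<lambda>f. fps_nth f n"]
  by (simp only: fps_add_nth fps_sub_nth fps_neg_nth fps_nth_numeral_mult qcoeff_def[symmetric])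

lemmas moment_coeffs = crank_coeff_2 crank_coeff_4 crank_coeff_6 crank_coeff_8 crank_coeff_10 crank_coeff_12
  cube_coeff_4 cube_coeff_6 cube_coeff_8 cube_coeff_10 cube_coeff_12

lemma rank_coeff_4:
  "fps_nth (rank_fps 4) n = (1 - 12 * real n) * fps_nth (rank_fps 2) n
      + (1 / 3) * fps_nth (zmoment 4 crank_cube) n + (- (2 * real n)) * fps_nth (rank_fps 0) n"
  using cube_moment_4[of n]
  by (simp add: field_simps eval_nat_numeral)

lemma rank_coeff_6:
  "fps_nth (rank_fps 6) n = (108 * real n ^ 2 - 24 * real n + 1) * fps_nth (rank_fps 2) n + (1 / 6
      - 3 * real n) * fps_nth (zmoment 4 crank_cube) n + (1 / 10) * fps_nth (zmoment 6 crank_cube) n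
      + (18 * real n ^ 2 - 8 / 5 * real n) * fps_nth (rank_fps 0) n"
  using cube_moment_6[of n] unfolding rank_coeff_4
  by (simp add: field_simps eval_nat_numeral)

lemma rank_coeff_8:
  "fps_nth (rank_fps 8) n = (360 * real n ^ 2 - 864 * real n ^ 3 - 36 * real n
      + 1) * fps_nth (rank_fps 2) n + (24 * real n ^ 2 - 6 * real n
      + 1 / 3) * fps_nth (zmoment 4 crank_cube) n + (- (4 / 5 * real n)
      - 1 / 15) * fps_nth (zmoment 6 crank_cube) n + (1 / 21) * fps_nth (zmoment 8 crank_cube) n
      + (204 / 5 * real n ^ 2 - 144 * real n ^ 3 - 66 / 35 * real n) * fps_nth (rank_fps 0) n"
  using cube_moment_8[of n] unfolding rank_coeff_4 rank_coeff_6
  by (simp add: field_simps eval_nat_numeral)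

lemma rank_coeff_10:
  "fps_nth (rank_fps 10) n = (6480 * real n ^ 4 - 4320 * real n ^ 3 + 756 * real n ^ 2 - 48 * real n
      + 1) * fps_nth (rank_fps 2) n + (90 * real n ^ 2 - 180 * real n ^ 3 - 17 / 2 * real n
      + 1 / 18) * fps_nth (zmoment 4 crank_cube) n + (6 * real n ^ 2 - real n
      + 17 / 60) * fps_nth (zmoment 6 crank_cube) n + (- (5 / 14 * real n)
      - 5 / 42) * fps_nth (zmoment 8 crank_cube) n + (1 / 36) * fps_nth (zmoment 10 crank_cube) n
      + (1080 * real n ^ 4 - 576 * real n ^ 3 + 414 / 7 * real n ^ 2
      - 52 / 35 * real n) * fps_nth (rank_fps 0) n"
  using cube_moment_10[of n] unfolding rank_coeff_4 rank_coeff_6 rank_coeff_8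
  by (simp add: field_simps eval_nat_numeral)

text \<open>Eliminating the rank moments of orders 4 to 10 in turn leaves only \<open>N_2\<close>.
  The polynomial before it is the one that multiplies \<open>N_2\<close> in the theorem, so
  \<open>N_2\<close> cancels against this part of \<open>N_12\<close>.\<close>

lemma rank_coeff_12:
  "fps_nth (rank_fps 12) n = (45360 * real n ^ 4 - 46656 * real n ^ 5 - 12096 * real n ^ 3
      + 1296 * real n ^ 2 - 60 * real n + 1) * fps_nth (rank_fps 2) n + (1296 * real n ^ 4
      - 1044 * real n ^ 3 + 180 * real n ^ 2 - 25 / 2 * real n
      + 34 / 45) * fps_nth (zmoment 4 crank_cube) n + (102 / 5 * real n ^ 2 - 216 / 5 * real n ^ 3
      - 8 / 5 * real n - 43 / 60) * fps_nth (zmoment 6 crank_cube) n + (18 / 7 * real n ^ 2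
      + 1 / 14 * real n + 101 / 210) * fps_nth (zmoment 8 crank_cube) n + (- (1 / 5 * real n)
      - 5 / 36) * fps_nth (zmoment 10 crank_cube) n + (1 / 55) * fps_nth (zmoment 12 crank_cube) n
      + (32616 / 5 * real n ^ 4 - 7776 * real n ^ 5 - 42624 / 35 * real n ^ 3 + 2988 / 35 * real n ^ 2
      - 922 / 385 * real n) * fps_nth (rank_fps 0) n"
  using cube_moment_12[of n] unfolding rank_coeff_4 rank_coeff_6 rank_coeff_8 rank_coeff_10
  by (simp add: field_simps eval_nat_numeral)

theorem theorem5p2:
  fixes n :: nat
  assumes "n \<ge> 1"
  shows "real_of_int (p23 (n - 1)) =
      1 / 897196601564928 *
        (- 57917897540518785552 * real n ^ 5 + 30652078276547889552 * real n ^ 4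
          + 5952274737922797228 * real n ^ 3 - 2214892612179680256 * real n ^ 2
          + 188772676333745691 * real n - 4410708034409819) * real_of_int (crank_moment 2 n)
    + 5 / 224299150391232 *
        (4089872889595634400 * real n ^ 4 - 3320629034843596140 * real n ^ 3
          + 593555423164294752 * real n ^ 2 - 40741028214970311 * real n
          + 815166233039851) * real_of_int (crank_moment 4 n)
    + 13 / 7120607948928 *
        (- 4612652508217680 * real n ^ 3 + 2500384365901740 * real n ^ 2
          - 190834728931028 * real n + 5730847932535) * real_of_int (crank_moment 6 n)
    + 65 / 24922127821248 *
        (431597256867684 * real n ^ 2 - 112947999359631 * real n
          + 3472477850182) * real_of_int (crank_moment 8 n)
    + 143 / 600533200512 *
        (- 555655003092 * real n + 33496841951) * real_of_int (crank_moment 10 n)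
    + 16986177 / 1919176 * real_of_int (crank_moment 12 n)
    + 24599722121 / 3316336128 *
        (- 46656 * real n ^ 5 + 45360 * real n ^ 4 - 12096 * real n ^ 3
          + 1296 * real n ^ 2 - 60 * real n + 1) * real_of_int (rank_moment 2 n)
    - 24599722121 / 3316336128 * real_of_int (rank_moment 12 n)"
proof -
  have p: "real_of_int (p23 (n - 1)) = 1 / 1728 * qcoeff n 0 3 0 - 1 / 1728 * qcoeff n 0 0 2"
  proof -
    have "partition_fps * delta_fps = qmono 0 3 0 - qmono 0 0 2"
      by (simp add: delta_fps_def qmono_def power3_eq_cube power2_eq_square algebra_simps)
    then have "qmono 0 3 0 - qmono 0 0 2 = 1728 * (fps_X * p23_fps)"
      by (simp only: delta_partition_p23)
    then have "fps_nth (qmono 0 3 0 - qmono 0 0 2) n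
        = fps_nth (1728 * (fps_X * p23_fps)) n" by (rule arg_cong)
    then have "qcoeff n 0 3 0 - qcoeff n 0 0 2 = 1728 * real_of_int (p23 (n - 1))"
      using assms unfolding qcoeff_def fps_sub_nth fps_nth_numeral_mult by (simp add: p23_fps_def)
    then show ?thesis by linarith
  qed
  have r: "real_of_int (rank_moment j n) = fps_nth (rank_fps j) n" for j by (simp add: rank_fps_def)
  have r0: "fps_nth (rank_fps 0) n = qcoeff n 0 0 0" by (simp add: rank_mass qcoeff_def qmono_0)
  let ?q = "qcoeff n" and ?C = "\<lambda>j. fps_nth (zmoment j crank_series) n"
    and ?H = "\<lambda>j. fps_nth (zmoment j crank_cube) n"
  \<comment> \<open>Horner's scheme in \<open>n\<close>: \<open>h0\<close> to \<open>h5\<close> add the coefficients of \<open>n\<^sup>5\<close> to \<open>n\<^sup>0\<close> in the right-hand side,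
    with the rank moments reduced to moments of the cube; \<open>N\<^sub>2\<close> cancels.\<close>
  have h0: "221397499089 / 3838352 * ?q 0 0 0 - 44689735756573137 / 692281328368 * ?C 2
      = 144827547567247425 / 2769125313472 * ?q 0 0 0
      + 14896578585524379 / 2769125313472 * ?q 1 0 0" (is "_ = ?L0")
    unfolding moment_coeffs n_linear by algebra
  have h1: "real n * (?L0) + (23651294966472137 / 692281328368 * ?C 2
      + 1127059328041125 / 12362166578 * ?C 4 - 3714558040271 / 76767040 * ?q 0 0 0
      - 73799166363 / 7676704 * ?H 4)
      = 1969453379131859 / 27691253134720 * ?q 0 1 0
      - 7274558652662631347 / 166147518808320 * ?q 0 0 0
      - 83004107241388609 / 16614751880832 * ?q 1 0 0
      + 3555688118591921 / 11076501253888 * ?q 2 0 0" (is "_ = ?L1")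
    unfolding moment_coeffs n_linear by algebra
  have h2: "real n * (?L1) + (7873379282966663 / 1186767991488 * ?C 2
      - 21961832241029075 / 296691997872 * ?C 4 - 416420018102985 / 49448666312 * ?C 6
      + 910189718477 / 100756740 * ?q 0 0 0 + 713391941509 / 92120448 * ?H 4
      + 24599722121 / 76767040 * ?H 6) = 50399904524787562901 / 6202840702177280 * ?q 0 0 0
      + 627284319697787251 / 531672060186624 * ?q 1 0 0
      - 81942041137630409 / 1329180150466560 * ?q 0 1 0
      - 148273737798946331 / 531672060186624 * ?q 2 0 0 + 457115984427409 / 77535508777216 * ?q 0 0 1
      + 2208343897776697 / 88612010031104 * ?q 1 1 0
      + 20268965529637175 / 531672060186624 * ?q 3 0 0" (is "_ = ?L2")
    unfolding moment_coeffs n_linear by algebra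
  have h3: "real n * (?L2) + (163567962732665 / 12362166578 * ?C 4
      - 106813879831196 / 43267583023 * ?C 2 + 51108485466545 / 11195924448 * ?C 6
      + 779272824899985 / 692281328368 * ?C 8 - 2041776936043 / 3224215680 * ?q 0 0 0
      - 122998610605 / 92120448 * ?H 4 - 418195276057 / 2763613440 * ?H 6
      - 24599722121 / 1289686272 * ?H 8) = 387323680339943797 / 31900323611197440 * ?q 0 1 0
      - 304269472425034496161 / 535925436668116992 * ?q 0 0 0
      - 210310427919377141 / 2126688240746496 * ?q 1 0 0
      + 703870564965014863 / 12760129444478976 * ?q 2 0 0
      - 36437832729619471 / 8373834947939328 * ?q 0 0 1
      - 59555515789422161 / 3190032361119744 * ?q 1 1 0
      - 553878068846147695 / 19140194166718464 * ?q 3 0 0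
      + 223683048176641 / 128113749442560 * ?q 0 2 0 + 15509248991351 / 4804265604096 * ?q 1 0 1
      + 8828822624147 / 1220130947072 * ?q 2 1 0 + 85197222176365 / 14641571364864 * ?q 4 0 0" (is "_
      = ?L3")
    unfolding moment_coeffs n_linear by algebra
  have h4: "real n * (?L3) + (62924225444581897 / 299065533854976 * ?C 2
      - 22633904563872395 / 24922127821248 * ?C 4 - 620212869025841 / 1780151987232 * ?C 6
      - 2447206652792005 / 8307375940416 * ?C 8 - 315312164453 / 2383068256 * ?C 10
      + 11340471897781 / 638394704640 * ?q 0 0 0 + 614993053025 / 6632672256 * ?H 4
      + 24599722121 / 2072710080 * ?H 6 - 24599722121 / 46428705792 * ?H 8
      + 24599722121 / 16581680640 * ?H 10) = 972316886361163989809 / 58951798033492869120 * ?q 0 0 0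
      + 2464877564346635987 / 918729320002486272 * ?q 1 0 0
      - 20652723325228231 / 31900323611197440 * ?q 0 1 0
      - 5409387758338837 / 1822875634925568 * ?q 2 0 0
      + 112559035196760643 / 200972038750543872 * ?q 0 0 1
      + 188785158843626489 / 76560776666873856 * ?q 1 1 0
      + 1799583791094544975 / 459364660001243136 * ?q 3 0 0
      - 73203244619691 / 85409166295040 * ?q 0 2 0 - 6637940167117 / 4117941946368 * ?q 1 0 1
      - 82850005890559 / 21962357047296 * ?q 2 1 0 - 833407974229805 / 263548284567552 * ?q 4 0 0
      + 527905226197 / 1459187896320 * ?q 0 1 1 + 686820837331 / 707485040640 * ?q 1 2 0
      + 49789115561 / 53061378048 * ?q 2 0 1 + 31561418737 / 20213858304 * ?q 3 1 0
      + 67155683803 / 80855433216 * ?q 5 0 0" (is "_ = ?L4")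
    unfolding moment_coeffs n_linear by algebra
  have h5: "real n * (?L4) + (582261595028465 / 32042735770176 * ?C 4
      - 4410708034409819 / 897196601564928 * ?C 2 + 74501023122955 / 7120607948928 * ?C 6
      + 112855530130915 / 12461063910624 * ?C 8 + 4790048398993 / 600533200512 * ?C 10
      + 16986177 / 1919176 * ?C 12 - 24599722121 / 182398487040 * ?H 12
      - 418195276057 / 74617562880 * ?H 4 + 24599722121 / 4627445760 * ?H 6
      - 2484571934221 / 696430586880 * ?H 8 + 122998610605 / 119388100608 * ?H 10)
      = 1 / 1728 * ?q 0 3 0 - 1 / 1728 * ?q 0 0 2" (is "_ = ?L5")
    unfolding moment_coeffs n_linear by algebra
  \<comment> \<open>Read backwards, the scheme replaces \<open>p23\<close> by its Horner form in the
    moments as opaque quantities; both sides are then polynomials in \<open>n\<close> with moments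
    as coefficients.\<close>
  show ?thesis
    unfolding p r crank_moment_eq rank_coeff_12 r0 h5[symmetric] h4[symmetric] h3[symmetric] h2[symmetric] h1[symmetric] h0[symmetric]
    by algebra
qed

end
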